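(* Let $R=\bigoplus_{n\in\mathbb{N}_0}R_n$ be a Noetherian homogeneous ring with local base ring $(R_0,\mathfrak{m}_0)$, let $R_+=\bigoplus_{n\ge 1}R_n$, and let $M$ and $N$ be finitely generated graded $R$-modules. Let $i\in\mathbb{N}_0$ and suppose that $H_{R_+}^i(M,N)$ is $R_+$-cofinite. Then the $R$-module $\Gamma_{\mathfrak{m}_0R}(H_{R_+}^i(M,N))$ is Artinian.
   Context: All rings are commutative. A Noetherian homogeneous ring with local base ring $(R_0,\mathfrak{m}_0)$ is an $\mathbb{N}_0$-graded ring $R=\bigoplus_{n\ge 0}R_n$ such that $R_0$ is a Noetherian local ring with maximal ideal $\mathfrak{m}_0$ and $R=R_0[l_1,\dots,l_r]$ for finitely many $l_1,\dots,l_r\in R_1$. Graded $R$-modules are $\mathbb{Z}$-graded. For an ideal $\mathfrak{a}$ of $R$ and an $R$-module $X$, $\Gamma_{\mathfrak{a}}(X)=\{x\in X:\mathfrak{a}^n x=0 \text{ for some } n\geq 1\}$. For a finitely generated $R$-module $M$, the $i$-th generalized local cohomology module is $H_{\mathfrak{a}}^i(M,X)=\varinjlim_n \mathrm{Ext}_R^i(M/\mathfrak{a}^nM,X)$. An $R$-module $X$ is $\mathfrak{a}$-cofinite if $\mathrm{Supp}_R(X)\subseteq V(\mathfrak{a})$ and $\mathrm{Ext}_R^j(R/\mathfrak{a},X)$ is finitely generated for all $j\ge 0$. *)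

theory Defs
  imports "HOL-Algebra.Module" "HOL-Algebra.Ideal_Product" "HOL-Algebra.Generated_Rings"
    "HOL-Algebra.Ring_Divisibility" "HOL-Library.FSet"
begin

section \<open>Modules over a commutative ring\<close>

text \<open>The \<^typ>\<open>('a, 'b) module\<close> records below carry the (irrelevant) fields
  \<^const>\<open>monoid.mult\<close> and \<^const>\<open>one\<close> of the ring record they extend; these
  are left \<^const>\<open>undefined\<close>.\<close>

definition submodule_span ::
    "('a, 'c) ring_scheme \<Rightarrow> ('a, 'b, 'd) module_scheme \<Rightarrow> 'b set \<Rightarrow> 'b set"
  where "submodule_span R M S = \<Inter> {H. submodule H R M \<and> S \<subseteq> H}"

definition fin_gen_module :: "('a, 'c) ring_scheme \<Rightarrow> ('a, 'b, 'd) module_scheme \<Rightarrow> bool"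
  where "fin_gen_module R M \<longleftrightarrow>
    (\<exists>S. finite S \<and> S \<subseteq> carrier M \<and> submodule_span R M S = carrier M)"

definition artinian_module :: "('a, 'c) ring_scheme \<Rightarrow> ('a, 'b, 'd) module_scheme \<Rightarrow> bool"
  where "artinian_module R M \<longleftrightarrow> module R M \<and>
    (\<forall>H :: nat \<Rightarrow> 'b set. (\<forall>n. submodule (H n) R M) \<and> (\<forall>n. H (Suc n) \<subseteq> H n) \<longrightarrow>
       (\<exists>n. \<forall>m\<ge>n. H m = H n))"

definition self_module :: "('a, 'c) ring_scheme \<Rightarrow> ('a, 'a) module"
  where "self_module R = \<lparr>carrier = carrier R, monoid.mult = undefined, one = undefined,
    zero = \<zero>\<^bsub>R\<^esub>, add = add R, smult = monoid.mult R\<rparr>"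

definition quotient_module :: "('a, 'b, 'd) module_scheme \<Rightarrow> 'b set \<Rightarrow> ('a, 'b set) module"
  where "quotient_module M N = \<lparr>carrier = a_rcosets\<^bsub>M\<^esub> N, monoid.mult = undefined, one = undefined,
    zero = N, add = set_add M, smult = (\<lambda>a C. \<Union>x\<in>C. N +>\<^bsub>M\<^esub> (a \<odot>\<^bsub>M\<^esub> x))\<rparr>"

definition hom_module ::
    "('a, 'c) ring_scheme \<Rightarrow> ('a, 'p, 'e) module_scheme \<Rightarrow> ('a, 'b, 'd) module_scheme
      \<Rightarrow> ('a, 'p \<Rightarrow> 'b) module"
  where "hom_module R P X = \<lparr>
    carrier = {g \<in> carrier P \<rightarrow>\<^sub>E carrier X.
      (\<forall>x\<in>carrier P. \<forall>y\<in>carrier P. g (x \<oplus>\<^bsub>P\<^esub> y) = g x \<oplus>\<^bsub>X\<^esub> g y) \<and>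
      (\<forall>a\<in>carrier R. \<forall>x\<in>carrier P. g (a \<odot>\<^bsub>P\<^esub> x) = a \<odot>\<^bsub>X\<^esub> g x)},
    monoid.mult = undefined, one = undefined,
    zero = (\<lambda>x\<in>carrier P. \<zero>\<^bsub>X\<^esub>),
    add = (\<lambda>g h. \<lambda>x\<in>carrier P. g x \<oplus>\<^bsub>X\<^esub> h x),
    smult = (\<lambda>a g. \<lambda>x\<in>carrier P. a \<odot>\<^bsub>X\<^esub> g x)\<rparr>"

definition ideal_module ::
    "('a, 'c) ring_scheme \<Rightarrow> 'a set \<Rightarrow> ('a, 'b, 'd) module_scheme \<Rightarrow> 'b set"
  where "ideal_module R I M = submodule_span R M {a \<odot>\<^bsub>M\<^esub> x | a x. a \<in> I \<and> x \<in> carrier M}"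

text \<open>\<^const>\<open>ideals_set\<close> is the monoid of ideals under the product of ideals, with
  unit \<^term>\<open>carrier R\<close>; powers of an ideal are powers in that monoid.\<close>

definition ideal_power :: "('a, 'c) ring_scheme \<Rightarrow> 'a set \<Rightarrow> nat \<Rightarrow> 'a set"
  where "ideal_power R I n = I [^]\<^bsub>ideals_set R\<^esub> n"

definition torsion :: "('a, 'c) ring_scheme \<Rightarrow> 'a set \<Rightarrow> ('a, 'b, 'd) module_scheme \<Rightarrow> 'b set"
  where "torsion R I X =
    {x \<in> carrier X. \<exists>n\<ge>1. \<forall>a\<in>ideal_power R I n. a \<odot>\<^bsub>X\<^esub> x = \<zero>\<^bsub>X\<^esub>}"

definition torsion_module ::
    "('a, 'c) ring_scheme \<Rightarrow> 'a set \<Rightarrow> ('a, 'b, 'd) module_scheme \<Rightarrow> ('a, 'b, 'd) module_scheme"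
  where "torsion_module R I X = X\<lparr>carrier := torsion R I X\<rparr>"


section \<open>The standard free resolution\<close>

text \<open>
  Every module \<^term>\<open>M\<close> has the functorial free resolution
  \<open>\<dots> \<rightarrow> F 2 \<rightarrow> F 1 \<rightarrow> F 0 \<rightarrow> M \<rightarrow> 0\<close> in which \<open>F 0\<close> is free on the set \<^term>\<open>carrier M\<close> and
  \<open>F (k + 1)\<close> is free on the underlying set of the kernel of the map leaving \<open>F k\<close>.
  To have all \<open>F k\<close> in one type, a basis element of \<open>F (k + 1)\<close>, which is an
  element \<open>f\<close> of \<open>F k\<close>, is coded by the finite graph of \<open>f\<close> on its support.
\<close>

datatype ('r, 'm) syz = Gen (ungen: 'm) | Syz "(('r, 'm) syz \<times> 'r) fset"

definition syz_code :: "('a, 'c) ring_scheme \<Rightarrow> (('a, 'm) syz \<Rightarrow> 'a) \<Rightarrow> ('a, 'm) syz"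
  where "syz_code R f = Syz (Abs_fset {(b, f b) | b. f b \<noteq> \<zero>\<^bsub>R\<^esub>})"

definition syz_decode :: "('a, 'c) ring_scheme \<Rightarrow> ('a, 'm) syz \<Rightarrow> ('a, 'm) syz \<Rightarrow> 'a"
  where "syz_decode R b = (case b of
      Gen m \<Rightarrow> (\<lambda>c. \<zero>\<^bsub>R\<^esub>)
    | Syz G \<Rightarrow> (\<lambda>c. if \<exists>r. (c, r) |\<in>| G then THE r. (c, r) |\<in>| G else \<zero>\<^bsub>R\<^esub>))"

definition free_module :: "('a, 'c) ring_scheme \<Rightarrow> 's set \<Rightarrow> ('a, 's \<Rightarrow> 'a) module"
  where "free_module R S = \<lparr>
    carrier = {f. (\<forall>b. f b \<in> carrier R) \<and> {b. f b \<noteq> \<zero>\<^bsub>R\<^esub>} \<subseteq> S \<and> finite {b. f b \<noteq> \<zero>\<^bsub>R\<^esub>}},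
    monoid.mult = undefined, one = undefined,
    zero = (\<lambda>b. \<zero>\<^bsub>R\<^esub>),
    add = (\<lambda>f g b. f b \<oplus>\<^bsub>R\<^esub> g b),
    smult = (\<lambda>a f b. a \<otimes>\<^bsub>R\<^esub> f b)\<rparr>"

text \<open>The augmentation \<open>F 0 \<rightarrow> M\<close>, sending the basis element \<^term>\<open>Gen x\<close> to \<^term>\<open>x\<close>, and
  the differential \<open>F (k + 1) \<rightarrow> F k\<close>, sending the basis element coding \<open>f\<close> to \<open>f\<close>; its
  values are computed pointwise, so one formula serves for all \<open>k\<close>.\<close>

definition augmentation ::
    "('a, 'c) ring_scheme \<Rightarrow> ('a, 'm, 'd) module_scheme \<Rightarrow> (('a, 'm) syz \<Rightarrow> 'a) \<Rightarrow> 'm"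
  where "augmentation R M f = (\<Oplus>\<^bsub>M\<^esub>b\<in>{b. f b \<noteq> \<zero>\<^bsub>R\<^esub>}. f b \<odot>\<^bsub>M\<^esub> ungen b)"

definition differential ::
    "('a, 'c) ring_scheme \<Rightarrow> (('a, 'm) syz \<Rightarrow> 'a) \<Rightarrow> ('a, 'm) syz \<Rightarrow> 'a"
  where "differential R f = (\<lambda>c. \<Oplus>\<^bsub>R\<^esub>b\<in>{b. f b \<noteq> \<zero>\<^bsub>R\<^esub>}. f b \<otimes>\<^bsub>R\<^esub> syz_decode R b c)"

primrec res_basis ::
    "('a, 'c) ring_scheme \<Rightarrow> ('a, 'm, 'd) module_scheme \<Rightarrow> nat \<Rightarrow> ('a, 'm) syz set"
  where
    "res_basis R M 0 = Gen ` carrier M"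
  | "res_basis R M (Suc k) = syz_code R `
      {f \<in> carrier (free_module R (res_basis R M k)).
        if k = 0 then augmentation R M f = \<zero>\<^bsub>M\<^esub> else differential R f = (\<lambda>c. \<zero>\<^bsub>R\<^esub>)}"

definition res_module ::
    "('a, 'c) ring_scheme \<Rightarrow> ('a, 'm, 'd) module_scheme \<Rightarrow> nat
      \<Rightarrow> ('a, ('a, 'm) syz \<Rightarrow> 'a) module"
  where "res_module R M k = free_module R (res_basis R M k)"

text \<open>A linear map \<open>\<phi>\<close> from \<open>M\<close> to \<open>M'\<close> induces a chain map between the
  resolutions, given on bases by \<open>Gen x \<mapsto> Gen (\<phi> x)\<close> in degree \<open>0\<close> and by applying
  the map of degree \<open>k\<close> to the coded element in degree \<open>k + 1\<close>.\<close>

definition push_forward :: "('a, 'c) ring_scheme \<Rightarrow> ('s \<Rightarrow> 't) \<Rightarrow> ('s \<Rightarrow> 'a) \<Rightarrow> 't \<Rightarrow> 'a"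
  where "push_forward R \<beta> f = (\<lambda>c. \<Oplus>\<^bsub>R\<^esub>b\<in>{b. f b \<noteq> \<zero>\<^bsub>R\<^esub> \<and> \<beta> b = c}. f b)"

primrec res_basis_map ::
    "('a, 'c) ring_scheme \<Rightarrow> ('m \<Rightarrow> 'n) \<Rightarrow> nat \<Rightarrow> ('a, 'm) syz \<Rightarrow> ('a, 'n) syz"
  where
    "res_basis_map R \<phi> 0 = (\<lambda>b. Gen (\<phi> (ungen b)))"
  | "res_basis_map R \<phi> (Suc k) =
      (\<lambda>b. syz_code R (push_forward R (res_basis_map R \<phi> k) (syz_decode R b)))"

definition res_map ::
    "('a, 'c) ring_scheme \<Rightarrow> ('m \<Rightarrow> 'n) \<Rightarrow> nat
      \<Rightarrow> (('a, 'm) syz \<Rightarrow> 'a) \<Rightarrow> ('a, 'n) syz \<Rightarrow> 'a"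
  where "res_map R \<phi> k = push_forward R (res_basis_map R \<phi> k)"


section \<open>Ext\<close>

abbreviation res_hom ::
    "('a, 'c) ring_scheme \<Rightarrow> nat \<Rightarrow> ('a, 'm, 'd) module_scheme \<Rightarrow> ('a, 'x, 'e) module_scheme
      \<Rightarrow> ('a, (('a, 'm) syz \<Rightarrow> 'a) \<Rightarrow> 'x) module"
  where "res_hom R i M X \<equiv> hom_module R (res_module R M i) X"

definition ext_cocycles ::
    "('a, 'c) ring_scheme \<Rightarrow> nat \<Rightarrow> ('a, 'm, 'd) module_scheme \<Rightarrow> ('a, 'x, 'e) module_scheme
      \<Rightarrow> ((('a, 'm) syz \<Rightarrow> 'a) \<Rightarrow> 'x) set"
  where "ext_cocycles R i M X = {g \<in> carrier (res_hom R i M X).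
    \<forall>f\<in>carrier (res_module R M (Suc i)). g (differential R f) = \<zero>\<^bsub>X\<^esub>}"

definition ext_coboundaries ::
    "('a, 'c) ring_scheme \<Rightarrow> nat \<Rightarrow> ('a, 'm, 'd) module_scheme \<Rightarrow> ('a, 'x, 'e) module_scheme
      \<Rightarrow> ((('a, 'm) syz \<Rightarrow> 'a) \<Rightarrow> 'x) set"
  where "ext_coboundaries R i M X = (case i of
      0 \<Rightarrow> {\<zero>\<^bsub>res_hom R 0 M X\<^esub>}
    | Suc k \<Rightarrow> (\<lambda>h. \<lambda>f\<in>carrier (res_module R M (Suc k)). h (differential R f)) `
        carrier (res_hom R k M X))"

definition Ext ::
    "('a, 'c) ring_scheme \<Rightarrow> nat \<Rightarrow> ('a, 'm, 'd) module_scheme \<Rightarrow> ('a, 'x, 'e) module_scheme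
      \<Rightarrow> ('a, ((('a, 'm) syz \<Rightarrow> 'a) \<Rightarrow> 'x) set) module"
  where "Ext R i M X = quotient_module
    ((res_hom R i M X)\<lparr>carrier := ext_cocycles R i M X\<rparr>) (ext_coboundaries R i M X)"

text \<open>For a linear map \<open>\<phi>\<close> from \<open>M\<close> to \<open>M'\<close>, the induced map from
  \<open>Ext R i M' X\<close> to \<open>Ext R i M X\<close>.\<close>

definition Ext_map ::
    "('a, 'c) ring_scheme \<Rightarrow> nat \<Rightarrow> ('a, 'm, 'd) module_scheme \<Rightarrow> ('m \<Rightarrow> 'n)
      \<Rightarrow> ('a, 'x, 'e) module_scheme
      \<Rightarrow> ((('a, 'n) syz \<Rightarrow> 'a) \<Rightarrow> 'x) set \<Rightarrow> ((('a, 'm) syz \<Rightarrow> 'a) \<Rightarrow> 'x) set"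
  where "Ext_map R i M \<phi> X C = (\<Union>g\<in>C. ext_coboundaries R i M X +>\<^bsub>res_hom R i M X\<^esub>
    (\<lambda>f\<in>carrier (res_module R M i). g (res_map R \<phi> i f)))"


section \<open>Direct limits of sequences of modules\<close>

text \<open>For a sequence \<open>D 0 \<rightarrow> D 1 \<rightarrow> \<dots>\<close> of modules with transition maps
  \<open>t n\<close> from \<open>D n\<close> to \<open>D (n + 1)\<close>, elements of the limit are classes of pairs
  \<open>(n, x)\<close> with \<open>x\<close> in \<open>D n\<close>.\<close>

primrec transition :: "(nat \<Rightarrow> 'b \<Rightarrow> 'b) \<Rightarrow> nat \<Rightarrow> nat \<Rightarrow> 'b \<Rightarrow> 'b"
  where
    "transition t n 0 = (\<lambda>x. x)"
  | "transition t n (Suc k) = (\<lambda>x. t (n + k) (transition t n k x))"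

definition lim_class ::
    "(nat \<Rightarrow> ('a, 'b, 'd) module_scheme) \<Rightarrow> (nat \<Rightarrow> 'b \<Rightarrow> 'b) \<Rightarrow> nat \<Rightarrow> 'b \<Rightarrow> (nat \<times> 'b) set"
  where "lim_class D t n x = {(m, y). y \<in> carrier (D m) \<and>
    (\<exists>j k. n + j = m + k \<and> transition t n j x = transition t m k y)}"

definition direct_limit ::
    "(nat \<Rightarrow> ('a, 'b, 'd) module_scheme) \<Rightarrow> (nat \<Rightarrow> 'b \<Rightarrow> 'b) \<Rightarrow> ('a, (nat \<times> 'b) set) module"
  where "direct_limit D t = \<lparr>
    carrier = {lim_class D t n x | n x. x \<in> carrier (D n)},
    monoid.mult = undefined, one = undefined,
    zero = lim_class D t 0 \<zero>\<^bsub>D 0\<^esub>,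
    add = (\<lambda>C C'. \<Union>(n, x)\<in>C. \<Union>(m, y)\<in>C'.
      lim_class D t (n + m) (transition t n m x \<oplus>\<^bsub>D (n + m)\<^esub> transition t m n y)),
    smult = (\<lambda>a C. \<Union>(n, x)\<in>C. lim_class D t n (a \<odot>\<^bsub>D n\<^esub> x))\<rparr>"


section \<open>Generalized local cohomology and cofiniteness\<close>

definition truncation ::
    "('a, 'c) ring_scheme \<Rightarrow> 'a set \<Rightarrow> ('a, 'm, 'd) module_scheme \<Rightarrow> nat \<Rightarrow> ('a, 'm set) module"
  where "truncation R I M n = quotient_module M (ideal_module R (ideal_power R I n) M)"

text \<open>The canonical map from \<open>M / I^(n+1) M\<close> to \<open>M / I^n M\<close>, sending the coset of \<open>x\<close>
  to \<open>I^n M + x\<close>.\<close>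

definition truncation_map ::
    "('a, 'c) ring_scheme \<Rightarrow> 'a set \<Rightarrow> ('a, 'm, 'd) module_scheme \<Rightarrow> nat \<Rightarrow> 'm set \<Rightarrow> 'm set"
  where "truncation_map R I M n C = ideal_module R (ideal_power R I n) M <+>\<^bsub>M\<^esub> C"

text \<open>The limit runs over all \<open>n \<ge> 0\<close>; the zero module at \<open>n = 0\<close> does not affect it.\<close>

definition local_cohomology ::
    "('a, 'c) ring_scheme \<Rightarrow> 'a set \<Rightarrow> nat \<Rightarrow> ('a, 'm, 'd) module_scheme \<Rightarrow> ('a, 'x, 'e) module_scheme
      \<Rightarrow> ('a, (nat \<times> ((('a, 'm set) syz \<Rightarrow> 'a) \<Rightarrow> 'x) set) set) module"
  where "local_cohomology R I i M X = direct_limit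
    (\<lambda>n. Ext R i (truncation R I M n) X)
    (\<lambda>n. Ext_map R i (truncation R I M (Suc n)) (truncation_map R I M n) X)"

text \<open>The fraction \<open>x / s\<close> in the localization of \<open>X\<close> at the prime \<open>P\<close>, as an
  equivalence class of pairs, and the set of all fractions.\<close>

definition fraction ::
    "('a, 'c) ring_scheme \<Rightarrow> 'a set \<Rightarrow> ('a, 'x, 'e) module_scheme \<Rightarrow> 'x \<Rightarrow> 'a \<Rightarrow> ('x \<times> 'a) set"
  where "fraction R P X x s = {(y, t). y \<in> carrier X \<and> t \<in> carrier R - P \<and>
    (\<exists>u\<in>carrier R - P. u \<odot>\<^bsub>X\<^esub> (t \<odot>\<^bsub>X\<^esub> x) = u \<odot>\<^bsub>X\<^esub> (s \<odot>\<^bsub>X\<^esub> y))}"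

definition localization ::
    "('a, 'c) ring_scheme \<Rightarrow> 'a set \<Rightarrow> ('a, 'x, 'e) module_scheme \<Rightarrow> ('x \<times> 'a) set set"
  where "localization R P X = {fraction R P X x s | x s. x \<in> carrier X \<and> s \<in> carrier R - P}"

definition support :: "('a, 'c) ring_scheme \<Rightarrow> ('a, 'x, 'e) module_scheme \<Rightarrow> 'a set set"
  where "support R X =
    {P. primeideal P R \<and> localization R P X \<noteq> {fraction R P X \<zero>\<^bsub>X\<^esub> \<one>\<^bsub>R\<^esub>}}"

definition vanishing_set :: "('a, 'c) ring_scheme \<Rightarrow> 'a set \<Rightarrow> 'a set set"
  where "vanishing_set R I = {P. primeideal P R \<and> I \<subseteq> P}"

definition cofinite_module :: "('a, 'c) ring_scheme \<Rightarrow> 'a set \<Rightarrow> ('a, 'x, 'e) module_scheme \<Rightarrow> bool"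
  where "cofinite_module R I X \<longleftrightarrow> support R X \<subseteq> vanishing_set R I \<and>
    (\<forall>j. fin_gen_module R (Ext R j (quotient_module (self_module R) I) X))"


section \<open>Graded rings and modules\<close>

locale graded_ring = cring R for R (structure) +
  fixes A :: "nat \<Rightarrow> 'a set"
  assumes component_subgroup: "additive_subgroup (A n) R"
    and component_mult: "\<lbrakk>a \<in> A n; b \<in> A m\<rbrakk> \<Longrightarrow> a \<otimes> b \<in> A (n + m)"
    and decomposition: "x \<in> carrier R \<Longrightarrow>
      \<exists>!f. (\<forall>n. f n \<in> A n) \<and> finite {n. f n \<noteq> \<zero>} \<and> x = (\<Oplus>n\<in>{n. f n \<noteq> \<zero>}. f n)"

locale noetherian_homogeneous_ring = graded_ring R A for R (structure) and A +
  fixes m0 :: "'a set"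
  assumes base_noetherian: "noetherian_ring (R\<lparr>carrier := A 0\<rparr>)"
    and base_local: "{I. maximalideal I (R\<lparr>carrier := A 0\<rparr>)} = {m0}"
    and generated_in_degree_one:
      "\<exists>L. finite L \<and> L \<subseteq> A 1 \<and> generate_ring R (A 0 \<union> L) = carrier R"

locale graded_module = graded_ring R A + module R M
  for R :: "('a, 'c) ring_scheme" (structure) and A and M :: "('a, 'b, 'd) module_scheme" (structure) +
  fixes G :: "int \<Rightarrow> 'b set"
  assumes component_submodule: "additive_subgroup (G k) M"
    and component_smult: "\<lbrakk>a \<in> A n; x \<in> G k\<rbrakk> \<Longrightarrow> a \<odot>\<^bsub>M\<^esub> x \<in> G (int n + k)"
    and module_decomposition: "x \<in> carrier M \<Longrightarrow>
      \<exists>!f. (\<forall>k. f k \<in> G k) \<and> finite {k. f k \<noteq> \<zero>\<^bsub>M\<^esub>} \<and>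
        x = (\<Oplus>\<^bsub>M\<^esub>k\<in>{k. f k \<noteq> \<zero>\<^bsub>M\<^esub>}. f k)"

definition irrelevant_ideal :: "('a, 'c) ring_scheme \<Rightarrow> (nat \<Rightarrow> 'a set) \<Rightarrow> 'a set"
  where "irrelevant_ideal R A =
    {(\<Oplus>\<^bsub>R\<^esub>n\<in>F. f n) | F f. finite F \<and> 0 \<notin> F \<and> (\<forall>n\<in>F. f n \<in> A n)}"

end

theory Submission
  imports Defs
begin

text \<open>Let \<open>X\<close> be the local cohomology module and \<open>W = \<Gamma>(X)\<close> its \<open>m0\<close>-torsion. All that matters about \<open>X\<close>
  is that it is a cofinite \<open>R\<close>-module. The condition on the support says that every element of \<open>X\<close>
  is killed by a power of each element of \<open>R+\<close>, and \<open>Ext\<^sup>0(R/R+, X)\<close> is the submodule \<open>C\<close> of elements killed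
  by \<open>R+\<close>, which is therefore a finitely generated module over \<open>R0 = R/R+\<close>. As \<open>R0\<close> is Noetherian, the
  elements of \<open>W\<close> killed by \<open>R+\<close> and \<open>m0\<close> form a finite-dimensional vector space over \<open>R0/m0\<close>,
  which is Artinian. If \<open>a\<close> acts locally nilpotently on a module and the kernel of \<open>a\<close> is Artinian,
  then so is the module; applying this to finitely many generators of \<open>R+\<close> and \<open>m0\<close>, one after the other, shows
  that \<open>W\<close> is Artinian.\<close>

section \<open>Linear maps, submodules and quotients\<close>

text \<open>The overview takes for granted that \<open>X\<close> is an \<open>R\<close>-module. This
  has to be earned: an element of \<open>local_cohomology\<close> is a class in a direct limit of
  cosets of cochains on a resolution with coded basis elements, and no module axiom holds by
  construction. For quotients and limits alike, the axioms are transported along linear maps from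
  modules already known.

  The finiteness argument moves between two rings of scalars. \<open>m0\<close> is a maximal ideal
  of \<open>A 0\<close> and in general not even an ideal of \<open>R\<close>, so the Noetherian
  property and linear algebra are used over \<open>A 0\<close>, while the chains to be stopped
  consist of \<open>R\<close>-submodules. The bridge is the decomposition of \<open>R\<close> into
  \<open>A 0\<close> and R+: on elements killed by R+ the two rings have the same submodules.

  The passage from the kernel of \<open>a\<close> to the whole module is delicate because the
  exponents killing the elements need not be bounded. Hence there may be no finite filtration by
  kernels of powers of \<open>a\<close> to induct on; a double chain replaces it, and for large
  exponents it is controlled by its diagonal.\<close>

definition linear_map ::
    "('a, 'c) ring_scheme \<Rightarrow> ('a, 'b, 'd) module_scheme \<Rightarrow> ('a, 'e, 'f) module_scheme
      \<Rightarrow> ('b \<Rightarrow> 'e) \<Rightarrow> bool"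
  where "linear_map R M N f \<longleftrightarrow> f \<in> carrier M \<rightarrow> carrier N \<and>
    (\<forall>x\<in>carrier M. \<forall>y\<in>carrier M. f (x \<oplus>\<^bsub>M\<^esub> y) = f x \<oplus>\<^bsub>N\<^esub> f y) \<and>
    (\<forall>a\<in>carrier R. \<forall>x\<in>carrier M. f (a \<odot>\<^bsub>M\<^esub> x) = a \<odot>\<^bsub>N\<^esub> f x)"

lemma linear_mapI:
  assumes "\<And>x. x \<in> carrier M \<Longrightarrow> f x \<in> carrier N"
    and "\<And>x y. \<lbrakk>x \<in> carrier M; y \<in> carrier M\<rbrakk> \<Longrightarrow> f (x \<oplus>\<^bsub>M\<^esub> y) = f x \<oplus>\<^bsub>N\<^esub> f y"
    and "\<And>a x. \<lbrakk>a \<in> carrier R; x \<in> carrier M\<rbrakk> \<Longrightarrow> f (a \<odot>\<^bsub>M\<^esub> x) = a \<odot>\<^bsub>N\<^esub> f x"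
  shows "linear_map R M N f"
  using assms unfolding linear_map_def by auto

lemma linear_map_closed: "\<lbrakk>linear_map R M N f; x \<in> carrier M\<rbrakk> \<Longrightarrow> f x \<in> carrier N"
  unfolding linear_map_def by auto

lemma linear_map_add:
  "\<lbrakk>linear_map R M N f; x \<in> carrier M; y \<in> carrier M\<rbrakk> \<Longrightarrow> f (x \<oplus>\<^bsub>M\<^esub> y) = f x \<oplus>\<^bsub>N\<^esub> f y"
  unfolding linear_map_def by auto

lemma linear_map_smult:
  "\<lbrakk>linear_map R M N f; a \<in> carrier R; x \<in> carrier M\<rbrakk> \<Longrightarrow> f (a \<odot>\<^bsub>M\<^esub> x) = a \<odot>\<^bsub>N\<^esub> f x"
  unfolding linear_map_def by auto

lemma linear_map_zero:
  assumes "module R M" "module R N" "linear_map R M N f"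
  shows "f \<zero>\<^bsub>M\<^esub> = \<zero>\<^bsub>N\<^esub>"
proof -
  interpret M: module R M by fact
  interpret N: module R N by fact
  have "f \<zero>\<^bsub>M\<^esub> = f (\<zero>\<^bsub>R\<^esub> \<odot>\<^bsub>M\<^esub> \<zero>\<^bsub>M\<^esub>)"
    by simp
  also have "\<dots> = \<zero>\<^bsub>R\<^esub> \<odot>\<^bsub>N\<^esub> f \<zero>\<^bsub>M\<^esub>"
    by (rule linear_map_smult[OF assms(3)]) auto
  also have "\<dots> = \<zero>\<^bsub>N\<^esub>"
    using linear_map_closed[OF assms(3)] by simp
  finally show ?thesis .
qed

lemma linear_map_comp:
  assumes "linear_map R M N f" "linear_map R N P g"
  shows "linear_map R M P (\<lambda>x. g (f x))"
  using assms unfolding linear_map_def by (auto simp: Pi_iff)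

text \<open>A negative is a multiple by the scalar -1, so closure under scalars already gives
  closure under negatives.\<close>

lemma module_submoduleI:
  assumes "module R M" and sub: "H \<subseteq> carrier M" and zero: "\<zero>\<^bsub>M\<^esub> \<in> H"
    and add: "\<And>x y. \<lbrakk>x \<in> H; y \<in> H\<rbrakk> \<Longrightarrow> x \<oplus>\<^bsub>M\<^esub> y \<in> H"
    and smult: "\<And>a x. \<lbrakk>a \<in> carrier R; x \<in> H\<rbrakk> \<Longrightarrow> a \<odot>\<^bsub>M\<^esub> x \<in> H"
  shows "submodule H R M"
proof -
  interpret M: module R M by fact
  show ?thesis
  proof (rule M.submoduleI)
    fix x assume x: "x \<in> H"
    then have "x \<in> carrier M" using sub by auto
    then have "\<ominus>\<^bsub>M\<^esub> x = (\<ominus>\<^bsub>R\<^esub> \<one>\<^bsub>R\<^esub>) \<odot>\<^bsub>M\<^esub> x"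
      by (simp add: M.smult_l_minus)
    then show "\<ominus>\<^bsub>M\<^esub> x \<in> H" using smult[OF _ x] by simp
  qed (use assms in auto)
qed

lemma submodule_zero: "submodule H R M \<Longrightarrow> \<zero>\<^bsub>M\<^esub> \<in> H"
  using subgroup.one_closed[OF submodule.axioms(1)] by fastforce

lemma submodule_add: "\<lbrakk>submodule H R M; x \<in> H; y \<in> H\<rbrakk> \<Longrightarrow> x \<oplus>\<^bsub>M\<^esub> y \<in> H"
  using subgroup.m_closed[OF submodule.axioms(1)] by fastforce

lemma submodule_subset: "submodule H R M \<Longrightarrow> H \<subseteq> carrier M"
  using subgroup.subset[OF submodule.axioms(1)] by fastforce

lemma submodule_minus:
  assumes "module R M" "submodule H R M" "x \<in> H" "y \<in> H"
  shows "x \<ominus>\<^bsub>M\<^esub> y \<in> H"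
  using assms submodule_add[OF assms(2,3)] module.submoduleE(3)[OF assms(1,2)]
  by (simp add: a_minus_def)

lemma submodule_carrier_restrict:
  assumes "module R M" "submodule H R M" "submodule K R M" "K \<subseteq> H"
  shows "submodule K R (M\<lparr>carrier := H\<rparr>)"
  by (rule module_submoduleI[OF submodule.submodule_is_module[OF assms(2,1)]])
    (use assms submodule_zero[OF assms(3)] submodule_add[OF assms(3)]
      submodule.smult_closed[OF assms(3)] in auto)

lemma submodule_image:
  assumes "module R M" "module R N" "linear_map R M N f" "submodule H R M"
  shows "submodule (f ` H) R N"
proof (rule module_submoduleI[OF assms(2)])
  note sub = submodule_subset[OF assms(4)]
  show "f ` H \<subseteq> carrier N" using linear_map_closed[OF assms(3)] sub by auto
  show "\<zero>\<^bsub>N\<^esub> \<in> f ` H"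
    using linear_map_zero[OF assms(1-3)] submodule_zero[OF assms(4)] by force
  show "x \<oplus>\<^bsub>N\<^esub> y \<in> f ` H" if xy: "x \<in> f ` H" "y \<in> f ` H" for x y
  proof -
    obtain u v where "u \<in> H" "v \<in> H" "x = f u" "y = f v" using xy by auto
    then show ?thesis
      using linear_map_add[OF assms(3), of u v] sub submodule_add[OF assms(4), of u v]
      by (metis image_eqI subsetD)
  qed
  show "a \<odot>\<^bsub>N\<^esub> x \<in> f ` H" if ax: "a \<in> carrier R" "x \<in> f ` H" for a x
  proof -
    obtain u where "u \<in> H" "x = f u" using ax by auto
    then show ?thesis
      using linear_map_smult[OF assms(3) ax(1), of u] sub submodule.smult_closed[OF assms(4) ax(1), of u]
      by (metis image_eqI subsetD)
  qed
qed

lemma submodule_vimage: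
  assumes "module R M" "module R N" "linear_map R M N f" "submodule K R N"
  shows "submodule {x \<in> carrier M. f x \<in> K} R M"
proof -
  interpret M: module R M by fact
  show ?thesis
    by (rule module_submoduleI[OF assms(1)])
      (use linear_map_zero[OF assms(1-3)] submodule_zero[OF assms(4)] submodule_add[OF assms(4)]
        submodule.smult_closed[OF assms(4)] linear_map_add[OF assms(3)] linear_map_smult[OF assms(3)]
       in auto)
qed

lemma submodule_singleton_zero:
  assumes "module R M" shows "submodule {\<zero>\<^bsub>M\<^esub>} R M"
proof -
  interpret M: module R M by fact
  show ?thesis by (rule module_submoduleI[OF assms]) auto
qed

lemma submodule_Inter:
  assumes "module R M" "\<And>H. H \<in> \<H> \<Longrightarrow> submodule H R M" "\<H> \<noteq> {}"
  shows "submodule (\<Inter>\<H>) R M"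
proof (rule module_submoduleI[OF assms(1)])
  show "\<Inter>\<H> \<subseteq> carrier M" using assms(2,3) submodule_subset[of _ R M] by (metis Inf_lower2 ex_in_conv)
qed (auto dest: assms(2) intro: submodule_zero submodule_add submodule.smult_closed)

text \<open>A module axiom involves at most three elements, so it holds in \<open>Q\<close> once any
  three lie in the image of one module under a map respecting the operations. A quotient needs one
  chart, a direct limit one for each stage. The zero is treated separately in \<open>f0\<close>
  because \<open>linear_map_zero\<close> presupposes a target known to be a module.\<close>

lemma module_by_charts:
  assumes "cring R" and D: "\<And>i. module R (D i)" and f: "\<And>i. linear_map R (D i) Q (f i)"
    and f0: "\<And>i. f i \<zero>\<^bsub>D i\<^esub> = \<zero>\<^bsub>Q\<^esub>"
    and chart: "\<And>x y z. \<lbrakk>x \<in> carrier Q; y \<in> carrier Q; z \<in> carrier Q\<rbrakk> \<Longrightarrow>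
      \<exists>i. {x, y, z} \<subseteq> f i ` carrier (D i)"
  shows "module R Q"
proof -
  have ex: "\<exists>i u v w. u \<in> carrier (D i) \<and> v \<in> carrier (D i) \<and> w \<in> carrier (D i) \<and>
      x = f i u \<and> y = f i v \<and> z = f i w"
    if xyz: "x \<in> carrier Q" "y \<in> carrier Q" "z \<in> carrier Q" for x y z
  proof -
    obtain i where "x \<in> f i ` carrier (D i)" "y \<in> f i ` carrier (D i)" "z \<in> f i ` carrier (D i)"
      using chart[OF xyz] by auto
    then obtain u v w where "u \<in> carrier (D i)" "v \<in> carrier (D i)" "w \<in> carrier (D i)"
        "x = f i u" "y = f i v" "z = f i w"
      by (elim imageE)
    then show ?thesis
      by (intro exI conjI)
  qed
  have add: "f i u \<oplus>\<^bsub>Q\<^esub> f i v = f i (u \<oplus>\<^bsub>D i\<^esub> v)" if "u \<in> carrier (D i)" "v \<in> carrier (D i)" for i u v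
    using linear_map_add[OF f that] by (rule sym)
  have smult: "a \<odot>\<^bsub>Q\<^esub> f i u = f i (a \<odot>\<^bsub>D i\<^esub> u)" if "a \<in> carrier R" "u \<in> carrier (D i)" for i u a
    using linear_map_smult[OF f that] by (rule sym)
  have clos: "f i u \<in> carrier Q" if "u \<in> carrier (D i)" for i u
    using linear_map_closed[OF f that] .
  have D0: "\<zero>\<^bsub>D i\<^esub> \<in> carrier (D i)" for i
    using D[of i] by (simp add: module_def abelian_group_def abelian_monoid.zero_closed)
  show ?thesis
  proof (rule moduleI[OF assms(1) abelian_groupI])
    show "\<zero>\<^bsub>Q\<^esub> \<in> carrier Q" using f0 clos[OF D0] by metis
  next
    fix x y assume "x \<in> carrier Q" "y \<in> carrier Q"
    then obtain i u v where *: "u \<in> carrier (D i)" "v \<in> carrier (D i)" "x = f i u" "y = f i v"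
      using ex by blast
    interpret Di: module R "D i" by (rule D)
    show "x \<oplus>\<^bsub>Q\<^esub> y \<in> carrier Q" "x \<oplus>\<^bsub>Q\<^esub> y = y \<oplus>\<^bsub>Q\<^esub> x"
      using * by (auto simp: add clos Di.M.a_comm)
  next
    fix x y z assume "x \<in> carrier Q" "y \<in> carrier Q" "z \<in> carrier Q"
    then obtain i u v w where *: "u \<in> carrier (D i)" "v \<in> carrier (D i)" "w \<in> carrier (D i)"
        "x = f i u" "y = f i v" "z = f i w"
      using ex by blast
    interpret Di: module R "D i" by (rule D)
    show "x \<oplus>\<^bsub>Q\<^esub> y \<oplus>\<^bsub>Q\<^esub> z = x \<oplus>\<^bsub>Q\<^esub> (y \<oplus>\<^bsub>Q\<^esub> z)"
      using * by (auto simp: add clos Di.M.a_assoc)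
  next
    fix x assume "x \<in> carrier Q"
    then obtain i u where *: "u \<in> carrier (D i)" "x = f i u"
      using ex by blast
    interpret Di: module R "D i" by (rule D)
    show "\<zero>\<^bsub>Q\<^esub> \<oplus>\<^bsub>Q\<^esub> x = x" using * by (simp add: add flip: f0[of i])
    show "\<one>\<^bsub>R\<^esub> \<odot>\<^bsub>Q\<^esub> x = x" using * by (simp add: smult)
    show "\<exists>y\<in>carrier Q. y \<oplus>\<^bsub>Q\<^esub> x = \<zero>\<^bsub>Q\<^esub>"
      using * by (intro bexI[of _ "f i (\<ominus>\<^bsub>D i\<^esub> u)"]) (auto simp: add clos Di.M.l_neg f0)
  next
    fix a x assume a: "a \<in> carrier R" and "x \<in> carrier Q"
    then obtain i u where *: "u \<in> carrier (D i)" "x = f i u"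
      using ex by blast
    interpret Di: module R "D i" by (rule D)
    show "a \<odot>\<^bsub>Q\<^esub> x \<in> carrier Q" using * a by (simp add: smult clos)
  next
    fix a b x assume a: "a \<in> carrier R" "b \<in> carrier R" and "x \<in> carrier Q"
    then obtain i u where *: "u \<in> carrier (D i)" "x = f i u"
      using ex by blast
    interpret Di: module R "D i" by (rule D)
    show "(a \<oplus>\<^bsub>R\<^esub> b) \<odot>\<^bsub>Q\<^esub> x = a \<odot>\<^bsub>Q\<^esub> x \<oplus>\<^bsub>Q\<^esub> b \<odot>\<^bsub>Q\<^esub> x"
      using * a by (simp add: smult add Di.smult_l_distr)
    show "a \<otimes>\<^bsub>R\<^esub> b \<odot>\<^bsub>Q\<^esub> x = a \<odot>\<^bsub>Q\<^esub> (b \<odot>\<^bsub>Q\<^esub> x)"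
      using * a by (simp add: smult Di.smult_assoc1)
  next
    fix a x y assume a: "a \<in> carrier R" and "x \<in> carrier Q" "y \<in> carrier Q"
    then obtain i u v where *: "u \<in> carrier (D i)" "v \<in> carrier (D i)" "x = f i u" "y = f i v"
      using ex by blast
    interpret Di: module R "D i" by (rule D)
    show "a \<odot>\<^bsub>Q\<^esub> (x \<oplus>\<^bsub>Q\<^esub> y) = a \<odot>\<^bsub>Q\<^esub> x \<oplus>\<^bsub>Q\<^esub> a \<odot>\<^bsub>Q\<^esub> y"
      using * a by (simp add: smult add Di.smult_r_distr)
  qed
qed

section \<open>Cosets and quotient modules\<close>

lemma coset_eq_iff:
  assumes "module R M" "submodule N R M" "x \<in> carrier M" "y \<in> carrier M"
  shows "N +>\<^bsub>M\<^esub> x = N +>\<^bsub>M\<^esub> y \<longleftrightarrow> (\<exists>n\<in>N. x = n \<oplus>\<^bsub>M\<^esub> y)"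
proof -
  interpret M: module R M by fact
  interpret N: abelian_subgroup N M
    by (rule abelian_subgroupI3[OF _ M.abelian_group_axioms])
      (simp add: additive_subgroup_def submodule.axioms(1)[OF assms(2)])
  have "N +>\<^bsub>M\<^esub> x = N +>\<^bsub>M\<^esub> y \<longleftrightarrow> x \<in> N +>\<^bsub>M\<^esub> y"
    using N.a_repr_independence'[of x y] N.a_rcos_self[of x] assms by auto
  then show ?thesis by (auto simp: a_r_coset_def')
qed

lemma carrier_quotient_module:
  "carrier (quotient_module M N) = (\<lambda>x. N +>\<^bsub>M\<^esub> x) ` carrier M"
  by (auto simp: quotient_module_def A_RCOSETS_def')

lemma zero_quotient_module: "\<zero>\<^bsub>quotient_module M N\<^esub> = N"
  by (simp add: quotient_module_def)

lemma coset_zero: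
  assumes "module R M" "submodule N R M"
  shows "N +>\<^bsub>M\<^esub> \<zero>\<^bsub>M\<^esub> = N"
proof -
  interpret M: module R M by fact
  show ?thesis
    using submodule_subset[OF assms(2)] by (force simp: a_r_coset_def')
qed

lemma coset_eq_zero_iff:
  assumes "module R M" "submodule N R M" "x \<in> carrier M"
  shows "N +>\<^bsub>M\<^esub> x = N \<longleftrightarrow> x \<in> N"
proof -
  interpret M: module R M by fact
  have "N +>\<^bsub>M\<^esub> x = N \<longleftrightarrow> N +>\<^bsub>M\<^esub> x = N +>\<^bsub>M\<^esub> \<zero>\<^bsub>M\<^esub>"
    using coset_zero[OF assms(1,2)] by simp
  also have "\<dots> \<longleftrightarrow> x \<in> N"
    using coset_eq_iff[OF assms(1,2,3), of "\<zero>\<^bsub>M\<^esub>"] submodule_subset[OF assms(2)]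
    by (auto intro!: bexI[of _ x] simp: assms(3))
  finally show ?thesis .
qed

lemma coset_self:
  assumes "module R M" "submodule N R M" "x \<in> carrier M"
  shows "x \<in> N +>\<^bsub>M\<^esub> x"
proof -
  interpret M: module R M by fact
  show ?thesis
    using submodule_zero[OF assms(2)] assms(3) by (force simp: a_r_coset_def')
qed

text \<open>The shape shared by the scalar multiplication of a quotient module and by \<^const>\<open>Ext_map\<close>.\<close>

lemma UN_coset_induced:
  assumes M: "module R M" "submodule N R M" and M': "module R M'" "submodule N' R M'"
    and u: "\<And>x. x \<in> carrier M \<Longrightarrow> u x \<in> carrier M'"
      "\<And>x y. \<lbrakk>x \<in> N; y \<in> carrier M\<rbrakk> \<Longrightarrow> u (x \<oplus>\<^bsub>M\<^esub> y) = u x \<oplus>\<^bsub>M'\<^esub> u y"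
      "\<And>x. x \<in> N \<Longrightarrow> u x \<in> N'"
    and x: "x \<in> carrier M"
  shows "(\<Union>y\<in>N +>\<^bsub>M\<^esub> x. N' +>\<^bsub>M'\<^esub> u y) = N' +>\<^bsub>M'\<^esub> u x"
proof -
  interpret M': module R M' by fact
  have "N' +>\<^bsub>M'\<^esub> u y = N' +>\<^bsub>M'\<^esub> u x" if "y \<in> N +>\<^bsub>M\<^esub> x" for y
  proof -
    obtain n where n: "n \<in> N" "y = n \<oplus>\<^bsub>M\<^esub> x" using \<open>y \<in> _\<close> by (auto simp: a_r_coset_def')
    then have "n \<in> carrier M" using submodule_subset[OF M(2)] by auto
    then show ?thesis using n u x by (subst coset_eq_iff[OF M']) auto
  qed
  moreover have "N +>\<^bsub>M\<^esub> x \<noteq> {}" using coset_self[OF M x] by blast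
  ultimately show ?thesis by (rule SUP_eq_const[rotated])
qed

text \<open>Linearity of the projection is checked on formulas and does not presuppose that the
  quotient is a module. The projection then serves as the single chart covering the
  quotient.\<close>

lemma
  assumes M: "module R M" "submodule N R M"
  shows quotient_map_linear: "linear_map R M (quotient_module M N) (\<lambda>x. N +>\<^bsub>M\<^esub> x)"
    and quotient_module_module: "module R (quotient_module M N)"
proof -
  interpret M: module R M by fact
  interpret N: abelian_subgroup N M
    by (rule abelian_subgroupI3[OF _ M.abelian_group_axioms])
      (simp add: additive_subgroup_def submodule.axioms(1)[OF assms(2)])
  show lin: "linear_map R M (quotient_module M N) (\<lambda>x. N +>\<^bsub>M\<^esub> x)"
  proof (rule linear_mapI)
    fix a x assume ax: "a \<in> carrier R" "x \<in> carrier M"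
    have "(\<Union>y\<in>N +>\<^bsub>M\<^esub> x. N +>\<^bsub>M\<^esub> (a \<odot>\<^bsub>M\<^esub> y)) = N +>\<^bsub>M\<^esub> (a \<odot>\<^bsub>M\<^esub> x)"
      by (rule UN_coset_induced[OF M M])
        (use ax submodule_subset[OF M(2)] M.smult_r_distr submodule.smult_closed[OF M(2)] in auto)
    then show "N +>\<^bsub>M\<^esub> (a \<odot>\<^bsub>M\<^esub> x) = a \<odot>\<^bsub>quotient_module M N\<^esub> (N +>\<^bsub>M\<^esub> x)"
      by (simp add: quotient_module_def)
  next
    fix x y assume "x \<in> carrier M" "y \<in> carrier M"
    then show "N +>\<^bsub>M\<^esub> (x \<oplus>\<^bsub>M\<^esub> y) = (N +>\<^bsub>M\<^esub> x) \<oplus>\<^bsub>quotient_module M N\<^esub> (N +>\<^bsub>M\<^esub> y)"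
      by (simp add: N.a_rcos_sum quotient_module_def)
  qed (simp add: carrier_quotient_module)
  show "module R (quotient_module M N)"
    by (rule module_by_charts[where D = "\<lambda>_ :: unit. M" and f = "\<lambda>_ x. N +>\<^bsub>M\<^esub> x"])
      (use lin M coset_zero[OF M] M.R.cring_axioms
        in \<open>auto simp: carrier_quotient_module zero_quotient_module\<close>)
qed

section \<open>Modules of homomorphisms and free modules\<close>

text \<open>\<open>F\<close> is constrained on cosets only, through \<open>u\<close>. This fits
  \<open>Ext_map\<close> and \<open>truncation_map\<close>, which are defined on arbitrary sets and
  whose values on cosets are worked out separately.\<close>

lemma quotient_induced_linear:
  assumes M: "module R M" "submodule N R M" and M': "module R M'" "submodule N' R M'"
    and u: "linear_map R M M' u"
    and F: "\<And>x. x \<in> carrier M \<Longrightarrow> F (N +>\<^bsub>M\<^esub> x) = N' +>\<^bsub>M'\<^esub> u x"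
  shows "linear_map R (quotient_module M N) (quotient_module M' N') F"
proof -
  interpret M: module R M by fact
  note q = quotient_map_linear[OF M] and q' = quotient_map_linear[OF M']
  note u' = linear_map_closed[OF u]
  show ?thesis
  proof (rule linear_mapI)
    fix C assume "C \<in> carrier (quotient_module M N)"
    then show "F C \<in> carrier (quotient_module M' N')"
      using F u' by (auto simp: carrier_quotient_module)
  next
    fix C D assume "C \<in> carrier (quotient_module M N)" "D \<in> carrier (quotient_module M N)"
    then obtain x y where xy: "x \<in> carrier M" "y \<in> carrier M" "C = N +>\<^bsub>M\<^esub> x" "D = N +>\<^bsub>M\<^esub> y"
      by (auto simp: carrier_quotient_module)
    then show "F (C \<oplus>\<^bsub>quotient_module M N\<^esub> D) = F C \<oplus>\<^bsub>quotient_module M' N'\<^esub> F D"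
      by (simp add: F u' linear_map_add[OF u] flip: linear_map_add[OF q] linear_map_add[OF q'])
  next
    fix a C assume "a \<in> carrier R" "C \<in> carrier (quotient_module M N)"
    then obtain x where xy: "x \<in> carrier M" "C = N +>\<^bsub>M\<^esub> x"
      by (auto simp: carrier_quotient_module)
    then show "F (a \<odot>\<^bsub>quotient_module M N\<^esub> C) = a \<odot>\<^bsub>quotient_module M' N'\<^esub> F C"
      using \<open>a \<in> carrier R\<close>
      by (simp add: F u' linear_map_smult[OF u] flip: linear_map_smult[OF q] linear_map_smult[OF q'])
  qed
qed

lemma carrier_hom_module:
  "g \<in> carrier (hom_module R P X) \<longleftrightarrow> g \<in> extensional (carrier P) \<and> linear_map R P X g"
  by (auto simp: hom_module_def linear_map_def PiE_def)

lemma hom_module_module: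
  assumes P: "module R P" and X: "module R X"
  shows "module R (hom_module R P X)"
proof -
  interpret P: module R P by fact
  interpret X: module R X by fact
  let ?H = "hom_module R P X"
  have H_simps: "(g \<oplus>\<^bsub>?H\<^esub> h) = (\<lambda>x\<in>carrier P. g x \<oplus>\<^bsub>X\<^esub> h x)" "\<zero>\<^bsub>?H\<^esub> = (\<lambda>x\<in>carrier P. \<zero>\<^bsub>X\<^esub>)"
      "a \<odot>\<^bsub>?H\<^esub> g = (\<lambda>x\<in>carrier P. a \<odot>\<^bsub>X\<^esub> g x)" for g h a
    by (simp_all add: hom_module_def)
  have clos: "g x \<in> carrier X" if "g \<in> carrier ?H" "x \<in> carrier P" for g x
    using that by (auto simp: carrier_hom_module linear_map_closed)
  have ext: "g = h" if "g \<in> carrier ?H" "h \<in> extensional (carrier P)" "\<And>x. x \<in> carrier P \<Longrightarrow> g x = h x" for g h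
    using that by (auto simp: carrier_hom_module intro: extensionalityI)
  have add_closed: "g \<oplus>\<^bsub>?H\<^esub> h \<in> carrier ?H" if g: "g \<in> carrier ?H" and h: "h \<in> carrier ?H" for g h
    using that clos[OF g] clos[OF h]
    by (auto simp: carrier_hom_module H_simps intro!: linear_mapI)
      (auto simp: linear_map_add linear_map_smult X.smult_r_distr X.M.a_ac)
  \<comment> \<open>Commutativity of \<open>R\<close> enters here: it makes a scalar multiple of a
    linear map linear again.\<close>
  have smult_closed: "a \<odot>\<^bsub>?H\<^esub> g \<in> carrier ?H" if g: "g \<in> carrier ?H" and a: "a \<in> carrier R" for a g
    using that clos[OF g]
    by (auto simp: carrier_hom_module H_simps intro!: linear_mapI)
      (auto simp: linear_map_add linear_map_smult X.smult_r_distr P.R.m_comm simp flip: X.smult_assoc1)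
  have zero_closed: "\<zero>\<^bsub>?H\<^esub> \<in> carrier ?H"
    by (auto simp: carrier_hom_module H_simps intro!: linear_mapI)
  show ?thesis
  proof (rule moduleI[OF P.R.cring_axioms abelian_groupI])
    fix g h k assume "g \<in> carrier ?H" "h \<in> carrier ?H" "k \<in> carrier ?H"
    note c = this[THEN clos]
    show "g \<oplus>\<^bsub>?H\<^esub> h \<oplus>\<^bsub>?H\<^esub> k = g \<oplus>\<^bsub>?H\<^esub> (h \<oplus>\<^bsub>?H\<^esub> k)"
      using c by (auto simp: H_simps X.M.a_assoc)
  next
    fix g h assume "g \<in> carrier ?H" "h \<in> carrier ?H"
    note c = this[THEN clos]
    show "g \<oplus>\<^bsub>?H\<^esub> h = h \<oplus>\<^bsub>?H\<^esub> g"
      using c by (auto simp: H_simps X.M.a_comm)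
  next
    fix g assume g: "g \<in> carrier ?H"
    show "\<zero>\<^bsub>?H\<^esub> \<oplus>\<^bsub>?H\<^esub> g = g"
      by (rule ext[symmetric, OF g]) (use clos[OF g] in \<open>auto simp: H_simps\<close>)
    show "\<one>\<^bsub>R\<^esub> \<odot>\<^bsub>?H\<^esub> g = g"
      by (rule ext[symmetric, OF g]) (use clos[OF g] in \<open>auto simp: H_simps\<close>)
    show "\<exists>h\<in>carrier ?H. h \<oplus>\<^bsub>?H\<^esub> g = \<zero>\<^bsub>?H\<^esub>"
    proof (rule bexI[of _ "(\<ominus>\<^bsub>R\<^esub> \<one>\<^bsub>R\<^esub>) \<odot>\<^bsub>?H\<^esub> g"])
      show "(\<ominus>\<^bsub>R\<^esub> \<one>\<^bsub>R\<^esub>) \<odot>\<^bsub>?H\<^esub> g \<in> carrier ?H" by (rule smult_closed[OF g]) simp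
      show "(\<ominus>\<^bsub>R\<^esub> \<one>\<^bsub>R\<^esub>) \<odot>\<^bsub>?H\<^esub> g \<oplus>\<^bsub>?H\<^esub> g = \<zero>\<^bsub>?H\<^esub>"
        using clos[OF g] by (auto simp: H_simps X.smult_l_minus X.M.l_neg)
    qed
  next
    fix a b g assume ab: "a \<in> carrier R" "b \<in> carrier R" and g: "g \<in> carrier ?H"
    show "(a \<oplus>\<^bsub>R\<^esub> b) \<odot>\<^bsub>?H\<^esub> g = a \<odot>\<^bsub>?H\<^esub> g \<oplus>\<^bsub>?H\<^esub> b \<odot>\<^bsub>?H\<^esub> g"
      using clos[OF g] ab by (auto simp: H_simps X.smult_l_distr)
    show "a \<otimes>\<^bsub>R\<^esub> b \<odot>\<^bsub>?H\<^esub> g = a \<odot>\<^bsub>?H\<^esub> (b \<odot>\<^bsub>?H\<^esub> g)"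
      using clos[OF g] ab by (auto simp: H_simps X.smult_assoc1)
  next
    fix a g h assume a: "a \<in> carrier R" and g: "g \<in> carrier ?H" "h \<in> carrier ?H"
    show "a \<odot>\<^bsub>?H\<^esub> (g \<oplus>\<^bsub>?H\<^esub> h) = a \<odot>\<^bsub>?H\<^esub> g \<oplus>\<^bsub>?H\<^esub> a \<odot>\<^bsub>?H\<^esub> h"
      using g[THEN clos] a by (auto simp: H_simps X.smult_r_distr)
  qed (use add_closed zero_closed smult_closed in auto)
qed

lemma hom_pullback_linear:
  assumes "module R P" "module R P'" and u: "linear_map R P' P u"
  shows "linear_map R (hom_module R P X) (hom_module R P' X) (\<lambda>g. \<lambda>f\<in>carrier P'. g (u f))"
proof -
  interpret P': module R P' by fact
  note u' = linear_map_closed[OF u]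
  show ?thesis
  proof (rule linear_mapI)
    fix g assume "g \<in> carrier (hom_module R P X)"
    then have "linear_map R P X g" by (simp add: carrier_hom_module)
    then have lin: "linear_map R P' X (\<lambda>f. g (u f))"
      by (rule linear_map_comp[OF u])
    have "linear_map R P' X (\<lambda>f\<in>carrier P'. g (u f))"
      by (rule linear_mapI)
        (use lin in \<open>auto simp: linear_map_closed[OF lin] linear_map_add[OF lin] linear_map_smult[OF lin]\<close>)
    then show "(\<lambda>f\<in>carrier P'. g (u f)) \<in> carrier (hom_module R P' X)"
      by (simp add: carrier_hom_module)
  qed (auto simp: hom_module_def u' intro!: restrict_ext)
qed

section \<open>Free modules and linear maps out of them\<close>

lemma self_module_module:
  assumes "cring R" shows "module R (self_module R)"
proof -
  interpret cring R by fact
  show ?thesis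
    by (rule moduleI[OF assms abelian_groupI])
      (auto simp: self_module_def a_ac l_distr r_distr m_assoc
        intro: bexI[of _ "\<ominus>\<^bsub>R\<^esub> x" for x] l_neg)
qed

text \<open>A finite sum reads only the carrier, the addition and the zero, which both records
  share; so lemmas on modules apply to sums of ring elements.\<close>

lemma self_module_simps:
  "carrier (self_module R) = carrier R" "add (self_module R) = add R"
  "\<zero>\<^bsub>self_module R\<^esub> = \<zero>\<^bsub>R\<^esub>" "smult (self_module R) = monoid.mult R"
  "finsum (self_module R) = finsum R"
  by (simp_all add: self_module_def finsum_def finprod_def fun_eq_iff)

lemma carrier_free_module:
  "f \<in> carrier (free_module R S) \<longleftrightarrow>
    (\<forall>b. f b \<in> carrier R) \<and> {b. f b \<noteq> \<zero>\<^bsub>R\<^esub>} \<subseteq> S \<and> finite {b. f b \<noteq> \<zero>\<^bsub>R\<^esub>}"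
  by (simp add: free_module_def)

lemma free_module_simps:
  "\<zero>\<^bsub>free_module R S\<^esub> = (\<lambda>b. \<zero>\<^bsub>R\<^esub>)"
  "f \<oplus>\<^bsub>free_module R S\<^esub> g = (\<lambda>b. f b \<oplus>\<^bsub>R\<^esub> g b)"
  "a \<odot>\<^bsub>free_module R S\<^esub> f = (\<lambda>b. a \<otimes>\<^bsub>R\<^esub> f b)"
  by (simp_all add: free_module_def)

lemma free_module_module:
  assumes "cring R" shows "module R (free_module R S)"
proof -
  interpret cring R by fact
  let ?F = "free_module R S"
  have cl: "f b \<in> carrier R" if "f \<in> carrier ?F" for f b
    using that by (simp add: carrier_free_module)
  have add_closed: "f \<oplus>\<^bsub>?F\<^esub> g \<in> carrier ?F" if fg: "f \<in> carrier ?F" "g \<in> carrier ?F" for f g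
  proof -
    have "{b. f b \<oplus>\<^bsub>R\<^esub> g b \<noteq> \<zero>\<^bsub>R\<^esub>} \<subseteq> {b. f b \<noteq> \<zero>\<^bsub>R\<^esub>} \<union> {b. g b \<noteq> \<zero>\<^bsub>R\<^esub>}" by auto
    then show ?thesis using fg
      by (auto simp: carrier_free_module free_module_simps elim: finite_subset)
  qed
  have smult_closed: "a \<odot>\<^bsub>?F\<^esub> f \<in> carrier ?F" if f: "f \<in> carrier ?F" "a \<in> carrier R" for a f
  proof -
    have "{b. a \<otimes>\<^bsub>R\<^esub> f b \<noteq> \<zero>\<^bsub>R\<^esub>} \<subseteq> {b. f b \<noteq> \<zero>\<^bsub>R\<^esub>}" using f(2) by auto
    then show ?thesis using f
      by (auto simp: carrier_free_module free_module_simps elim: finite_subset)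
  qed
  show ?thesis
  proof (rule moduleI[OF assms abelian_groupI])
    fix f assume f: "f \<in> carrier ?F"
    show "\<exists>g\<in>carrier ?F. g \<oplus>\<^bsub>?F\<^esub> f = \<zero>\<^bsub>?F\<^esub>"
      using smult_closed[OF f, of "\<ominus>\<^bsub>R\<^esub> \<one>\<^bsub>R\<^esub>"] cl[OF f]
      by (intro bexI[of _ "(\<ominus>\<^bsub>R\<^esub> \<one>\<^bsub>R\<^esub>) \<odot>\<^bsub>?F\<^esub> f"]) (auto simp: free_module_simps l_minus l_neg)
  qed (use add_closed smult_closed in
      \<open>auto simp: free_module_simps cl a_ac l_distr r_distr m_assoc\<close>,
      simp add: carrier_free_module)
qed

definition basis_vec :: "('a, 'c) ring_scheme \<Rightarrow> 's \<Rightarrow> 's \<Rightarrow> 'a"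
  where "basis_vec R b = (\<lambda>c. if c = b then \<one>\<^bsub>R\<^esub> else \<zero>\<^bsub>R\<^esub>)"

lemma basis_vec_closed:
  assumes "cring R" "b \<in> S" shows "basis_vec R b \<in> carrier (free_module R S)"
proof -
  interpret cring R by fact
  show ?thesis
    using assms(2) by (auto simp: carrier_free_module basis_vec_def intro!: finite_subset[of _ "{b}"])
qed

text \<open>The support is emptied one coordinate at a time. The set \<open>T\<close> of the
  induction may contain points outside \<open>S\<close>; there \<open>f\<close> vanishes and the
  point is dropped.\<close>

lemma free_module_induct [consumes 2, case_names zero add]:
  assumes "cring R" and f: "f \<in> carrier (free_module R S)"
    and zero: "P (\<lambda>b. \<zero>\<^bsub>R\<^esub>)"
    and add: "\<And>a b g. \<lbrakk>a \<in> carrier R; b \<in> S; g \<in> carrier (free_module R S); P g\<rbrakk> \<Longrightarrow>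
      P ((a \<odot>\<^bsub>free_module R S\<^esub> basis_vec R b) \<oplus>\<^bsub>free_module R S\<^esub> g)"
  shows "P f"
proof -
  interpret cring R by fact
  have "P f" if "finite T" "f \<in> carrier (free_module R S)" "{b. f b \<noteq> \<zero>\<^bsub>R\<^esub>} \<subseteq> T" for T f
    using that
  proof (induction T arbitrary: f rule: finite_induct)
    case empty
    then have "f = (\<lambda>b. \<zero>\<^bsub>R\<^esub>)" by auto
    then show ?case using zero by simp
  next
    case (insert b T)
    show ?case
    proof (cases "b \<in> S")
      case False
      then have "{b. f b \<noteq> \<zero>\<^bsub>R\<^esub>} \<subseteq> T"
        using insert.prems by (auto simp: carrier_free_module)
      then show ?thesis using insert by blast
    next
      case True
      define g where "g = f(b := \<zero>\<^bsub>R\<^esub>)"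
      have sub: "{c. g c \<noteq> \<zero>\<^bsub>R\<^esub>} \<subseteq> {c. f c \<noteq> \<zero>\<^bsub>R\<^esub>}" by (auto simp: g_def)
      have g: "g \<in> carrier (free_module R S)" "{c. g c \<noteq> \<zero>\<^bsub>R\<^esub>} \<subseteq> T"
        using insert.prems sub finite_subset[OF sub]
        by (auto simp: carrier_free_module g_def split: if_splits)
      have "f = (f b \<odot>\<^bsub>free_module R S\<^esub> basis_vec R b) \<oplus>\<^bsub>free_module R S\<^esub> g"
        using insert.prems by (auto simp: free_module_simps basis_vec_def g_def carrier_free_module)
      moreover have "f b \<in> carrier R" using insert.prems by (simp add: carrier_free_module)
      ultimately show ?thesis using add[OF _ True g(1) insert.IH[OF g]] by metis
    qed
  qed
  from this[OF _ f order_refl] show ?thesis using f by (simp add: carrier_free_module)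
qed

text \<open>Every identity of the resolution below, from d d = 0 to the commuting squares, is
  reduced by this to basis elements, where both sides can be computed.\<close>

lemma free_module_maps_eq:
  assumes "cring R" "module R X"
    and u: "linear_map R (free_module R S) X u" and v: "linear_map R (free_module R S) X v"
    and eq: "\<And>b. b \<in> S \<Longrightarrow> u (basis_vec R b) = v (basis_vec R b)"
    and f: "f \<in> carrier (free_module R S)"
  shows "u f = v f"
  using assms(1) f
proof (induction rule: free_module_induct)
  case zero
  show ?case
    using linear_map_zero[OF free_module_module[OF assms(1)] assms(2) u]
      linear_map_zero[OF free_module_module[OF assms(1)] assms(2) v]
    by (simp add: free_module_simps)
next
  case (add a b g)
  interpret F: module R "free_module R S" by (rule free_module_module) fact
  note e = basis_vec_closed[OF assms(1) add(2)]
  note simps = linear_map_add[OF _ F.smult_closed[OF add(1) e] add(3)] linear_map_smult[OF _ add(1) e]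
  show ?case
    by (simp add: simps[OF u] simps[OF v] add eq)
qed

lemma zero_map_linear:
  assumes "module R N" shows "linear_map R M N (\<lambda>x. \<zero>\<^bsub>N\<^esub>)"
proof -
  interpret N: module R N by fact
  show ?thesis by (rule linear_mapI) auto
qed

text \<open>The universal property of a free module. With \<open>ungen\<close> for
  \<open>\<phi>\<close> it is \<open>augmentation\<close>; with values in \<open>R\<close> itself it
  gives each coordinate of \<open>differential\<close> and of \<open>push_forward\<close>.\<close>

definition linear_extension ::
    "('a, 'c) ring_scheme \<Rightarrow> ('a, 'b, 'd) module_scheme \<Rightarrow> ('s \<Rightarrow> 'b) \<Rightarrow> ('s \<Rightarrow> 'a) \<Rightarrow> 'b"
  where "linear_extension R X \<phi> f = (\<Oplus>\<^bsub>X\<^esub>b\<in>{b. f b \<noteq> \<zero>\<^bsub>R\<^esub>}. f b \<odot>\<^bsub>X\<^esub> \<phi> b)"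

text \<open>The defining sum runs over the support of \<open>f\<close>, which varies with
  \<open>f\<close>. A common finite index set makes the sums for different functions
  comparable.\<close>

lemma linear_extension_eq:
  assumes "module R X" "\<phi> \<in> S \<rightarrow> carrier X" "f \<in> carrier (free_module R S)"
    and T: "finite T" "T \<subseteq> S" "{b. f b \<noteq> \<zero>\<^bsub>R\<^esub>} \<subseteq> T"
  shows "linear_extension R X \<phi> f = (\<Oplus>\<^bsub>X\<^esub>b\<in>T. f b \<odot>\<^bsub>X\<^esub> \<phi> b)"
proof -
  interpret X: module R X by fact
  show ?thesis unfolding linear_extension_def
    by (rule X.M.add.finprod_mono_neutral_cong_left)
      (use assms in \<open>auto simp: carrier_free_module Pi_iff subset_iff\<close>)
qed

lemma linear_extension_linear:
  assumes "module R X" and \<phi>: "\<phi> \<in> S \<rightarrow> carrier X"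
  shows "linear_map R (free_module R S) X (linear_extension R X \<phi>)"
proof -
  interpret X: module R X by fact
  interpret F: module R "free_module R S" by (rule free_module_module[OF X.R.cring_axioms])
  note eq = linear_extension_eq[OF assms]
  have cl: "f b \<odot>\<^bsub>X\<^esub> \<phi> b \<in> carrier X" if "f \<in> carrier (free_module R S)" "b \<in> S" for f b
    using that \<phi> by (auto simp: carrier_free_module)
  show ?thesis
  proof (rule linear_mapI)
    fix f assume "f \<in> carrier (free_module R S)"
    then show "linear_extension R X \<phi> f \<in> carrier X"
      using cl by (auto simp: linear_extension_def carrier_free_module intro!: X.M.finsum_closed)
  next
    fix f g assume fg: "f \<in> carrier (free_module R S)" "g \<in> carrier (free_module R S)"
    define T where "T = {b. f b \<noteq> \<zero>\<^bsub>R\<^esub>} \<union> {b. g b \<noteq> \<zero>\<^bsub>R\<^esub>}"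
    have T: "finite T" "T \<subseteq> S" "{b. f b \<noteq> \<zero>\<^bsub>R\<^esub>} \<subseteq> T" "{b. g b \<noteq> \<zero>\<^bsub>R\<^esub>} \<subseteq> T"
        "{b. (f \<oplus>\<^bsub>free_module R S\<^esub> g) b \<noteq> \<zero>\<^bsub>R\<^esub>} \<subseteq> T"
      using fg by (auto simp: carrier_free_module T_def free_module_simps)
    have "(\<Oplus>\<^bsub>X\<^esub>b\<in>T. (f \<oplus>\<^bsub>free_module R S\<^esub> g) b \<odot>\<^bsub>X\<^esub> \<phi> b) =
        (\<Oplus>\<^bsub>X\<^esub>b\<in>T. f b \<odot>\<^bsub>X\<^esub> \<phi> b \<oplus>\<^bsub>X\<^esub> g b \<odot>\<^bsub>X\<^esub> \<phi> b)"
      by (rule X.M.finsum_cong')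
        (use fg \<phi> T cl in \<open>auto simp: carrier_free_module free_module_simps X.smult_l_distr Pi_iff subset_iff\<close>)
    also have "\<dots> = (\<Oplus>\<^bsub>X\<^esub>b\<in>T. f b \<odot>\<^bsub>X\<^esub> \<phi> b) \<oplus>\<^bsub>X\<^esub> (\<Oplus>\<^bsub>X\<^esub>b\<in>T. g b \<odot>\<^bsub>X\<^esub> \<phi> b)"
      by (rule X.M.finsum_addf) (use cl fg T in auto)
    finally show "linear_extension R X \<phi> (f \<oplus>\<^bsub>free_module R S\<^esub> g) =
        linear_extension R X \<phi> f \<oplus>\<^bsub>X\<^esub> linear_extension R X \<phi> g"
      using fg T by (simp add: eq[of _ T])
  next
    fix a f assume a: "a \<in> carrier R" and f: "f \<in> carrier (free_module R S)"
    define T where "T = {b. f b \<noteq> \<zero>\<^bsub>R\<^esub>}"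
    have T: "finite T" "T \<subseteq> S" "{b. f b \<noteq> \<zero>\<^bsub>R\<^esub>} \<subseteq> T"
        "{b. (a \<odot>\<^bsub>free_module R S\<^esub> f) b \<noteq> \<zero>\<^bsub>R\<^esub>} \<subseteq> T"
      using f a by (auto simp: carrier_free_module T_def free_module_simps)
    have "(\<Oplus>\<^bsub>X\<^esub>b\<in>T. (a \<odot>\<^bsub>free_module R S\<^esub> f) b \<odot>\<^bsub>X\<^esub> \<phi> b) =
        (\<Oplus>\<^bsub>X\<^esub>b\<in>T. a \<odot>\<^bsub>X\<^esub> (f b \<odot>\<^bsub>X\<^esub> \<phi> b))"
      by (rule X.M.finsum_cong')
        (use f a \<phi> T cl in \<open>auto simp: carrier_free_module free_module_simps X.smult_assoc1 Pi_iff subset_iff\<close>)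
    also have "\<dots> = a \<odot>\<^bsub>X\<^esub> (\<Oplus>\<^bsub>X\<^esub>b\<in>T. f b \<odot>\<^bsub>X\<^esub> \<phi> b)"
      by (rule X.finsum_smult_ldistr[symmetric]) (use cl f T a in auto)
    finally show "linear_extension R X \<phi> (a \<odot>\<^bsub>free_module R S\<^esub> f) = a \<odot>\<^bsub>X\<^esub> linear_extension R X \<phi> f"
      using f a T by (simp add: eq[of _ T])
  qed
qed

lemma linear_extension_basis:
  assumes "module R X" and \<phi>: "\<phi> \<in> S \<rightarrow> carrier X" and b: "b \<in> S"
  shows "linear_extension R X \<phi> (basis_vec R b) = \<phi> b"
proof -
  interpret X: module R X by fact
  have "linear_extension R X \<phi> (basis_vec R b) = (\<Oplus>\<^bsub>X\<^esub>c\<in>{b}. basis_vec R b c \<odot>\<^bsub>X\<^esub> \<phi> c)"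
    by (rule linear_extension_eq[OF assms(1,2) basis_vec_closed[OF X.R.cring_axioms b]])
      (use b in \<open>auto simp: basis_vec_def\<close>)
  moreover have "\<phi> b \<in> carrier X" using \<phi> b by auto
  ultimately show ?thesis by (simp add: basis_vec_def)
qed

text \<open>Think of \<open>\<psi> c b\<close> as a matrix entry in row \<open>c\<close> and column
  \<open>b\<close>, and of \<open>G\<close> as multiplication by the matrix. Each coordinate is a
  linear extension, and finiteness of the columns keeps the values finitely supported. The form is
  coordinatewise because \<open>differential\<close> and \<open>push_forward\<close> are defined
  pointwise, as sums in \<open>R\<close>.\<close>

lemma
  assumes "cring R"
    and \<psi>: "\<And>b c. b \<in> S \<Longrightarrow> \<psi> c b \<in> carrier R"
    and fin: "\<And>b. b \<in> S \<Longrightarrow> finite {c. \<psi> c b \<noteq> \<zero>\<^bsub>R\<^esub>}" "\<And>b. b \<in> S \<Longrightarrow> {c. \<psi> c b \<noteq> \<zero>\<^bsub>R\<^esub>} \<subseteq> T"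
    and G: "\<And>f c. f \<in> carrier (free_module R S) \<Longrightarrow> G f c = linear_extension R (self_module R) (\<psi> c) f"
  shows free_module_coordinatewise_linear: "linear_map R (free_module R S) (free_module R T) G"
    and free_module_coordinatewise_basis: "b \<in> S \<Longrightarrow> G (basis_vec R b) = (\<lambda>c. \<psi> c b)"
proof -
  interpret cring R by fact
  interpret F: module R "free_module R S" by (rule free_module_module) fact
  note lin = linear_extension_linear[OF self_module_module[OF assms(1)], of "\<psi> c" S for c]
  have \<psi>': "\<psi> c \<in> S \<rightarrow> carrier (self_module R)" for c
    using \<psi> by (auto simp: self_module_simps)
  show "linear_map R (free_module R S) (free_module R T) G"
  proof (rule linear_mapI)
    fix f assume f: "f \<in> carrier (free_module R S)"
    have G0: "G f c = \<zero>\<^bsub>R\<^esub>" if "\<And>b. f b \<noteq> \<zero>\<^bsub>R\<^esub> \<Longrightarrow> \<psi> c b = \<zero>\<^bsub>R\<^esub>" for c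
    proof -
      have "G f c = (\<Oplus>\<^bsub>R\<^esub>b\<in>{b. f b \<noteq> \<zero>\<^bsub>R\<^esub>}. \<zero>\<^bsub>R\<^esub>)"
        unfolding G[OF f] linear_extension_def self_module_simps
        by (rule finsum_cong') (use that f in \<open>auto simp: carrier_free_module\<close>)
      then show ?thesis by simp
    qed
    have sub: "{c. G f c \<noteq> \<zero>\<^bsub>R\<^esub>} \<subseteq> (\<Union>b\<in>{b. f b \<noteq> \<zero>\<^bsub>R\<^esub>}. {c. \<psi> c b \<noteq> \<zero>\<^bsub>R\<^esub>})"
      using G0 by auto
    have fS: "{b. f b \<noteq> \<zero>\<^bsub>R\<^esub>} \<subseteq> S" "finite {b. f b \<noteq> \<zero>\<^bsub>R\<^esub>}" using f by (auto simp: carrier_free_module)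
    have "finite (\<Union>b\<in>{b. f b \<noteq> \<zero>\<^bsub>R\<^esub>}. {c. \<psi> c b \<noteq> \<zero>\<^bsub>R\<^esub>})" using fS fin(1) by auto
    with sub have "finite {c. G f c \<noteq> \<zero>\<^bsub>R\<^esub>}" by (rule finite_subset)
    moreover have "{c. G f c \<noteq> \<zero>\<^bsub>R\<^esub>} \<subseteq> T" using sub fin(2) fS by fast
    moreover have "G f c \<in> carrier R" for c
      using linear_map_closed[OF lin[OF \<psi>'] f] G[OF f] by (simp add: self_module_simps)
    ultimately show "G f \<in> carrier (free_module R T)" by (simp add: carrier_free_module)
  next
    fix f g assume fg: "f \<in> carrier (free_module R S)" "g \<in> carrier (free_module R S)"
    show "G (f \<oplus>\<^bsub>free_module R S\<^esub> g) = G f \<oplus>\<^bsub>free_module R T\<^esub> G g"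
      using fg linear_map_add[OF lin[OF \<psi>'] fg]
      by (simp add: fun_eq_iff G free_module_simps(2)[of R T] self_module_simps)
  next
    fix a f assume af: "a \<in> carrier R" "f \<in> carrier (free_module R S)"
    show "G (a \<odot>\<^bsub>free_module R S\<^esub> f) = a \<odot>\<^bsub>free_module R T\<^esub> G f"
      using af linear_map_smult[OF lin[OF \<psi>'] af]
      by (simp add: fun_eq_iff G free_module_simps(3)[of R T] self_module_simps)
  qed
  show "G (basis_vec R b) = (\<lambda>c. \<psi> c b)" if "b \<in> S"
    using linear_extension_basis[OF self_module_module[OF assms(1)] \<psi>' that]
      basis_vec_closed[OF assms(1) that] by (simp add: fun_eq_iff G)
qed

section \<open>The standard resolution\<close>

text \<open>\<open>Abs_fset\<close> is specified on finite sets only; on functions with finite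
  support this makes the coding injective.\<close>

lemma syz_decode_code:
  assumes "finite {b. f b \<noteq> \<zero>\<^bsub>R\<^esub>}"
  shows "syz_decode R (syz_code R f) = f"
proof
  fix c
  have eq: "{(b, f b) | b. f b \<noteq> \<zero>\<^bsub>R\<^esub>} = (\<lambda>b. (b, f b)) ` {b. f b \<noteq> \<zero>\<^bsub>R\<^esub>}" by auto
  have "finite {(b, f b) | b. f b \<noteq> \<zero>\<^bsub>R\<^esub>}" unfolding eq using assms by simp
  then have mem: "(c, r) |\<in>| Abs_fset {(b, f b) | b. f b \<noteq> \<zero>\<^bsub>R\<^esub>} \<longleftrightarrow> r = f c \<and> f c \<noteq> \<zero>\<^bsub>R\<^esub>" for r
    by (auto simp: Abs_fset_inverse)
  show "syz_decode R (syz_code R f) c = f c"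
    by (simp add: syz_code_def syz_decode_def mem)
qed

text \<open>The cycles in degree \<open>k\<close>. Naming them separates the cycle condition from
  the coding, which \<open>res_basis\<close> combines in one formula.\<close>

definition res_kernel ::
    "('a, 'c) ring_scheme \<Rightarrow> ('a, 'm, 'd) module_scheme \<Rightarrow> nat \<Rightarrow> (('a, 'm) syz \<Rightarrow> 'a) set"
  where "res_kernel R M k = {f \<in> carrier (res_module R M k).
    if k = 0 then augmentation R M f = \<zero>\<^bsub>M\<^esub> else differential R f = (\<lambda>c. \<zero>\<^bsub>R\<^esub>)}"

lemma res_basis_Suc: "res_basis R M (Suc k) = syz_code R ` res_kernel R M k"
  by (simp add: res_kernel_def res_module_def)

declare res_basis.simps(2) [simp del]

lemma res_kernel_finite: "f \<in> res_kernel R M k \<Longrightarrow> finite {b. f b \<noteq> \<zero>\<^bsub>R\<^esub>}"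
  by (auto simp: res_kernel_def res_module_def carrier_free_module)

lemma res_module_module: "cring R \<Longrightarrow> module R (res_module R M k)"
  unfolding res_module_def by (rule free_module_module)

lemma res_basis_decode:
  assumes "b \<in> res_basis R M (Suc k)"
  shows "syz_decode R b \<in> res_kernel R M k"
  using assms unfolding res_basis_Suc by (auto simp: syz_decode_code[OF res_kernel_finite])

text \<open>The columns of the matrix of the differential are the decoded basis elements. They lie
  in the free module of degree \<open>k\<close>, hence have finite support in its basis.\<close>

lemma
  assumes "cring R"
  shows differential_linear:
      "linear_map R (res_module R M (Suc k)) (res_module R M k) (differential R)"
    and differential_basis:
      "b \<in> res_basis R M (Suc k) \<Longrightarrow> differential R (basis_vec R b) = syz_decode R b"
proof -
  have mem: "syz_decode R b \<in> carrier (free_module R (res_basis R M k))"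
    if "b \<in> res_basis R M (Suc k)" for b
    using res_basis_decode[OF that] by (simp add: res_kernel_def res_module_def)
  have diff: "differential R f c = linear_extension R (self_module R) (\<lambda>b. syz_decode R b c) f" for f c
    by (simp add: differential_def linear_extension_def self_module_simps)
  show "linear_map R (res_module R M (Suc k)) (res_module R M k) (differential R)"
    unfolding res_module_def
    by (rule free_module_coordinatewise_linear[OF assms, where \<psi> = "\<lambda>c b. syz_decode R b c"])
      (use mem in \<open>auto simp: diff carrier_free_module\<close>)
  show "differential R (basis_vec R b) = syz_decode R b" if b: "b \<in> res_basis R M (Suc k)"
    by (subst free_module_coordinatewise_basis[OF assms, where \<psi> = "\<lambda>c b. syz_decode R b c"
          and S = "res_basis R M (Suc k)" and T = "res_basis R M k"])
      (use mem b in \<open>auto simp: diff carrier_free_module\<close>)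
qed

text \<open>On a basis vector the inner differential returns the coded element, which is a cycle by
  the choice of the basis. In the lowest degree the same reason gives
  \<open>augmentation_differential\<close>.\<close>

lemma differential_differential:
  assumes "cring R" and f: "f \<in> carrier (res_module R M (Suc (Suc k)))"
  shows "differential R (differential R f) = (\<lambda>c. \<zero>\<^bsub>R\<^esub>)"
proof -
  note lin = linear_map_comp[OF differential_linear differential_linear, OF assms(1) assms(1)]
  have "differential R (differential R f) = \<zero>\<^bsub>res_module R M k\<^esub>"
  proof (rule free_module_maps_eq[where u = "\<lambda>f. differential R (differential R f)"])
    show "linear_map R (free_module R (res_basis R M (Suc (Suc k)))) (res_module R M k)
        (\<lambda>f. differential R (differential R f))"
      using lin[of M k] by (simp only: res_module_def)
    show "f \<in> carrier (free_module R (res_basis R M (Suc (Suc k))))"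
      using f by (simp only: res_module_def)
    show "differential R (differential R (basis_vec R b)) = \<zero>\<^bsub>res_module R M k\<^esub>"
      if "b \<in> res_basis R M (Suc (Suc k))" for b
      unfolding differential_basis[OF assms(1) that]
      using res_basis_decode[OF that] by (simp add: res_kernel_def res_module_def free_module_simps)
  qed (rule assms res_module_module[OF assms(1)] zero_map_linear[OF res_module_module[OF assms(1)]])+
  then show ?thesis by (simp add: res_module_def free_module_simps)
qed

lemma
  assumes "module R M"
  shows augmentation_linear: "linear_map R (res_module R M 0) M (augmentation R M)"
    and augmentation_basis: "x \<in> carrier M \<Longrightarrow> augmentation R M (basis_vec R (Gen x)) = x"
proof -
  have aug: "augmentation R M = linear_extension R M ungen"
    by (simp add: augmentation_def linear_extension_def fun_eq_iff)
  have ungen: "ungen \<in> res_basis R M 0 \<rightarrow> carrier M" by auto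
  show "linear_map R (res_module R M 0) M (augmentation R M)"
    unfolding res_module_def aug by (rule linear_extension_linear[OF assms ungen])
  show "augmentation R M (basis_vec R (Gen x)) = x" if "x \<in> carrier M"
    unfolding aug using linear_extension_basis[OF assms ungen, of "Gen x"] that by simp
qed

lemma augmentation_differential:
  assumes "module R M" and f: "f \<in> carrier (res_module R M (Suc 0))"
  shows "augmentation R M (differential R f) = \<zero>\<^bsub>M\<^esub>"
proof -
  interpret M: module R M by fact
  note R = M.R.cring_axioms
  show ?thesis
  proof (rule free_module_maps_eq[where u = "\<lambda>f. augmentation R M (differential R f)", OF R assms(1) _ zero_map_linear])
    show "linear_map R (free_module R (res_basis R M (Suc 0))) M (\<lambda>f. augmentation R M (differential R f))"
      using linear_map_comp[OF differential_linear[OF R, of M 0] augmentation_linear[OF assms(1)]]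
      by (simp only: res_module_def)
    show "f \<in> carrier (free_module R (res_basis R M (Suc 0)))" using f by (simp only: res_module_def)
    show "augmentation R M (differential R (basis_vec R b)) = \<zero>\<^bsub>M\<^esub>"
      if "b \<in> res_basis R M (Suc 0)" for b
      unfolding differential_basis[OF R that] using res_basis_decode[OF that] by (simp add: res_kernel_def)
  qed (rule assms)
qed

text \<open>The matrix has a single 1 in each column, in row \<open>\<beta> b\<close>; the sum over
  a fibre in \<open>push_forward\<close> is the product with that matrix, some zero terms
  dropped.\<close>

lemma
  assumes "cring R" and \<beta>: "\<beta> \<in> S \<rightarrow> T"
  shows push_forward_linear: "linear_map R (free_module R S) (free_module R T) (push_forward R \<beta>)"
    and push_forward_basis: "b \<in> S \<Longrightarrow> push_forward R \<beta> (basis_vec R b) = basis_vec R (\<beta> b)"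
proof -
  interpret cring R by fact
  define \<psi> where "\<psi> = (\<lambda>c b. if \<beta> b = c then \<one>\<^bsub>R\<^esub> else \<zero>\<^bsub>R\<^esub>)"
  have push: "push_forward R \<beta> f c = linear_extension R (self_module R) (\<psi> c) f"
    if "f \<in> carrier (free_module R S)" for f c
    unfolding push_forward_def linear_extension_def self_module_simps
    by (rule add.finprod_mono_neutral_cong_left)
      (use that in \<open>auto simp: carrier_free_module \<psi>_def\<close>)
  show "linear_map R (free_module R S) (free_module R T) (push_forward R \<beta>)"
    by (rule free_module_coordinatewise_linear[OF assms(1), where \<psi> = \<psi>])
      (use \<beta> push in \<open>auto simp: \<psi>_def split: if_splits\<close>)
  show "push_forward R \<beta> (basis_vec R b) = basis_vec R (\<beta> b)" if "b \<in> S"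
    by (subst free_module_coordinatewise_basis[OF assms(1), where \<psi> = \<psi> and S = S and T = T])
      (use \<beta> push that in \<open>auto simp: \<psi>_def basis_vec_def fun_eq_iff split: if_splits\<close>)
qed

text \<open>Each square of the chain map is checked on the basis; the square in one degree is what makes
  the basis map of the next degree well defined.\<close>

lemma
  assumes M: "module R M" and M': "module R M'" and \<phi>: "linear_map R M M' \<phi>"
  shows res_basis_map_closed: "res_basis_map R \<phi> k \<in> res_basis R M k \<rightarrow> res_basis R M' k"
    and differential_res_map: "f \<in> carrier (res_module R M (Suc k)) \<Longrightarrow>
      differential R (res_map R \<phi> (Suc k) f) = res_map R \<phi> k (differential R f)"
proof -
  interpret M: module R M by fact
  note R = M.R.cring_axioms
  have zero: "res_basis_map R \<phi> 0 \<in> res_basis R M 0 \<rightarrow> res_basis R M' 0"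
    using linear_map_closed[OF \<phi>] by auto
  \<comment> \<open>This square has the augmentations in place of the differentials; it carries
    cycles of degree 0 to cycles and so starts the induction.\<close>
  have aug: "augmentation R M' (res_map R \<phi> 0 f) = \<phi> (augmentation R M f)"
    if "f \<in> carrier (res_module R M 0)" for f
  proof (rule free_module_maps_eq[where u = "\<lambda>f. augmentation R M' (res_map R \<phi> 0 f)"
        and v = "\<lambda>f. \<phi> (augmentation R M f)", OF R M'])
    have "linear_map R (res_module R M 0) (res_module R M' 0) (res_map R \<phi> 0)"
      unfolding res_map_def res_module_def by (rule push_forward_linear[OF R zero])
    from linear_map_comp[OF this augmentation_linear[OF M']]
    show "linear_map R (free_module R (res_basis R M 0)) M' (\<lambda>f. augmentation R M' (res_map R \<phi> 0 f))"
      by (simp only: res_module_def)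
    show "linear_map R (free_module R (res_basis R M 0)) M' (\<lambda>f. \<phi> (augmentation R M f))"
      using linear_map_comp[OF augmentation_linear[OF M] \<phi>] by (simp only: res_module_def)
    show "f \<in> carrier (free_module R (res_basis R M 0))" using that by (simp only: res_module_def)
    fix b assume b: "b \<in> res_basis R M 0"
    then obtain x where x: "b = Gen x" "x \<in> carrier M" by auto
    show "augmentation R M' (res_map R \<phi> 0 (basis_vec R b)) = \<phi> (augmentation R M (basis_vec R b))"
      using x push_forward_basis[OF R zero b] linear_map_closed[OF \<phi> x(2)]
      by (simp add: res_map_def augmentation_basis[OF M] augmentation_basis[OF M'])
  qed
  \<comment> \<open>The square between degrees \<open>k + 1\<close> and \<open>k\<close> carries
    cycles of degree \<open>k + 1\<close> to cycles, which is what closure of the basis in degree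
    \<open>k + 2\<close> requires; so closure and squares share one induction.\<close>
  have "res_basis_map R \<phi> k \<in> res_basis R M k \<rightarrow> res_basis R M' k \<and>
    res_basis_map R \<phi> (Suc k) \<in> res_basis R M (Suc k) \<rightarrow> res_basis R M' (Suc k) \<and>
    (\<forall>f\<in>carrier (res_module R M (Suc k)).
      differential R (res_map R \<phi> (Suc k) f) = res_map R \<phi> k (differential R f))" for k
  proof (induction k)
    have step: "res_basis_map R \<phi> (Suc k) \<in> res_basis R M (Suc k) \<rightarrow> res_basis R M' (Suc k) \<and>
        (\<forall>f\<in>carrier (res_module R M (Suc k)).
          differential R (res_map R \<phi> (Suc k) f) = res_map R \<phi> k (differential R f))"
      if \<beta>: "res_basis_map R \<phi> k \<in> res_basis R M k \<rightarrow> res_basis R M' k"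
        and ker: "\<And>f. f \<in> res_kernel R M k \<Longrightarrow> res_map R \<phi> k f \<in> res_kernel R M' k" for k
    proof (intro conjI ballI)
      have code: "res_basis_map R \<phi> (Suc k) b = syz_code R (res_map R \<phi> k (syz_decode R b))" for b
        by (simp add: res_map_def)
      show cl: "res_basis_map R \<phi> (Suc k) \<in> res_basis R M (Suc k) \<rightarrow> res_basis R M' (Suc k)"
        unfolding code res_basis_Suc[of R M'] using ker res_basis_decode by blast
      fix f assume "f \<in> carrier (res_module R M (Suc k))"
      then have f: "f \<in> carrier (free_module R (res_basis R M (Suc k)))" by (simp add: res_module_def)
      show "differential R (res_map R \<phi> (Suc k) f) = res_map R \<phi> k (differential R f)"
      proof (rule free_module_maps_eq[where u = "\<lambda>f. differential R (res_map R \<phi> (Suc k) f)"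
            and v = "\<lambda>f. res_map R \<phi> k (differential R f)", OF R res_module_module[OF R, of M' k] _ _ _ f])
        have "linear_map R (res_module R M (Suc k)) (res_module R M' (Suc k)) (res_map R \<phi> (Suc k))"
          unfolding res_map_def res_module_def by (rule push_forward_linear[OF R cl])
        from linear_map_comp[OF this differential_linear[OF R]]
        show "linear_map R (free_module R (res_basis R M (Suc k))) (res_module R M' k)
            (\<lambda>f. differential R (res_map R \<phi> (Suc k) f))"
          by (simp only: res_module_def)
        have "linear_map R (res_module R M k) (res_module R M' k) (res_map R \<phi> k)"
          unfolding res_map_def res_module_def by (rule push_forward_linear[OF R \<beta>])
        from linear_map_comp[OF differential_linear[OF R] this]
        show "linear_map R (free_module R (res_basis R M (Suc k))) (res_module R M' k)
            (\<lambda>f. res_map R \<phi> k (differential R f))"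
          by (simp only: res_module_def)
        fix b assume b: "b \<in> res_basis R M (Suc k)"
        have b': "res_basis_map R \<phi> (Suc k) b \<in> res_basis R M' (Suc k)" using cl b by auto
        have "differential R (res_map R \<phi> (Suc k) (basis_vec R b)) =
            syz_decode R (res_basis_map R \<phi> (Suc k) b)"
          using push_forward_basis[OF R cl b] differential_basis[OF R b'] by (simp only: res_map_def)
        also have "\<dots> = res_map R \<phi> k (syz_decode R b)"
          unfolding code by (rule syz_decode_code[OF res_kernel_finite[OF ker[OF res_basis_decode[OF b]]]])
        finally show "differential R (res_map R \<phi> (Suc k) (basis_vec R b)) =
            res_map R \<phi> k (differential R (basis_vec R b))"
          by (simp only: differential_basis[OF R b])
      qed
    qed
    have mem: "res_map R \<phi> k f \<in> carrier (res_module R M' k)"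
      if "res_basis_map R \<phi> k \<in> res_basis R M k \<rightarrow> res_basis R M' k" "f \<in> res_kernel R M k" for k f
      using linear_map_closed[OF push_forward_linear[OF R that(1)]] that(2)
      by (simp add: res_kernel_def res_module_def res_map_def)
    case 0
    have "res_map R \<phi> 0 f \<in> res_kernel R M' 0" if "f \<in> res_kernel R M 0" for f
      using mem[OF zero that] that aug[of f] linear_map_zero[OF M M' \<phi>] by (simp add: res_kernel_def)
    then show ?case using zero step by blast
    case (Suc k)
    then have \<beta>: "res_basis_map R \<phi> k \<in> res_basis R M k \<rightarrow> res_basis R M' k" by blast
    have "res_map R \<phi> k \<zero>\<^bsub>res_module R M k\<^esub> = \<zero>\<^bsub>res_module R M' k\<^esub>"
      unfolding res_map_def res_module_def
      by (rule linear_map_zero[OF free_module_module[OF R] free_module_module[OF R] push_forward_linear[OF R \<beta>]])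
    then have z: "res_map R \<phi> k (\<lambda>c. \<zero>\<^bsub>R\<^esub>) = (\<lambda>c. \<zero>\<^bsub>R\<^esub>)"
      by (simp add: res_module_def free_module_simps)
    have "res_map R \<phi> (Suc k) f \<in> res_kernel R M' (Suc k)" if f: "f \<in> res_kernel R M (Suc k)" for f
    proof -
      have "res_map R \<phi> (Suc k) f \<in> carrier (res_module R M' (Suc k))" by (rule mem[OF _ f]) (use Suc in blast)
      moreover have "differential R (res_map R \<phi> (Suc k) f) = res_map R \<phi> k (differential R f)"
        using Suc f by (auto simp only: res_kernel_def)
      ultimately show ?thesis using f z by (simp add: res_kernel_def)
    qed
    then show ?case using Suc step by blast
  qed
  then show "res_basis_map R \<phi> k \<in> res_basis R M k \<rightarrow> res_basis R M' k"
    "f \<in> carrier (res_module R M (Suc k)) \<Longrightarrow>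
      differential R (res_map R \<phi> (Suc k) f) = res_map R \<phi> k (differential R f)"
    by blast+
qed

lemma res_map_linear:
  assumes "module R M" "module R M'" "linear_map R M M' \<phi>"
  shows "linear_map R (res_module R M k) (res_module R M' k) (res_map R \<phi> k)"
proof -
  interpret M: module R M by fact
  show ?thesis
    unfolding res_map_def res_module_def
    by (rule push_forward_linear[OF M.R.cring_axioms res_basis_map_closed[OF assms]])
qed

section \<open>Ext and direct limits\<close>

lemma res_hom_module: "module R X \<Longrightarrow> module R (res_hom R i M X)"
  by (simp add: hom_module_module res_module_module module.axioms)

lemma differential_pullback_linear:
  assumes "cring R"
  shows "linear_map R (res_hom R i M X) (res_hom R (Suc i) M X)
    (\<lambda>g. \<lambda>f\<in>carrier (res_module R M (Suc i)). g (differential R f))"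
  by (rule hom_pullback_linear[OF res_module_module[OF assms] res_module_module[OF assms]
        differential_linear[OF assms]])

text \<open>Cocycles are the kernel of pullback along the differential, and coboundaries of positive
  degree are its image; so the lemmas on preimages and images apply.\<close>

lemma submodule_ext_cocycles:
  assumes X: "module R X"
  shows "submodule (ext_cocycles R i M X) R (res_hom R i M X)"
proof -
  interpret X: module R X by fact
  note R = X.R.cring_axioms
  have "ext_cocycles R i M X = {g \<in> carrier (res_hom R i M X).
      (\<lambda>f\<in>carrier (res_module R M (Suc i)). g (differential R f)) \<in> {\<zero>\<^bsub>res_hom R (Suc i) M X\<^esub>}}"
    unfolding ext_cocycles_def by (auto simp: hom_module_def fun_eq_iff restrict_def)
  also have "submodule \<dots> R (res_hom R i M X)"
    by (rule submodule_vimage[OF res_hom_module[OF X] res_hom_module[OF X]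
          differential_pullback_linear[OF R] submodule_singleton_zero[OF res_hom_module[OF X]]])
  finally show ?thesis .
qed

lemma submodule_ext_coboundaries:
  assumes X: "module R X"
  shows "submodule (ext_coboundaries R i M X) R (res_hom R i M X)"
proof -
  interpret X: module R X by fact
  show ?thesis
  proof (cases i)
    case 0
    then show ?thesis
      by (simp add: ext_coboundaries_def submodule_singleton_zero[OF res_hom_module[OF X]])
  next
    case (Suc k)
    show ?thesis
      unfolding Suc ext_coboundaries_def nat.case
      by (rule submodule_image[OF res_hom_module[OF X] res_hom_module[OF X]
            differential_pullback_linear[OF X.R.cring_axioms]
            module.carrier_is_submodule[OF res_hom_module[OF X]]])
  qed
qed

text \<open>This is d d = 0, read through the pullback; in degree 0 the zero map is the only
  coboundary.\<close>

lemma ext_coboundaries_subset_cocycles: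
  assumes X: "module R X"
  shows "ext_coboundaries R i M X \<subseteq> ext_cocycles R i M X"
proof (cases i)
  case 0
  then show ?thesis
    using submodule_zero[OF submodule_ext_cocycles[OF X]] by (simp add: ext_coboundaries_def)
next
  case (Suc k)
  interpret X: module R X by fact
  note R = X.R.cring_axioms
  show ?thesis
  proof
    fix g assume g: "g \<in> ext_coboundaries R i M X"
    then obtain h where h: "h \<in> carrier (res_hom R k M X)"
      and gh: "g = (\<lambda>f\<in>carrier (res_module R M (Suc k)). h (differential R f))"
      using Suc by (auto simp: ext_coboundaries_def)
    have "h (\<lambda>c. \<zero>\<^bsub>R\<^esub>) = \<zero>\<^bsub>X\<^esub>"
      using linear_map_zero[OF res_module_module[OF R] X, of M k h] h
      by (simp add: carrier_hom_module res_module_def free_module_simps)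
    then have "g (differential R f) = \<zero>\<^bsub>X\<^esub>" if "f \<in> carrier (res_module R M (Suc i))" for f
      using that Suc linear_map_closed[OF differential_linear[OF R] that]
        differential_differential[OF R, of f M k]
      by (simp add: gh)
    then show "g \<in> ext_cocycles R i M X"
      using g submodule_subset[OF submodule_ext_coboundaries[OF X]] by (auto simp: ext_cocycles_def)
  qed
qed

abbreviation cocycle_module ::
    "('a, 'c) ring_scheme \<Rightarrow> nat \<Rightarrow> ('a, 'm, 'd) module_scheme \<Rightarrow> ('a, 'x, 'e) module_scheme
      \<Rightarrow> ('a, (('a, 'm) syz \<Rightarrow> 'a) \<Rightarrow> 'x) module"
  where "cocycle_module R i M X \<equiv> (res_hom R i M X)\<lparr>carrier := ext_cocycles R i M X\<rparr>"

lemma cocycle_module_module: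
  assumes "module R X" shows "module R (cocycle_module R i M X)"
  by (rule submodule.submodule_is_module[OF submodule_ext_cocycles res_hom_module]) fact+

lemma submodule_coboundaries_cocycles:
  assumes "module R X"
  shows "submodule (ext_coboundaries R i M X) R (cocycle_module R i M X)"
  using assms by (intro submodule_carrier_restrict res_hom_module submodule_ext_cocycles
      submodule_ext_coboundaries ext_coboundaries_subset_cocycles)

lemma Ext_module: "module R X \<Longrightarrow> module R (Ext R i M X)"
  unfolding Ext_def
  by (rule quotient_module_module[OF cocycle_module_module submodule_coboundaries_cocycles])

text \<open>Pullback along the chain map preserves cocycles and coboundaries because the chain map
  commutes with the differentials. The union in \<open>Ext_map\<close> is then evaluated on a coset
  by \<open>UN_coset_induced\<close>.\<close>

lemma Ext_map_linear:
  fixes R :: "('a, 'c) ring_scheme" and M :: "('a, 'm, 'd) module_scheme"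
    and M' :: "('a, 'n, 'f) module_scheme" and X :: "('a, 'x, 'e) module_scheme"
  assumes M: "module R M" and M': "module R M'" and X: "module R X" and \<phi>: "linear_map R M M' \<phi>"
  shows "linear_map R (Ext R i M' X) (Ext R i M X) (Ext_map R i M \<phi> X)"
proof -
  interpret M: module R M by fact
  note R = M.R.cring_axioms
  define u :: "((('a, 'n) syz \<Rightarrow> 'a) \<Rightarrow> 'x) \<Rightarrow> (('a, 'm) syz \<Rightarrow> 'a) \<Rightarrow> 'x" where "u = (\<lambda>g. \<lambda>f\<in>carrier (res_module R M i). g (res_map R \<phi> i f))"
  have hom: "linear_map R (res_hom R i M' X) (res_hom R i M X) u"
    unfolding u_def
    by (rule hom_pullback_linear[OF res_module_module[OF R] res_module_module[OF R] res_map_linear[OF M M' \<phi>]])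
  have cocycle: "u g \<in> ext_cocycles R i M X" if g: "g \<in> ext_cocycles R i M' X" for g
  proof -
    have "u g (differential R f) = \<zero>\<^bsub>X\<^esub>" if f: "f \<in> carrier (res_module R M (Suc i))" for f
    proof -
      have "u g (differential R f) = g (differential R (res_map R \<phi> (Suc i) f))"
        using linear_map_closed[OF differential_linear[OF R] f]
        by (simp add: u_def differential_res_map[OF M M' \<phi> f])
      also have "\<dots> = \<zero>\<^bsub>X\<^esub>"
        using g linear_map_closed[OF res_map_linear[OF M M' \<phi>] f] by (simp add: ext_cocycles_def)
      finally show ?thesis .
    qed
    then show ?thesis
      using linear_map_closed[OF hom] g by (simp add: ext_cocycles_def)
  qed
  have coboundary: "u g \<in> ext_coboundaries R i M X" if g: "g \<in> ext_coboundaries R i M' X" for g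
  proof (cases i)
    case 0
    then show ?thesis
      using g linear_map_zero[OF res_hom_module[OF X] res_hom_module[OF X] hom]
      by (simp add: ext_coboundaries_def)
  next
    case (Suc k)
    then obtain h where h: "h \<in> carrier (res_hom R k M' X)"
      and gh: "g = (\<lambda>f\<in>carrier (res_module R M' (Suc k)). h (differential R f))"
      using g by (auto simp: ext_coboundaries_def)
    \<comment> \<open>The pullback of the coboundary of \<open>h\<close> is the coboundary of the
      pullback of \<open>h\<close> one degree below.\<close>
    have "u g = (\<lambda>f\<in>carrier (res_module R M (Suc k)).
        (\<lambda>f\<in>carrier (res_module R M k). h (res_map R \<phi> k f)) (differential R f))"
      unfolding u_def Suc gh
      using linear_map_closed[OF res_map_linear[OF M M' \<phi>, of "Suc k"]]
        linear_map_closed[OF differential_linear[OF R, of M k]] differential_res_map[OF M M' \<phi>, of _ k]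
      by (auto intro!: restrict_ext)
    moreover have "(\<lambda>f\<in>carrier (res_module R M k). h (res_map R \<phi> k f)) \<in> carrier (res_hom R k M X)"
      by (rule linear_map_closed[OF hom_pullback_linear[OF res_module_module[OF R] res_module_module[OF R]
              res_map_linear[OF M M' \<phi>]] h])
    ultimately show ?thesis
      unfolding Suc ext_coboundaries_def nat.case by blast
  qed
  have lin: "linear_map R (cocycle_module R i M' X) (cocycle_module R i M X) u"
  proof (rule linear_mapI)
    fix g h assume "g \<in> carrier (cocycle_module R i M' X)" "h \<in> carrier (cocycle_module R i M' X)"
    then show "u (g \<oplus>\<^bsub>cocycle_module R i M' X\<^esub> h) = u g \<oplus>\<^bsub>cocycle_module R i M X\<^esub> u h"
      using linear_map_add[OF hom, of g h] by (simp add: ext_cocycles_def)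
  next
    fix a g assume "a \<in> carrier R" "g \<in> carrier (cocycle_module R i M' X)"
    then show "u (a \<odot>\<^bsub>cocycle_module R i M' X\<^esub> g) = a \<odot>\<^bsub>cocycle_module R i M X\<^esub> u g"
      using linear_map_smult[OF hom, of a g] by (simp add: ext_cocycles_def)
  qed (simp add: cocycle)
  show ?thesis
    unfolding Ext_def
  proof (rule quotient_induced_linear[OF cocycle_module_module[OF X] submodule_coboundaries_cocycles[OF X]
        cocycle_module_module[OF X] submodule_coboundaries_cocycles[OF X] lin])
    fix g assume g: "g \<in> carrier (cocycle_module R i M' X)"
    let ?B = "ext_coboundaries R i M X" and ?B' = "ext_coboundaries R i M' X"
    have "(\<Union>h\<in>?B' +>\<^bsub>cocycle_module R i M' X\<^esub> g. ?B +>\<^bsub>cocycle_module R i M X\<^esub> u h) =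
        ?B +>\<^bsub>cocycle_module R i M X\<^esub> u g"
    proof (rule UN_coset_induced[OF cocycle_module_module[OF X] submodule_coboundaries_cocycles[OF X]
          cocycle_module_module[OF X] submodule_coboundaries_cocycles[OF X] _ _ coboundary g])
      fix h h' assume h: "h \<in> ?B'" "h' \<in> carrier (cocycle_module R i M' X)"
      have "h \<in> carrier (cocycle_module R i M' X)"
        using ext_coboundaries_subset_cocycles[OF X] h(1) by auto
      then show "u (h \<oplus>\<^bsub>cocycle_module R i M' X\<^esub> h') = u h \<oplus>\<^bsub>cocycle_module R i M X\<^esub> u h'"
        using h(2) by (rule linear_map_add[OF lin])
    qed (rule linear_map_closed[OF lin])
    \<comment> \<open>\<open>Ext_map\<close> takes its cosets in the module of all cochains; a coset
      depends only on the addition, which the cocycle module shares.\<close>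
    then show "Ext_map R i M \<phi> X (?B' +>\<^bsub>cocycle_module R i M' X\<^esub> g) = ?B +>\<^bsub>cocycle_module R i M X\<^esub> u g"
      by (simp add: Ext_map_def u_def a_r_coset_def')
  qed
qed

section \<open>Direct limits of sequences of modules\<close>

lemma
  assumes D: "\<And>n. module R (D n)" and t: "\<And>n. linear_map R (D n) (D (Suc n)) (t n)"
  shows transition_linear: "linear_map R (D n) (D (n + k)) (transition t n k)"
    and transition_transition: "transition t (n + j) k (transition t n j x) = transition t n (j + k) x"
proof -
  show "linear_map R (D n) (D (n + k)) (transition t n k)"
  proof (induction k)
    case 0
    show ?case by (auto intro: linear_mapI)
  next
    case (Suc k)
    show ?case using linear_map_comp[OF Suc t] by simp
  qed
  show "transition t (n + j) k (transition t n j x) = transition t n (j + k) x"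
    by (induction k) (simp_all add: add.assoc)
qed

text \<open>The stages are the charts: any three classes have representatives at a common stage.
  Well-definedness rests on \<open>shift\<close>, by which moving a representative along the
  transition maps does not change its class; the unions defining sum and scalar multiple then run
  over equal sets.\<close>

lemma direct_limit_module:
  assumes "cring R" and D: "\<And>n. module R (D n)" and t: "\<And>n. linear_map R (D n) (D (Suc n)) (t n)"
  shows "module R (direct_limit D t)"
proof -
  let ?L = "direct_limit D t" and ?c = "lim_class D t"
  note tl = transition_linear[of R D t, OF D t] and tt = transition_transition[of R D t, OF D t]
  note tcl = linear_map_closed[OF tl]
  have self: "(n, x) \<in> ?c n x" if "x \<in> carrier (D n)" for n x
    using that by (auto simp: lim_class_def)
  have shift: "?c (n + j) (transition t n j x) = ?c n x" if x: "x \<in> carrier (D n)" for n j x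
  proof -
    have "(\<exists>i k. n + j + i = m + k \<and> transition t (n + j) i (transition t n j x) = transition t m k y) \<longleftrightarrow>
        (\<exists>i k. n + i = m + k \<and> transition t n i x = transition t m k y)" for m y
    proof
      assume "\<exists>i k. n + j + i = m + k \<and> transition t (n + j) i (transition t n j x) = transition t m k y"
      then show "\<exists>i k. n + i = m + k \<and> transition t n i x = transition t m k y"
        unfolding tt by (metis add.assoc)
    next
      assume "\<exists>i k. n + i = m + k \<and> transition t n i x = transition t m k y"
      then obtain i k where ik: "n + i = m + k" "transition t n i x = transition t m k y" by blast
      \<comment> \<open>Agreement at stage \<open>n + i\<close> persists after \<open>j\<close>
        further steps, which leaves room for the shift by \<open>j\<close>.\<close>
      have "transition t n (j + i) x = transition t (n + i) j (transition t n i x)"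
        unfolding tt by (simp add: add.commute)
      also have "\<dots> = transition t m (k + j) y"
        unfolding ik tt ..
      finally show "\<exists>i k. n + j + i = m + k \<and> transition t (n + j) i (transition t n j x) = transition t m k y"
        unfolding tt using ik(1) by (metis add.assoc add.commute)
    qed
    then show ?thesis by (auto simp: lim_class_def)
  qed
  have add: "?c n x \<oplus>\<^bsub>?L\<^esub> ?c n y = ?c n (x \<oplus>\<^bsub>D n\<^esub> y)" if xy: "x \<in> carrier (D n)" "y \<in> carrier (D n)" for n x y
  proof -
    interpret Dn: module R "D n" by (rule D)
    have *: "?c (m + m') (transition t m m' x' \<oplus>\<^bsub>D (m + m')\<^esub> transition t m' m y') = ?c n (x \<oplus>\<^bsub>D n\<^esub> y)"
      if x': "(m, x') \<in> ?c n x" and y': "(m', y') \<in> ?c n y" for m x' m' y'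
    proof -
      obtain j k where jk: "n + j = m + k" "transition t n j x = transition t m k x'" and x'D: "x' \<in> carrier (D m)"
        using x' by (auto simp: lim_class_def)
      obtain j' k' where jk': "n + j' = m' + k'" "transition t n j' y = transition t m' k' y'" and y'D: "y' \<in> carrier (D m')"
        using y' by (auto simp: lim_class_def)
      \<comment> \<open>Since \<open>N = (m + k) + (m' + k')\<close>, this stage lies beyond
        \<open>m + k\<close>, where the images of \<open>x\<close> and \<open>x'\<close> agree, and
        beyond \<open>m' + k'\<close>, where those of \<open>y\<close> and \<open>y'\<close>
        agree.\<close>
      define N where "N = m + m' + (k + k')"
      have cx: "transition t (m + m') (k + k') (transition t m m' x') = transition t n (N - n) x"
      proof -
        have "transition t (m + m') (k + k') (transition t m m' x') = transition t m (k + (m' + k')) x'"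
          unfolding tt by (simp add: ac_simps)
        also have "\<dots> = transition t (m + k) (m' + k') (transition t m k x')" by (simp add: tt)
        also have "\<dots> = transition t n (j + (m' + k')) x"
          using jk by (metis tt)
        also have "j + (m' + k') = N - n" using jk(1) by (simp add: N_def)
        finally show ?thesis .
      qed
      have cy: "transition t (m + m') (k + k') (transition t m' m y') = transition t n (N - n) y"
      proof -
        have "transition t (m + m') (k + k') (transition t m' m y') = transition t m' (k' + (m + k)) y'"
          using tt[of m' m "k + k'" y'] by (simp add: ac_simps)
        also have "\<dots> = transition t (m' + k') (m + k) (transition t m' k' y')" by (simp add: tt)
        also have "\<dots> = transition t n (j' + (m + k)) y"
          using jk' by (metis tt)
        also have "j' + (m + k) = N - n" using jk'(1) by (simp add: N_def)
        finally show ?thesis .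
      qed
      have N: "n + (N - n) = m + m' + (k + k')" using jk(1) by (simp add: N_def)
      have mem: "transition t m m' x' \<in> carrier (D (m + m'))" "transition t m' m y' \<in> carrier (D (m + m'))"
        using tcl[OF x'D, of m'] tcl[OF y'D, of m] by (simp_all add: add.commute)
      interpret Dm: module R "D (m + m')" by (rule D)
      have "transition t (m + m') (k + k') (transition t m m' x' \<oplus>\<^bsub>D (m + m')\<^esub> transition t m' m y') =
          transition t n (N - n) (x \<oplus>\<^bsub>D n\<^esub> y)"
        using linear_map_add[OF tl mem, of "k + k'"] linear_map_add[OF tl xy, of "N - n"] N
        by (simp add: cx cy)
      then show ?thesis
        using shift[of "transition t m m' x' \<oplus>\<^bsub>D (m + m')\<^esub> transition t m' m y'" "m + m'" "k + k'"]
          shift[of "x \<oplus>\<^bsub>D n\<^esub> y" n "N - n"] mem xy N by simp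
    qed
    have "(\<Union>(m', y')\<in>?c n y. ?c (m + m') (transition t m m' x' \<oplus>\<^bsub>D (m + m')\<^esub> transition t m' m y')) =
        ?c n (x \<oplus>\<^bsub>D n\<^esub> y)" if "(m, x') \<in> ?c n x" for m x'
      by (rule SUP_eq_const) (use self[OF xy(2)] *[OF that] in auto)
    then have "(\<Union>(m, x')\<in>?c n x. \<Union>(m', y')\<in>?c n y.
        ?c (m + m') (transition t m m' x' \<oplus>\<^bsub>D (m + m')\<^esub> transition t m' m y')) = ?c n (x \<oplus>\<^bsub>D n\<^esub> y)"
      by (intro SUP_eq_const) (use self[OF xy(1)] in auto)
    then show ?thesis by (simp add: direct_limit_def)
  qed
  have smult: "a \<odot>\<^bsub>?L\<^esub> ?c n x = ?c n (a \<odot>\<^bsub>D n\<^esub> x)" if x: "x \<in> carrier (D n)" and a: "a \<in> carrier R" for n x a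
  proof -
    have *: "?c m (a \<odot>\<^bsub>D m\<^esub> y) = ?c n (a \<odot>\<^bsub>D n\<^esub> x)" if y: "(m, y) \<in> ?c n x" for m y
    proof -
      obtain j k where jk: "n + j = m + k" "transition t n j x = transition t m k y" and yD: "y \<in> carrier (D m)"
        using y by (auto simp: lim_class_def)
      have "transition t n j (a \<odot>\<^bsub>D n\<^esub> x) = transition t m k (a \<odot>\<^bsub>D m\<^esub> y)"
        using linear_map_smult[OF tl a x, of j] linear_map_smult[OF tl a yD, of k] jk by simp
      then show ?thesis
        using shift[of "a \<odot>\<^bsub>D n\<^esub> x" n j] shift[of "a \<odot>\<^bsub>D m\<^esub> y" m k] jk(1)
          module.smult_closed[OF D a x] module.smult_closed[OF D a yD]
        by simp
    qed
    have "(\<Union>(m, y)\<in>?c n x. ?c m (a \<odot>\<^bsub>D m\<^esub> y)) = ?c n (a \<odot>\<^bsub>D n\<^esub> x)"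
    proof (rule SUP_eq_const)
      show "(case p of (m, y) \<Rightarrow> ?c m (a \<odot>\<^bsub>D m\<^esub> y)) = ?c n (a \<odot>\<^bsub>D n\<^esub> x)" if "p \<in> ?c n x" for p
        using *[of "fst p" "snd p"] that by (simp add: case_prod_unfold)
    qed (use self[OF x] in blast)
    then show ?thesis by (simp add: direct_limit_def)
  qed
  show ?thesis
  proof (rule module_by_charts[OF assms(1), where D = D and f = ?c])
    show "linear_map R (D n) ?L (?c n)" for n
      by (rule linear_mapI) (auto simp: add smult, auto simp: direct_limit_def)
    show "?c n \<zero>\<^bsub>D n\<^esub> = \<zero>\<^bsub>?L\<^esub>" for n
    proof -
      interpret D0: module R "D 0" by (rule D)
      show ?thesis
        using shift[of "\<zero>\<^bsub>D 0\<^esub>" 0 n] linear_map_zero[OF D D tl, of 0 n] by (simp add: direct_limit_def)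
    qed
    fix x y z assume "x \<in> carrier ?L" "y \<in> carrier ?L" "z \<in> carrier ?L"
    then obtain n x' m y' k z' where *: "x = ?c n x'" "x' \<in> carrier (D n)" "y = ?c m y'" "y' \<in> carrier (D m)"
        "z = ?c k z'" "z' \<in> carrier (D k)"
      by (auto simp: direct_limit_def)
    have "x \<in> ?c (n + m + k) ` carrier (D (n + m + k))"
      using shift[OF *(2), of "m + k"] tcl[OF *(2), of "m + k"] *(1)
      by (intro image_eqI[of _ _ "transition t n (m + k) x'"]) (simp_all add: ac_simps)
    moreover have "y \<in> ?c (n + m + k) ` carrier (D (n + m + k))"
      using shift[OF *(4), of "n + k"] tcl[OF *(4), of "n + k"] *(3)
      by (intro image_eqI[of _ _ "transition t m (n + k) y'"]) (simp_all add: ac_simps)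
    moreover have "z \<in> ?c (n + m + k) ` carrier (D (n + m + k))"
      using shift[OF *(6), of "n + m"] tcl[OF *(6), of "n + m"] *(5)
      by (intro image_eqI[of _ _ "transition t k (n + m) z'"]) (simp_all add: ac_simps)
    ultimately show "\<exists>i. {x, y, z} \<subseteq> ?c i ` carrier (D i)" by blast
  qed (rule D)
qed

section \<open>Powers of ideals, truncations and the module structure on local cohomology\<close>

lemma ideal_power_ideal:
  assumes "cring R" "ideal I R" shows "ideal (ideal_power R I n) R"
proof -
  interpret cring R by fact
  interpret S: comm_monoid "ideals_set R" by (rule ideals_set_is_comm_monoid)
  have "I [^]\<^bsub>ideals_set R\<^esub> n \<in> carrier (ideals_set R)"
    using assms(2) by (intro S.nat_pow_closed) (simp add: ideals_set_def)
  then show ?thesis by (simp add: ideals_set_def ideal_power_def)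
qed

lemma ideal_power_Suc: "ideal_power R I (Suc n) = ideal_prod R (ideal_power R I n) I"
  by (simp add: ideal_power_def nat_pow_def ideals_set_def)

lemma ideal_power_antimono:
  assumes "cring R" "ideal I R" "n \<le> m"
  shows "ideal_power R I m \<subseteq> ideal_power R I n"
  using assms(3)
proof (induction m rule: dec_induct)
  case (step m)
  interpret cring R by fact
  show ?case
    using step ideal_prod_inter[OF ideal_power_ideal[OF assms(1,2)] assms(2), of m]
    by (auto simp: ideal_power_Suc)
qed simp

lemma submodule_ideal_module:
  assumes M: "module R M" and I: "I \<subseteq> carrier R"
  shows "submodule (ideal_module R I M) R M"
proof -
  interpret M: module R M by fact
  have "{a \<odot>\<^bsub>M\<^esub> x |a x. a \<in> I \<and> x \<in> carrier M} \<subseteq> carrier M" using I by auto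
  then show ?thesis
    unfolding ideal_module_def submodule_span_def
    using M.carrier_is_submodule by (intro submodule_Inter[OF M]) auto
qed

lemma ideal_module_mono: "I \<subseteq> J \<Longrightarrow> ideal_module R I M \<subseteq> ideal_module R J M"
  unfolding ideal_module_def submodule_span_def by (rule Inter_anti_mono) blast

text \<open>As the powers of \<open>I\<close> decrease, \<open>truncation_map\<close> sends the
  coset of \<open>x\<close> to the coset of \<open>x\<close>, so it is induced by the identity of
  \<open>M\<close>. Linearity passes from it to the maps on \<open>Ext\<close>, and these form the
  sequence whose limit is taken.\<close>

lemma local_cohomology_module:
  assumes I: "ideal I R" and M: "module R M" and X: "module R X"
  shows "module R (local_cohomology R I i M X)"
proof -
  interpret M: module R M by fact
  note R = M.R.cring_axioms
  let ?J = "\<lambda>n. ideal_module R (ideal_power R I n) M"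
  have sub: "submodule (?J n) R M" for n
    using submodule_ideal_module[OF M] ideal_power_ideal[OF R I, of n]
    by (simp add: additive_subgroup.a_subset ideal.axioms(1))
  have T: "module R (truncation R I M n)" for n
    unfolding truncation_def by (rule quotient_module_module[OF M sub])
  have id: "linear_map R M M (\<lambda>x. x)" by (auto intro: linear_mapI)
  have "linear_map R (truncation R I M (Suc n)) (truncation R I M n) (truncation_map R I M n)" for n
    unfolding truncation_def
  proof (rule quotient_induced_linear[OF M sub M sub id])
    fix x assume x: "x \<in> carrier M"
    have le: "?J (Suc n) \<subseteq> ?J n"
      by (rule ideal_module_mono[OF ideal_power_antimono[OF R I]]) simp
    have c: "y \<in> carrier M" if "y \<in> ?J n" for y using submodule_subset[OF sub] that by blast
    show "truncation_map R I M n (?J (Suc n) +>\<^bsub>M\<^esub> x) = ?J n +>\<^bsub>M\<^esub> x"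
    proof
      show "truncation_map R I M n (?J (Suc n) +>\<^bsub>M\<^esub> x) \<subseteq> ?J n +>\<^bsub>M\<^esub> x"
      proof
        fix z assume "z \<in> truncation_map R I M n (?J (Suc n) +>\<^bsub>M\<^esub> x)"
        then obtain y y' where y: "y \<in> ?J n" "y' \<in> ?J (Suc n)" "z = y \<oplus>\<^bsub>M\<^esub> (y' \<oplus>\<^bsub>M\<^esub> x)"
          by (auto simp: truncation_map_def set_add_def' a_r_coset_def')
        then have "z = (y \<oplus>\<^bsub>M\<^esub> y') \<oplus>\<^bsub>M\<^esub> x" using x c le by (auto simp: M.M.a_assoc)
        moreover have "y \<oplus>\<^bsub>M\<^esub> y' \<in> ?J n" using y le submodule_add[OF sub] by blast
        ultimately show "z \<in> ?J n +>\<^bsub>M\<^esub> x" by (auto simp: a_r_coset_def')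
      qed
      show "?J n +>\<^bsub>M\<^esub> x \<subseteq> truncation_map R I M n (?J (Suc n) +>\<^bsub>M\<^esub> x)"
        using coset_self[OF M sub x, of "Suc n"]
        by (auto simp: truncation_map_def set_add_def' a_r_coset_def'[of M "?J n"])
    qed
  qed
  then show ?thesis
    unfolding local_cohomology_def
    by (intro direct_limit_module Ext_module[OF X] Ext_map_linear T X R)
qed

section \<open>Torsion and descending chains\<close>

text \<open>Through this, annihilators, ideals of leading coefficients and R+ are recognised as
  ideals by the lemmas on submodules.\<close>

lemma submodule_self_imp_ideal:
  assumes "cring R" "submodule J R (self_module R)"
  shows "ideal J R"
proof -
  interpret cring R by fact
  have sub: "J \<subseteq> carrier R"
    using submodule_subset[OF assms(2)] by (simp add: self_module_simps)
  show ?thesis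
  proof (rule idealI[OF ring_axioms])
    show "subgroup J (add_monoid R)"
    proof (rule add.subgroupI[OF sub])
      show "J \<noteq> {}" using submodule_zero[OF assms(2)] by auto
      show "\<ominus>\<^bsub>R\<^esub> x \<in> J" if x: "x \<in> J" for x
      proof -
        have "(\<ominus>\<^bsub>R\<^esub> \<one>\<^bsub>R\<^esub>) \<otimes>\<^bsub>R\<^esub> x \<in> J"
          using submodule.smult_closed[OF assms(2) _ x, of "\<ominus>\<^bsub>R\<^esub> \<one>\<^bsub>R\<^esub>"] by (simp add: self_module_simps)
        then show ?thesis using x sub by (auto simp: l_minus)
      qed
      show "x \<oplus>\<^bsub>R\<^esub> y \<in> J" if "x \<in> J" "y \<in> J" for x y
        using submodule_add[OF assms(2) that] by (simp add: self_module_simps)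
    qed
    show l: "x \<otimes>\<^bsub>R\<^esub> a \<in> J" if "a \<in> J" "x \<in> carrier R" for a x
      using submodule.smult_closed[OF assms(2) that(2,1)] by (simp add: self_module_simps)
    show "a \<otimes>\<^bsub>R\<^esub> x \<in> J" if "a \<in> J" "x \<in> carrier R" for a x
      using l[OF that] that sub m_comm[of a x] by auto
  qed
qed

lemma ideal_imp_submodule_self:
  assumes "cring R" "ideal J R"
  shows "submodule J R (self_module R)"
proof -
  interpret cring R by fact
  interpret J: ideal J R by fact
  show ?thesis
    by (rule module_submoduleI[OF self_module_module[OF assms(1)]])
      (auto simp: self_module_simps J.I_l_closed)
qed

lemma cring_ideal_subset:
  assumes "ideal I R" shows "I \<subseteq> carrier R"
  using assms by (simp add: additive_subgroup.a_subset ideal.axioms(1))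

lemma smult_map_linear:
  assumes "module R X" "x \<in> carrier X"
  shows "linear_map R (self_module R) X (\<lambda>r. r \<odot>\<^bsub>X\<^esub> x)"
proof -
  interpret X: module R X by fact
  show ?thesis
    by (rule linear_mapI) (use assms(2) in \<open>auto simp: self_module_simps X.smult_l_distr X.smult_assoc1\<close>)
qed

lemma homothety_linear:
  assumes "module R X" "a \<in> carrier R"
  shows "linear_map R X X (\<lambda>x. a \<odot>\<^bsub>X\<^esub> x)"
proof -
  interpret X: module R X by fact
  show ?thesis
    by (rule linear_mapI)
      (use assms(2) in \<open>auto simp: X.smult_r_distr X.R.m_comm simp flip: X.smult_assoc1\<close>)
qed

lemma annihilator_ideal:
  assumes "module R X" "x \<in> carrier X"
  shows "ideal {r \<in> carrier R. r \<odot>\<^bsub>X\<^esub> x = \<zero>\<^bsub>X\<^esub>} R"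
proof -
  interpret X: module R X by fact
  have "submodule {r \<in> carrier (self_module R). r \<odot>\<^bsub>X\<^esub> x \<in> {\<zero>\<^bsub>X\<^esub>}} R (self_module R)"
    by (rule submodule_vimage[OF self_module_module[OF X.R.cring_axioms] assms(1)
          smult_map_linear[OF assms] submodule_singleton_zero[OF assms(1)]])
  then show ?thesis
    by (intro submodule_self_imp_ideal[OF X.R.cring_axioms]) (simp add: self_module_simps)
qed

lemma annihilated_submodule:
  assumes X: "module R X" and W: "submodule W R X" and L: "L \<subseteq> carrier R"
  shows "submodule {x \<in> W. \<forall>a\<in>L. a \<odot>\<^bsub>X\<^esub> x = \<zero>\<^bsub>X\<^esub>} R X"
proof -
  interpret X: module R X by fact
  have com: "a \<odot>\<^bsub>X\<^esub> (b \<odot>\<^bsub>X\<^esub> x) = b \<odot>\<^bsub>X\<^esub> (a \<odot>\<^bsub>X\<^esub> x)"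
    if "a \<in> carrier R" "b \<in> carrier R" "x \<in> carrier X" for a b x
    using linear_map_smult[OF homothety_linear[OF X that(1)] that(2,3)] .
  show ?thesis
    by (rule module_submoduleI[OF X])
      (use L submodule_subset[OF W] submodule_zero[OF W] submodule_add[OF W]
        submodule.smult_closed[OF W] in \<open>auto simp: subset_iff X.smult_r_distr com\<close>)
qed

text \<open>An ideal maximal among those containing \<open>I\<close> and no power of \<open>a\<close> is prime.\<close>

lemma exists_prime_avoiding:
  assumes "cring R" "ideal I R" and a: "a \<in> carrier R" and pow: "\<And>n. a [^]\<^bsub>R\<^esub> (n::nat) \<notin> I"
  shows "\<exists>P. primeideal P R \<and> I \<subseteq> P \<and> a \<notin> P"
proof -
  interpret cring R by fact
  define \<J> where "\<J> = {J. ideal J R \<and> I \<subseteq> J \<and> (\<forall>n. a [^]\<^bsub>R\<^esub> (n::nat) \<notin> J)}"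
  have "\<exists>P\<in>\<J>. \<forall>J\<in>\<J>. P \<subseteq> J \<longrightarrow> J = P"
  proof (rule subset_Zorn_nonempty)
    show "\<J> \<noteq> {}" using assms(2) pow by (auto simp: \<J>_def)
    fix \<C> assume \<C>: "\<C> \<noteq> {}" "subset.chain \<J> \<C>"
    then have "subset.chain {J. ideal J R} \<C>" by (auto simp: subset.chain_def \<J>_def)
    from chain_Union_is_ideal[OF this] have "ideal (\<Union>\<C>) R" using \<C>(1) by simp
    then show "\<Union>\<C> \<in> \<J>" using \<C> by (auto simp: subset.chain_def \<J>_def)
  qed
  then obtain P where P: "P \<in> \<J>" and max: "\<And>J. \<lbrakk>J \<in> \<J>; P \<subseteq> J\<rbrakk> \<Longrightarrow> J = P" by blast
  interpret P: ideal P R using P by (simp add: \<J>_def)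
  \<comment> \<open>By maximality of \<open>P\<close>, the larger ideal generated by
    \<open>P\<close> and \<open>b\<close> contains a power of \<open>a\<close>.\<close>
  have power: "\<exists>n::nat. \<exists>p\<in>P. \<exists>r\<in>carrier R. a [^]\<^bsub>R\<^esub> n = p \<oplus>\<^bsub>R\<^esub> r \<otimes>\<^bsub>R\<^esub> b"
    if b: "b \<in> carrier R" "b \<notin> P" for b
  proof -
    let ?J = "P <+>\<^bsub>R\<^esub> PIdl\<^bsub>R\<^esub> b"
    have J: "ideal ?J R" by (rule add_ideals[OF P.ideal_axioms cgenideal_ideal[OF b(1)]])
    have PJ: "P \<subseteq> ?J"
    proof
      fix x assume "x \<in> P"
      then have "x = x \<oplus>\<^bsub>R\<^esub> \<zero>\<^bsub>R\<^esub> \<otimes>\<^bsub>R\<^esub> b" using b(1) by simp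
      then show "x \<in> ?J" using \<open>x \<in> P\<close> unfolding set_add_def' cgenideal_def by blast
    qed
    have "b = \<zero>\<^bsub>R\<^esub> \<oplus>\<^bsub>R\<^esub> \<one>\<^bsub>R\<^esub> \<otimes>\<^bsub>R\<^esub> b" using b(1) by simp
    then have "b \<in> ?J" using P.zero_closed unfolding set_add_def' cgenideal_def by blast
    then have "?J \<notin> \<J>" using max[OF _ PJ] b(2) by auto
    then obtain n :: nat where "a [^]\<^bsub>R\<^esub> n \<in> ?J" using J PJ P by (auto simp: \<J>_def)
    then show ?thesis unfolding set_add_def' cgenideal_def by blast
  qed
  have "primeideal P R"
  proof (rule primeidealI[OF P.ideal_axioms assms(1)])
    show "carrier R \<noteq> P" using P nat_pow_closed[OF a] by (auto simp: \<J>_def)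
    fix b c assume b: "b \<in> carrier R" and c: "c \<in> carrier R" and bc: "b \<otimes>\<^bsub>R\<^esub> c \<in> P"
    show "b \<in> P \<or> c \<in> P"
    proof (rule ccontr)
      assume "\<not> (b \<in> P \<or> c \<in> P)"
      then obtain n p r m q s where 1: "p \<in> P" "r \<in> carrier R" "a [^]\<^bsub>R\<^esub> (n::nat) = p \<oplus>\<^bsub>R\<^esub> r \<otimes>\<^bsub>R\<^esub> b"
        and 2: "q \<in> P" "s \<in> carrier R" "a [^]\<^bsub>R\<^esub> (m::nat) = q \<oplus>\<^bsub>R\<^esub> s \<otimes>\<^bsub>R\<^esub> c"
        using power b c by metis
      have carr: "p \<in> carrier R" "q \<in> carrier R" using 1(1) 2(1) by auto
      \<comment> \<open>Multiplied out, every term but the last has a factor \<open>p\<close> or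
        \<open>q\<close> in \<open>P\<close>, and the last one contains the product of
        \<open>b\<close> and \<open>c\<close>.\<close>
      have "a [^]\<^bsub>R\<^esub> (n + m) = (p \<oplus>\<^bsub>R\<^esub> r \<otimes>\<^bsub>R\<^esub> b) \<otimes>\<^bsub>R\<^esub> (q \<oplus>\<^bsub>R\<^esub> s \<otimes>\<^bsub>R\<^esub> c)"
        using a by (simp add: 1(3) 2(3) flip: nat_pow_mult)
      also have "\<dots> = (q \<oplus>\<^bsub>R\<^esub> s \<otimes>\<^bsub>R\<^esub> c) \<otimes>\<^bsub>R\<^esub> p \<oplus>\<^bsub>R\<^esub> ((r \<otimes>\<^bsub>R\<^esub> b) \<otimes>\<^bsub>R\<^esub> q \<oplus>\<^bsub>R\<^esub> (r \<otimes>\<^bsub>R\<^esub> s) \<otimes>\<^bsub>R\<^esub> (b \<otimes>\<^bsub>R\<^esub> c))"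
        using carr b c 1(2) 2(2) by (simp add: l_distr r_distr m_ac a_ac)
      also have "\<dots> \<in> P"
        using P.I_l_closed[OF 1(1)] P.I_l_closed[OF 2(1)] P.I_l_closed[OF bc] 1(2) 2(2) b c carr
        by (intro P.a_closed) auto
      finally show False using P by (auto simp: \<J>_def)
    qed
  qed
  moreover have "a \<notin> P" using P nat_pow_eone[OF a] by (metis (mono_tags, lifting) \<J>_def mem_Collect_eq)
  ultimately show ?thesis using P by (auto simp: \<J>_def)
qed

text \<open>If no power of \<open>a\<close> killed \<open>x\<close>, the annihilator of
  \<open>x\<close> would lie in a prime \<open>P\<close> avoiding \<open>a\<close>. Then x/1 is
  nonzero in the localization at \<open>P\<close>, so \<open>P\<close> is in the support without
  containing \<open>I\<close>.\<close>

lemma support_subset_imp_torsion: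
  assumes X: "module R X" and "I \<subseteq> carrier R" and supp: "support R X \<subseteq> vanishing_set R I"
    and x: "x \<in> carrier X" and a: "a \<in> I"
  shows "\<exists>n::nat. (a [^]\<^bsub>R\<^esub> n) \<odot>\<^bsub>X\<^esub> x = \<zero>\<^bsub>X\<^esub>"
proof (rule ccontr)
  interpret X: module R X by fact
  have aR: "a \<in> carrier R" using assms by auto
  assume "\<nexists>n::nat. (a [^]\<^bsub>R\<^esub> n) \<odot>\<^bsub>X\<^esub> x = \<zero>\<^bsub>X\<^esub>"
  then obtain P where P: "primeideal P R" "{r \<in> carrier R. r \<odot>\<^bsub>X\<^esub> x = \<zero>\<^bsub>X\<^esub>} \<subseteq> P" "a \<notin> P"
    using exists_prime_avoiding[OF X.R.cring_axioms annihilator_ideal[OF X x] aR] by blast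
  interpret P: primeideal P R by fact
  have one: "\<one>\<^bsub>R\<^esub> \<in> carrier R - P"
    using P.I_notcarr P.one_imp_carrier by auto
  have "(x, \<one>\<^bsub>R\<^esub>) \<in> fraction R P X x \<one>\<^bsub>R\<^esub>"
    using x one by (auto simp: fraction_def)
  \<comment> \<open>Membership in the zero fraction would produce an element outside
    \<open>P\<close> that kills \<open>x\<close>, against the choice of \<open>P\<close>.\<close>
  moreover have "(x, \<one>\<^bsub>R\<^esub>) \<notin> fraction R P X \<zero>\<^bsub>X\<^esub> \<one>\<^bsub>R\<^esub>"
    using P(2) x by (auto simp: fraction_def)
  moreover have "fraction R P X x \<one>\<^bsub>R\<^esub> \<in> localization R P X"
    using x one by (auto simp: localization_def)
  ultimately have "P \<in> support R X" using P(1) by (auto simp: support_def)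
  then show False using supp a P(3) by (auto simp: vanishing_set_def)
qed

text \<open>The Artinian property of \<open>V\<close>, phrased with submodules of the ambient
  module: the record \<open>X\<close> stays fixed while \<open>V\<close> shrinks to kernels and the
  ring of scalars changes.\<close>

definition descending_chain_condition ::
    "('a, 'c) ring_scheme \<Rightarrow> ('a, 'b, 'd) module_scheme \<Rightarrow> 'b set \<Rightarrow> bool"
  where "descending_chain_condition R X V \<longleftrightarrow>
    (\<forall>H :: nat \<Rightarrow> 'b set. (\<forall>n. submodule (H n) R X \<and> H n \<subseteq> V \<and> H (Suc n) \<subseteq> H n) \<longrightarrow>
       (\<exists>n. \<forall>m\<ge>n. H m = H n))"

lemma descending_chain_conditionD:
  assumes "descending_chain_condition R X V"
    and "\<And>n. submodule (H n) R X" "\<And>n. H n \<subseteq> V" "\<And>n. H (Suc n) \<subseteq> H n"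
  obtains n :: nat where "\<And>m. n \<le> m \<Longrightarrow> H m = H n"
  using assms unfolding descending_chain_condition_def by blast

text \<open>Let the diagonal stop at \<open>k\<close>. Every \<open>K m n\<close> with
  \<open>m\<close> and \<open>n\<close> at least \<open>k\<close> lies between two equal diagonal
  terms. Only the finitely many \<open>n < k\<close> remain, and each of these chains stops by
  itself.\<close>

lemma double_chain_stable:
  fixes K :: "nat \<Rightarrow> nat \<Rightarrow> 'b set"
  assumes m: "\<And>m n. K (Suc m) n \<subseteq> K m n" and n: "\<And>m n. K m (Suc n) \<subseteq> K m n"
    and rows: "\<And>n. \<exists>k. \<forall>m\<ge>k. K m n = K k n" and diag: "\<exists>k. \<forall>m\<ge>k. K m m = K k k"
  shows "\<exists>M. \<forall>m\<ge>M. \<forall>n. K m n = K M n"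
proof -
  have m': "K m' n \<subseteq> K m n" if "m \<le> m'" for m m' n
    by (rule lift_Suc_antimono_le[of "\<lambda>m. K m n", OF m that])
  have n': "K m n' \<subseteq> K m n" if "n \<le> n'" for m n n'
    by (rule lift_Suc_antimono_le[of "K m", OF n that])
  obtain k where k: "\<And>m. k \<le> m \<Longrightarrow> K m m = K k k" using diag by blast
  obtain r where r: "\<And>n m. r n \<le> m \<Longrightarrow> K m n = K (r n) n" using rows by metis
  define M where "M = Max (insert k (r ` {..<k}))"
  have Mk: "k \<le> M" and Mr: "\<And>n. n < k \<Longrightarrow> r n \<le> M" by (auto simp: M_def)
  have big: "K m n = K k k" if "k \<le> m" "k \<le> n" for m n
    using m'[of m "max m n" n] n'[of n "max m n" "max m n"] m'[of k m n] n'[of k n k] k[of "max m n"] that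
    by force
  have "K m n = K M n" if "M \<le> m" for m n
  proof (cases "n < k")
    case True
    then show ?thesis using r[of n m] r[of n M] Mr[OF True] that by simp
  next
    case False
    then show ?thesis using big[of m n] big[of M n] that Mk by simp
  qed
  then show ?thesis by blast
qed

text \<open>A descending chain \<open>H\<close> is recovered from the double chain of the submodules \<open>a\<^sup>n H m\<close>, intersected
  with the kernel of \<open>a\<close>, by induction on the power of \<open>a\<close> killing an element.\<close>

lemma descending_chain_condition_torsion:
  fixes R :: "('a, 'c) ring_scheme" and X :: "('a, 'b, 'd) module_scheme"
  assumes X: "module R X" and W: "submodule W R X" and a: "a \<in> carrier R"
    and tors: "\<And>x. x \<in> W \<Longrightarrow> \<exists>n::nat. (a [^]\<^bsub>R\<^esub> n) \<odot>\<^bsub>X\<^esub> x = \<zero>\<^bsub>X\<^esub>"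
    and dcc: "descending_chain_condition R X {x \<in> W. a \<odot>\<^bsub>X\<^esub> x = \<zero>\<^bsub>X\<^esub>}"
  shows "descending_chain_condition R X W"
  unfolding descending_chain_condition_def
proof (intro allI impI)
  interpret X: module R X by fact
  fix H :: "nat \<Rightarrow> 'b set"
  assume "\<forall>n. submodule (H n) R X \<and> H n \<subseteq> W \<and> H (Suc n) \<subseteq> H n"
  then have H: "\<And>n. submodule (H n) R X" and HW: "\<And>n. H n \<subseteq> W" and HS: "\<And>n. H (Suc n) \<subseteq> H n" by auto
  have HX: "x \<in> carrier X" if "x \<in> H n" for x n using submodule_subset[OF H] that by blast
  have pow: "a [^]\<^bsub>R\<^esub> (n::nat) \<in> carrier R" for n using a by simp
  define K where "K m n = (\<lambda>x. (a [^]\<^bsub>R\<^esub> n) \<odot>\<^bsub>X\<^esub> x) ` H m \<inter> {x \<in> W. a \<odot>\<^bsub>X\<^esub> x = \<zero>\<^bsub>X\<^esub>}" for m and n :: nat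
  have aS: "(a [^]\<^bsub>R\<^esub> Suc n) \<odot>\<^bsub>X\<^esub> x = (a [^]\<^bsub>R\<^esub> n) \<odot>\<^bsub>X\<^esub> (a \<odot>\<^bsub>X\<^esub> x)"
    "(a [^]\<^bsub>R\<^esub> Suc n) \<odot>\<^bsub>X\<^esub> x = a \<odot>\<^bsub>X\<^esub> ((a [^]\<^bsub>R\<^esub> n) \<odot>\<^bsub>X\<^esub> x)" if "x \<in> carrier X" for x and n :: nat
    using a that pow[of n] by (simp_all add: X.R.nat_pow_Suc2 flip: X.smult_assoc1) (simp add: X.R.m_comm)
  have Ksub: "submodule (K m n) R X" for m n
  proof -
    have "submodule {x \<in> W. \<forall>b\<in>{a}. b \<odot>\<^bsub>X\<^esub> x = \<zero>\<^bsub>X\<^esub>} R X"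
      by (rule annihilated_submodule[OF X W]) (use a in auto)
    then have 1: "submodule {x \<in> W. a \<odot>\<^bsub>X\<^esub> x = \<zero>\<^bsub>X\<^esub>} R X" by simp
    have 2: "submodule ((\<lambda>x. (a [^]\<^bsub>R\<^esub> n) \<odot>\<^bsub>X\<^esub> x) ` H m) R X"
      by (rule submodule_image[OF X X homothety_linear[OF X pow] H])
    show ?thesis using submodule_Inter[OF X, of "{_, _}"] 1 2 unfolding K_def
      by (metis (no_types, lifting) Inf_insert Inf_empty inf_top_right insert_iff insert_not_empty empty_iff)
  qed
  have KS: "K m (Suc n) \<subseteq> K m n" for m n
  proof -
    have "(\<lambda>x. (a [^]\<^bsub>R\<^esub> Suc n) \<odot>\<^bsub>X\<^esub> x) ` H m \<subseteq> (\<lambda>x. (a [^]\<^bsub>R\<^esub> n) \<odot>\<^bsub>X\<^esub> x) ` H m"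
    proof
      fix y assume "y \<in> (\<lambda>x. (a [^]\<^bsub>R\<^esub> Suc n) \<odot>\<^bsub>X\<^esub> x) ` H m"
      then obtain x where x: "x \<in> H m" "y = (a [^]\<^bsub>R\<^esub> Suc n) \<odot>\<^bsub>X\<^esub> x" by blast
      then have "y = (a [^]\<^bsub>R\<^esub> n) \<odot>\<^bsub>X\<^esub> (a \<odot>\<^bsub>X\<^esub> x)" using aS(1)[OF HX] by simp
      then show "y \<in> (\<lambda>x. (a [^]\<^bsub>R\<^esub> n) \<odot>\<^bsub>X\<^esub> x) ` H m"
        using submodule.smult_closed[OF H a x(1)] by blast
    qed
    then show ?thesis unfolding K_def by blast
  qed
  have SK: "K (Suc m) n \<subseteq> K m n" for m n using HS[of m] unfolding K_def by blast
  have KW: "K m n \<subseteq> {x \<in> W. a \<odot>\<^bsub>X\<^esub> x = \<zero>\<^bsub>X\<^esub>}" for m n unfolding K_def by blast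
  \<comment> \<open>One stage \<open>M\<close> must serve all exponents \<open>n\<close> at once,
    because the elements of \<open>W\<close> need not have a common exponent.\<close>
  have "\<exists>M. \<forall>m\<ge>M. \<forall>n. K m n = K M n"
  proof (rule double_chain_stable)
    show "\<exists>k. \<forall>m\<ge>k. K m n = K k n" for n
      by (rule descending_chain_conditionD[OF dcc, of "\<lambda>m. K m n"]) (use Ksub KW SK in blast)+
    show "\<exists>k. \<forall>m\<ge>k. K m m = K k k"
      by (rule descending_chain_conditionD[OF dcc, of "\<lambda>m. K m m"]) (use Ksub KW SK KS in blast)+
  qed (use SK KS in auto)
  then obtain M where M: "\<And>m n. M \<le> m \<Longrightarrow> K m n = K M n" by blast
  have "y \<in> H m" if mM: "M \<le> m" and "y \<in> H M" "(a [^]\<^bsub>R\<^esub> n) \<odot>\<^bsub>X\<^esub> y = \<zero>\<^bsub>X\<^esub>" for m y and n :: nat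
    using that(2,3)
  proof (induction n arbitrary: y)
    case 0
    then show ?case using HX[OF 0(1)] submodule_zero[OF H] by simp
  next
    case (Suc n)
    note yX = HX[OF Suc.prems(1)]
    \<comment> \<open>This element is killed by \<open>a\<close>, hence lies in
      \<open>K M n = K m n\<close>. Subtracting from \<open>y\<close> an \<open>x\<close> in
      \<open>H m\<close> with the same image lowers the exponent.\<close>
    have "(a [^]\<^bsub>R\<^esub> n) \<odot>\<^bsub>X\<^esub> y \<in> K M n"
      using Suc.prems aS(2)[OF yX, of n] submodule.smult_closed[OF H pow Suc.prems(1)] HW[of M]
      unfolding K_def by auto
    then obtain x where x: "x \<in> H m" "(a [^]\<^bsub>R\<^esub> n) \<odot>\<^bsub>X\<^esub> y = (a [^]\<^bsub>R\<^esub> n) \<odot>\<^bsub>X\<^esub> x"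
      using M[OF mM, of n] unfolding K_def by blast
    have xM: "x \<in> H M" using lift_Suc_antimono_le[of H, OF HS mM] x(1) by blast
    have "(a [^]\<^bsub>R\<^esub> n) \<odot>\<^bsub>X\<^esub> (y \<ominus>\<^bsub>X\<^esub> x) = \<zero>\<^bsub>X\<^esub>"
      using HX[OF xM] yX pow[of n] x(2)
      by (simp add: a_minus_def X.smult_r_distr X.smult_r_minus X.M.r_neg)
    then have "y \<ominus>\<^bsub>X\<^esub> x \<in> H m"
      using submodule_minus[OF X H Suc.prems(1) xM] by (rule Suc.IH[rotated])
    from submodule_add[OF H this x(1)] show ?case
      using yX HX[OF xM] by (simp add: a_minus_def X.M.a_assoc X.M.l_neg)
  qed
  then have "H M \<subseteq> H m" if "M \<le> m" for m using that tors HW[of M] by blast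
  then have "\<forall>m\<ge>M. H m = H M" using lift_Suc_antimono_le[of H, OF HS] by blast
  then show "\<exists>n. \<forall>m\<ge>n. H m = H n" by blast
qed

text \<open>The kernel of one element is again a submodule, with the same torsion property for the
  others, so the induction hypothesis applies to it; the case of a single element then passes from
  the kernel to \<open>W\<close>.\<close>

lemma descending_chain_condition_torsion_finite:
  assumes X: "module R X" and "finite L" "L \<subseteq> carrier R" "submodule W R X"
    and "\<And>a x. \<lbrakk>a \<in> L; x \<in> W\<rbrakk> \<Longrightarrow> \<exists>n::nat. (a [^]\<^bsub>R\<^esub> n) \<odot>\<^bsub>X\<^esub> x = \<zero>\<^bsub>X\<^esub>"
    and "descending_chain_condition R X {x \<in> W. \<forall>a\<in>L. a \<odot>\<^bsub>X\<^esub> x = \<zero>\<^bsub>X\<^esub>}"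
  shows "descending_chain_condition R X W"
  using assms(2-)
proof (induction L arbitrary: W rule: finite_induct)
  case empty
  then show ?case by simp
next
  case (insert a L)
  let ?W = "{x \<in> W. a \<odot>\<^bsub>X\<^esub> x = \<zero>\<^bsub>X\<^esub>}"
  have "submodule {x \<in> W. \<forall>b\<in>{a}. b \<odot>\<^bsub>X\<^esub> x = \<zero>\<^bsub>X\<^esub>} R X"
    by (rule annihilated_submodule[OF X insert.prems(2)]) (use insert.prems(1) in auto)
  then have W: "submodule ?W R X" by simp
  have "{x \<in> ?W. \<forall>b\<in>L. b \<odot>\<^bsub>X\<^esub> x = \<zero>\<^bsub>X\<^esub>} = {x \<in> W. \<forall>b\<in>insert a L. b \<odot>\<^bsub>X\<^esub> x = \<zero>\<^bsub>X\<^esub>}" by auto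
  then have "descending_chain_condition R X ?W"
    by (intro insert.IH[OF _ W]) (use insert.prems in auto)
  then show ?case
    by (intro descending_chain_condition_torsion[OF X insert.prems(2), of a]) (use insert.prems in auto)
qed

section \<open>Finitely generated modules\<close>

text \<open>Unlike the intersection \<open>submodule_span\<close>, this splits off one generator at
  a time, as inductions on the number of generators require.\<close>

primrec list_span :: "('a, 'c) ring_scheme \<Rightarrow> ('a, 'b, 'd) module_scheme \<Rightarrow> 'b list \<Rightarrow> 'b set"
  where
    "list_span R X [] = {\<zero>\<^bsub>X\<^esub>}"
  | "list_span R X (c # cs) = {r \<odot>\<^bsub>X\<^esub> c \<oplus>\<^bsub>X\<^esub> y | r y. r \<in> carrier R \<and> y \<in> list_span R X cs}"

lemma list_span_submodule:
  assumes "module R X" "set cs \<subseteq> carrier X"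
  shows "submodule (list_span R X cs) R X"
  using assms(2)
proof (induction cs)
  case Nil
  then show ?case by (simp add: submodule_singleton_zero[OF assms(1)])
next
  case (Cons c cs)
  interpret X: module R X by fact
  have sub: "submodule (list_span R X cs) R X" and c: "c \<in> carrier X" using Cons by auto
  note cl = subsetD[OF submodule_subset[OF sub]]
  show ?case
  proof (rule module_submoduleI[OF assms(1)])
    show "list_span R X (c # cs) \<subseteq> carrier X" using c cl by auto
    have "\<zero>\<^bsub>X\<^esub> = \<zero>\<^bsub>R\<^esub> \<odot>\<^bsub>X\<^esub> c \<oplus>\<^bsub>X\<^esub> \<zero>\<^bsub>X\<^esub>" using c by simp
    then show "\<zero>\<^bsub>X\<^esub> \<in> list_span R X (c # cs)" using submodule_zero[OF sub] by auto
    fix x y assume "x \<in> list_span R X (c # cs)" "y \<in> list_span R X (c # cs)"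
    then obtain r s u v where *: "r \<in> carrier R" "s \<in> carrier R" "u \<in> list_span R X cs" "v \<in> list_span R X cs"
      "x = r \<odot>\<^bsub>X\<^esub> c \<oplus>\<^bsub>X\<^esub> u" "y = s \<odot>\<^bsub>X\<^esub> c \<oplus>\<^bsub>X\<^esub> v" by auto
    then have "x \<oplus>\<^bsub>X\<^esub> y = (r \<oplus>\<^bsub>R\<^esub> s) \<odot>\<^bsub>X\<^esub> c \<oplus>\<^bsub>X\<^esub> (u \<oplus>\<^bsub>X\<^esub> v)"
      using c cl by (simp add: X.smult_l_distr X.M.a_ac)
    then show "x \<oplus>\<^bsub>X\<^esub> y \<in> list_span R X (c # cs)"
      using * submodule_add[OF sub *(3,4)] by auto
  next
    fix a x assume a: "a \<in> carrier R" and "x \<in> list_span R X (c # cs)"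
    then obtain r u where *: "r \<in> carrier R" "u \<in> list_span R X cs" "x = r \<odot>\<^bsub>X\<^esub> c \<oplus>\<^bsub>X\<^esub> u" by auto
    then have "a \<odot>\<^bsub>X\<^esub> x = (a \<otimes>\<^bsub>R\<^esub> r) \<odot>\<^bsub>X\<^esub> c \<oplus>\<^bsub>X\<^esub> a \<odot>\<^bsub>X\<^esub> u"
      using a c cl by (simp add: X.smult_r_distr X.smult_assoc1)
    then show "a \<odot>\<^bsub>X\<^esub> x \<in> list_span R X (c # cs)"
      using * a submodule.smult_closed[OF sub a *(2)] by auto
  qed
qed

lemma list_span_subset_Cons:
  assumes "module R X" "c \<in> carrier X" "set cs \<subseteq> carrier X"
  shows "list_span R X cs \<subseteq> list_span R X (c # cs)"
proof
  interpret X: module R X by fact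
  fix x assume x: "x \<in> list_span R X cs"
  then have "x \<in> carrier X" using submodule_subset[OF list_span_submodule[OF assms(1,3)]] by auto
  then have "x = \<zero>\<^bsub>R\<^esub> \<odot>\<^bsub>X\<^esub> c \<oplus>\<^bsub>X\<^esub> x" using assms(2) by simp
  then show "x \<in> list_span R X (c # cs)" using x by auto
qed

lemma set_subset_list_span:
  assumes "module R X" "set cs \<subseteq> carrier X"
  shows "set cs \<subseteq> list_span R X cs"
  using assms(2)
proof (induction cs)
  case (Cons c cs)
  interpret X: module R X by fact
  have "c = \<one>\<^bsub>R\<^esub> \<odot>\<^bsub>X\<^esub> c \<oplus>\<^bsub>X\<^esub> \<zero>\<^bsub>X\<^esub>" using Cons.prems by simp
  moreover have "\<zero>\<^bsub>X\<^esub> \<in> list_span R X cs"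
    using Cons.prems by (intro submodule_zero[OF list_span_submodule[OF assms(1)]]) simp
  ultimately have "c \<in> list_span R X (c # cs)" by auto
  then show ?case using Cons list_span_subset_Cons[OF assms(1), of c cs] by auto
qed simp

lemma list_span_minimal:
  assumes "submodule H R X" "set cs \<subseteq> H"
  shows "list_span R X cs \<subseteq> H"
  using assms(2)
  by (induction cs) (auto intro: submodule_zero[OF assms(1)] submodule_add[OF assms(1)]
      submodule.smult_closed[OF assms(1)])

text \<open>For a submodule \<open>Y\<close> these are the \<open>r\<close> for which r c lies in
  the sum of \<open>H\<close> and \<open>Y\<close>. They play the role of the ideals of leading
  coefficients in Hilbert's basis theorem.\<close>

definition leading_coeffs ::
    "('a, 'c) ring_scheme \<Rightarrow> ('a, 'b, 'd) module_scheme \<Rightarrow> 'b \<Rightarrow> 'b set \<Rightarrow> 'b set \<Rightarrow> 'a set"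
  where "leading_coeffs R X c Y H = {r \<in> carrier R. \<exists>y\<in>Y. r \<odot>\<^bsub>X\<^esub> c \<oplus>\<^bsub>X\<^esub> y \<in> H}"

lemma leading_coeffs_ideal:
  assumes X: "module R X" and c: "c \<in> carrier X" and Y: "submodule Y R X" and H: "submodule H R X"
  shows "ideal (leading_coeffs R X c Y H) R"
proof -
  interpret X: module R X by fact
  note Yc = subsetD[OF submodule_subset[OF Y]]
  show ?thesis
  proof (rule submodule_self_imp_ideal[OF X.R.cring_axioms
        module_submoduleI[OF self_module_module[OF X.R.cring_axioms]]])
    have "\<zero>\<^bsub>R\<^esub> \<odot>\<^bsub>X\<^esub> c \<oplus>\<^bsub>X\<^esub> \<zero>\<^bsub>X\<^esub> \<in> H" using c submodule_zero[OF H] by simp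
    then show "\<zero>\<^bsub>self_module R\<^esub> \<in> leading_coeffs R X c Y H"
      using submodule_zero[OF Y] by (auto simp: leading_coeffs_def self_module_simps)
  next
    fix r s assume "r \<in> leading_coeffs R X c Y H" "s \<in> leading_coeffs R X c Y H"
    then obtain y z where *: "r \<in> carrier R" "s \<in> carrier R" "y \<in> Y" "z \<in> Y"
      "r \<odot>\<^bsub>X\<^esub> c \<oplus>\<^bsub>X\<^esub> y \<in> H" "s \<odot>\<^bsub>X\<^esub> c \<oplus>\<^bsub>X\<^esub> z \<in> H" by (auto simp: leading_coeffs_def)
    have "(r \<oplus>\<^bsub>R\<^esub> s) \<odot>\<^bsub>X\<^esub> c \<oplus>\<^bsub>X\<^esub> (y \<oplus>\<^bsub>X\<^esub> z) = (r \<odot>\<^bsub>X\<^esub> c \<oplus>\<^bsub>X\<^esub> y) \<oplus>\<^bsub>X\<^esub> (s \<odot>\<^bsub>X\<^esub> c \<oplus>\<^bsub>X\<^esub> z)"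
      using * c Yc by (simp add: X.smult_l_distr X.M.a_ac)
    then show "r \<oplus>\<^bsub>self_module R\<^esub> s \<in> leading_coeffs R X c Y H"
      using * submodule_add[OF H *(5,6)] submodule_add[OF Y *(3,4)]
      by (auto simp: leading_coeffs_def self_module_simps intro!: bexI[of _ "y \<oplus>\<^bsub>X\<^esub> z"])
  next
    fix a r assume a: "a \<in> carrier R" and "r \<in> leading_coeffs R X c Y H"
    then obtain y where *: "r \<in> carrier R" "y \<in> Y" "r \<odot>\<^bsub>X\<^esub> c \<oplus>\<^bsub>X\<^esub> y \<in> H"
      by (auto simp: leading_coeffs_def)
    have "(a \<otimes>\<^bsub>R\<^esub> r) \<odot>\<^bsub>X\<^esub> c \<oplus>\<^bsub>X\<^esub> a \<odot>\<^bsub>X\<^esub> y = a \<odot>\<^bsub>X\<^esub> (r \<odot>\<^bsub>X\<^esub> c \<oplus>\<^bsub>X\<^esub> y)"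
      using * a c Yc by (simp add: X.smult_r_distr X.smult_assoc1)
    then show "a \<odot>\<^bsub>self_module R\<^esub> r \<in> leading_coeffs R X c Y H"
      using * a submodule.smult_closed[OF H a *(3)] submodule.smult_closed[OF Y a *(2)]
      by (auto simp: leading_coeffs_def self_module_simps intro!: bexI[of _ "a \<odot>\<^bsub>X\<^esub> y"])
  qed (auto simp: leading_coeffs_def self_module_simps)
qed

text \<open>An element of \<open>H\<close> has the form r c + y, and \<open>E\<close> contains some
  r c + z with the same r. The difference y - z lies in \<open>H\<close> and in the span of
  \<open>cs\<close>, hence in \<open>E\<close>.\<close>

lemma leading_coeffs_subset_imp_subset:
  assumes X: "module R X" and c: "c \<in> carrier X" and cs: "set cs \<subseteq> carrier X"
    and H: "submodule H R X" "H \<subseteq> list_span R X (c # cs)" and E: "submodule E R X" "E \<subseteq> H"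
    and J: "leading_coeffs R X c (list_span R X cs) H \<subseteq> leading_coeffs R X c (list_span R X cs) E"
    and Y: "H \<inter> list_span R X cs \<subseteq> E"
  shows "H \<subseteq> E"
proof
  interpret X: module R X by fact
  note sp = list_span_submodule[OF X cs]
  note spc = subsetD[OF submodule_subset[OF sp]]
  fix x assume x: "x \<in> H"
  then obtain r y where r: "r \<in> carrier R" "y \<in> list_span R X cs" "x = r \<odot>\<^bsub>X\<^esub> c \<oplus>\<^bsub>X\<^esub> y"
    using H(2) by auto
  then have "r \<in> leading_coeffs R X c (list_span R X cs) H" using x by (auto simp: leading_coeffs_def)
  then obtain z where z: "z \<in> list_span R X cs" "r \<odot>\<^bsub>X\<^esub> c \<oplus>\<^bsub>X\<^esub> z \<in> E"
    using J by (auto simp: leading_coeffs_def)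
  have yz: "y \<ominus>\<^bsub>X\<^esub> z \<in> list_span R X cs" by (rule submodule_minus[OF X sp r(2) z(1)])
  have "x = (r \<odot>\<^bsub>X\<^esub> c \<oplus>\<^bsub>X\<^esub> z) \<oplus>\<^bsub>X\<^esub> (y \<ominus>\<^bsub>X\<^esub> z)"
    using r c z(1) spc by (simp add: a_minus_def X.M.a_ac X.M.r_neg X.M.r_neg1 X.M.r_neg2)
  moreover have "x \<ominus>\<^bsub>X\<^esub> (r \<odot>\<^bsub>X\<^esub> c \<oplus>\<^bsub>X\<^esub> z) \<in> H"
    using x z(2) E(2) by (intro submodule_minus[OF X H(1)]) auto
  moreover have "x \<ominus>\<^bsub>X\<^esub> (r \<odot>\<^bsub>X\<^esub> c \<oplus>\<^bsub>X\<^esub> z) = y \<ominus>\<^bsub>X\<^esub> z"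
    using r c z(1) spc by (simp add: a_minus_def X.M.minus_add X.M.a_ac X.M.r_neg X.M.r_neg1 X.M.r_neg2)
  ultimately show "x \<in> E"
    using submodule_add[OF E(1) z(2), of "y \<ominus>\<^bsub>X\<^esub> z"] Y yz by auto
qed

text \<open>Two kinds of generators suffice: lifts to \<open>H\<close> of finitely many generators
  of the ideal of leading coefficients, and generators of the intersection with the shorter span,
  given by induction.\<close>

lemma noetherian_submodule_list_span:
  assumes "noetherian_ring R" and X: "module R X"
    and "set cs \<subseteq> carrier X" "submodule H R X" "H \<subseteq> list_span R X cs"
  shows "\<exists>ds. set ds \<subseteq> carrier X \<and> H = list_span R X ds"
  using assms(3-)
proof (induction cs arbitrary: H)
  case Nil
  then have "H = {\<zero>\<^bsub>X\<^esub>}" using submodule_zero[of H] by auto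
  then show ?case by (intro exI[of _ "[]"]) simp
next
  case (Cons c cs)
  interpret X: module R X by fact
  note H = Cons.prems(2)
  have c: "c \<in> carrier X" and cs: "set cs \<subseteq> carrier X" using Cons.prems(1) by auto
  let ?Y = "list_span R X cs"
  note sp = list_span_submodule[OF X cs]
  have inter: "submodule (H \<inter> ?Y) R X"
    using submodule_Inter[OF X, of "{H, ?Y}"] H sp by auto
  then obtain ds where ds: "set ds \<subseteq> carrier X" "H \<inter> ?Y = list_span R X ds"
    using Cons.IH[OF cs inter] by auto
  note J = leading_coeffs_ideal[OF X c sp]
  obtain S where S: "S \<subseteq> carrier R" "finite S" "leading_coeffs R X c ?Y H = Idl\<^bsub>R\<^esub> S"
    using noetherian_ring.finetely_gen[OF assms(1) J[OF H]] by blast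
  have "\<forall>r\<in>S. \<exists>y\<in>?Y. r \<odot>\<^bsub>X\<^esub> c \<oplus>\<^bsub>X\<^esub> y \<in> H"
    using S(3) X.R.genideal_self[OF S(1)] by (auto simp: leading_coeffs_def)
  then obtain y where y: "\<And>r. r \<in> S \<Longrightarrow> y r \<in> ?Y" "\<And>r. r \<in> S \<Longrightarrow> r \<odot>\<^bsub>X\<^esub> c \<oplus>\<^bsub>X\<^esub> y r \<in> H" by metis
  obtain rs where rs: "set rs = S" using finite_list[OF S(2)] by blast
  define es where "es = map (\<lambda>r. r \<odot>\<^bsub>X\<^esub> c \<oplus>\<^bsub>X\<^esub> y r) rs @ ds"
  have dsH: "set ds \<subseteq> H" using set_subset_list_span[OF X ds(1)] ds(2) by auto
  have esH: "set es \<subseteq> H" using y(2) dsH rs by (auto simp: es_def)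
  then have esX: "set es \<subseteq> carrier X" using submodule_subset[OF H] by auto
  note E = list_span_submodule[OF X esX]
  have in_E: "set es \<subseteq> list_span R X es" by (rule set_subset_list_span[OF X esX])
  have EH: "list_span R X es \<subseteq> H" by (rule list_span_minimal[OF H esH])
  have "H \<subseteq> list_span R X es"
  proof (rule leading_coeffs_subset_imp_subset[OF X c cs H Cons.prems(3) E EH])
    have "S \<subseteq> leading_coeffs R X c ?Y (list_span R X es)"
      using in_E rs S(1) y(1) by (force simp: leading_coeffs_def es_def)
    then show "leading_coeffs R X c ?Y H \<subseteq> leading_coeffs R X c ?Y (list_span R X es)"
      unfolding S(3) by (rule X.R.genideal_minimal[OF J[OF E]])
    show "H \<inter> ?Y \<subseteq> list_span R X es"
      unfolding ds(2) by (rule list_span_minimal[OF E]) (use in_E in \<open>auto simp: es_def\<close>)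
  qed
  then show ?case using EH esX by blast
qed

text \<open>This is the Artinian property of a finite-dimensional vector space over R/m, read off
  inside \<open>X\<close>: the leading coefficients of a submodule form an ideal containing
  \<open>m\<close>, so along a chain they can drop at most once.\<close>

lemma descending_chain_condition_maximal_annihilator:
  assumes "maximalideal m R" and X: "module R X" and "set vs \<subseteq> carrier X"
    and "\<And>a v. \<lbrakk>a \<in> m; v \<in> set vs\<rbrakk> \<Longrightarrow> a \<odot>\<^bsub>X\<^esub> v = \<zero>\<^bsub>X\<^esub>"
  shows "descending_chain_condition R X (list_span R X vs)"
  using assms(3-)
proof (induction vs)
  case Nil
  have "H n = {\<zero>\<^bsub>X\<^esub>}" if "submodule (H n) R X" "H n \<subseteq> {\<zero>\<^bsub>X\<^esub>}" for H :: "nat \<Rightarrow> _" and n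
    using submodule_zero[OF that(1)] that(2) by auto
  then show ?case unfolding descending_chain_condition_def list_span.simps by metis
next
  case (Cons v vs)
  interpret X: module R X by fact
  interpret m: maximalideal m R by fact
  have v: "v \<in> carrier X" and vs: "set vs \<subseteq> carrier X" using Cons.prems(1) by auto
  let ?Y = "list_span R X vs"
  note sp = list_span_submodule[OF X vs]
  have dcc: "descending_chain_condition R X ?Y" using Cons by auto
  show ?case
    unfolding descending_chain_condition_def
  proof (intro allI impI)
    fix H assume "\<forall>n::nat. submodule (H n) R X \<and> H n \<subseteq> list_span R X (v # vs) \<and> H (Suc n) \<subseteq> H n"
    then have H: "\<And>n. submodule (H n) R X" and HV: "\<And>n. H n \<subseteq> list_span R X (v # vs)"
      and HS: "\<And>n. H (Suc n) \<subseteq> H n" by auto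
    have anti: "H n' \<subseteq> H n" if "n \<le> n'" for n n'
      by (rule lift_Suc_antimono_le[of H, OF HS that])
    have inter: "submodule (H n \<inter> ?Y) R X" for n
      using submodule_Inter[OF X, of "{H n, ?Y}"] H sp by auto
    obtain n1 where n1: "\<And>n. n1 \<le> n \<Longrightarrow> H n \<inter> ?Y = H n1 \<inter> ?Y"
      by (rule descending_chain_conditionD[OF dcc, of "\<lambda>n. H n \<inter> ?Y"]) (use inter HS in auto)
    let ?J = "\<lambda>n. leading_coeffs R X v ?Y (H n)"
    have "m \<subseteq> ?J n" for n
    proof
      fix a assume a: "a \<in> m"
      then have "a \<odot>\<^bsub>X\<^esub> v \<oplus>\<^bsub>X\<^esub> \<zero>\<^bsub>X\<^esub> = \<zero>\<^bsub>X\<^esub>" using Cons.prems(2) by simp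
      then show "a \<in> ?J n"
        using a submodule_zero[OF H] submodule_zero[OF sp] by (auto simp: leading_coeffs_def intro!: bexI[of _ "\<zero>\<^bsub>X\<^esub>"])
    qed
    then have two: "?J n = m \<or> ?J n = carrier R" for n
      using m.I_maximal[OF leading_coeffs_ideal[OF X v sp H]] by (auto simp: leading_coeffs_def)
    have J_anti: "?J n' \<subseteq> ?J n" if "n \<le> n'" for n n'
      using anti[OF that] by (auto simp: leading_coeffs_def)
    \<comment> \<open>The ideals take only the values \<open>m\<close> and \<open>carrier R\<close>.
      If \<open>m\<close> occurs, it is contained in all of them; otherwise they are
      constant.\<close>
    have "\<exists>n2. \<forall>n\<ge>n2. ?J n2 \<subseteq> ?J n"
    proof (cases "\<exists>n2. ?J n2 = m")
      case True
      then show ?thesis using two m.Icarr by blast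
    next
      case False
      then show ?thesis using two by blast
    qed
    then obtain n2 where n2: "\<And>n. n2 \<le> n \<Longrightarrow> ?J n2 \<subseteq> ?J n" by blast
    define N where "N = max n1 n2"
    have "H N \<subseteq> H n" if "N \<le> n" for n
    proof (rule leading_coeffs_subset_imp_subset[OF X v vs H HV H anti[OF that]])
      show "?J N \<subseteq> ?J n" using J_anti[of n2 N] n2[of n] that by (auto simp: N_def)
      show "H N \<inter> ?Y \<subseteq> H n" using n1[of N] n1[of n] that by (auto simp: N_def)
    qed
    then show "\<exists>n. \<forall>k\<ge>n. H k = H n" using anti by blast
  qed
qed

section \<open>The zeroth Ext\<close>

lemma submodule_span_minimal: "\<lbrakk>submodule H R X; S \<subseteq> H\<rbrakk> \<Longrightarrow> submodule_span R X S \<subseteq> H"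
  by (auto simp: submodule_span_def)

lemma quotient_lift:
  assumes M: "module R M" "submodule N R M" and X: "module R X"
    and u: "linear_map R M X u" and u0: "\<And>x. x \<in> N \<Longrightarrow> u x = \<zero>\<^bsub>X\<^esub>"
  shows "\<exists>g. linear_map R (quotient_module M N) X g \<and> (\<forall>x\<in>carrier M. g (N +>\<^bsub>M\<^esub> x) = u x)"
proof -
  interpret X: module R X by fact
  interpret M: module R M by fact
  let ?Q = "quotient_module M N"
  define g where "g C = u (SOME x. x \<in> C)" for C
  have g: "g (N +>\<^bsub>M\<^esub> x) = u x" if x: "x \<in> carrier M" for x
  proof -
    have "(SOME y. y \<in> N +>\<^bsub>M\<^esub> x) \<in> N +>\<^bsub>M\<^esub> x"
      by (rule someI[of "\<lambda>y. y \<in> N +>\<^bsub>M\<^esub> x", OF coset_self[OF M x]])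
    then obtain n where n: "n \<in> N" "(SOME y. y \<in> N +>\<^bsub>M\<^esub> x) = n \<oplus>\<^bsub>M\<^esub> x"
      by (auto simp: a_r_coset_def')
    then have "n \<in> carrier M" using submodule_subset[OF M(2)] by auto
    then show ?thesis
      using linear_map_add[OF u _ x] n u0 linear_map_closed[OF u x] by (simp add: g_def)
  qed
  note q = quotient_map_linear[OF M]
  have "linear_map R ?Q X g"
  proof (rule linear_mapI)
    fix C assume "C \<in> carrier ?Q"
    then show "g C \<in> carrier X"
      using g linear_map_closed[OF u] by (auto simp: carrier_quotient_module)
  next
    fix C D assume "C \<in> carrier ?Q" "D \<in> carrier ?Q"
    then obtain x y where xy: "x \<in> carrier M" "y \<in> carrier M" "C = N +>\<^bsub>M\<^esub> x" "D = N +>\<^bsub>M\<^esub> y"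
      by (auto simp: carrier_quotient_module)
    then show "g (C \<oplus>\<^bsub>?Q\<^esub> D) = g C \<oplus>\<^bsub>X\<^esub> g D"
      by (simp add: g linear_map_add[OF u] flip: linear_map_add[OF q])
  next
    fix a C assume a: "a \<in> carrier R" and "C \<in> carrier ?Q"
    then obtain x where "x \<in> carrier M" "C = N +>\<^bsub>M\<^esub> x"
      by (auto simp: carrier_quotient_module)
    then show "g (a \<odot>\<^bsub>?Q\<^esub> C) = a \<odot>\<^bsub>X\<^esub> g C"
      using a by (simp add: g linear_map_smult[OF u] flip: linear_map_smult[OF q])
  qed
  then show ?thesis using g by blast
qed

text \<open>Evaluation of cocycles at the basis vector over \<open>1 + I\<close> identifies \<open>Ext\<^sup>0(R/I, X)\<close>
  with the elements of \<open>X\<close> killed by \<open>I\<close>.\<close>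

lemma fin_gen_Ext_0_imp:
  fixes R :: "('a, 'c) ring_scheme" and X :: "('a, 'x, 'e) module_scheme"
  assumes X: "module R X" and I: "ideal I R"
    and fg: "fin_gen_module R (Ext R 0 (quotient_module (self_module R) I) X)"
  shows "\<exists>cs. set cs \<subseteq> {x \<in> carrier X. \<forall>a\<in>I. a \<odot>\<^bsub>X\<^esub> x = \<zero>\<^bsub>X\<^esub>} \<and>
    {x \<in> carrier X. \<forall>a\<in>I. a \<odot>\<^bsub>X\<^esub> x = \<zero>\<^bsub>X\<^esub>} \<subseteq> list_span R X cs"
proof -
  interpret X: module R X by fact
  note R = X.R.cring_axioms
  note S = self_module_module[OF R] ideal_imp_submodule_self[OF R I]
  interpret S: module R "self_module R" by fact
  let ?Q = "quotient_module (self_module R) I"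
  let ?K = "{x \<in> carrier X. \<forall>a\<in>I. a \<odot>\<^bsub>X\<^esub> x = \<zero>\<^bsub>X\<^esub>}"
  have Q: "module R ?Q" by (rule quotient_module_module[OF S])
  interpret Q: module R ?Q by fact
  define q where "q = I +>\<^bsub>self_module R\<^esub> \<one>\<^bsub>R\<^esub>"
  have one: "\<one>\<^bsub>R\<^esub> \<in> carrier (self_module R)" by (simp add: self_module_simps)
  have q: "q \<in> carrier ?Q" using one by (auto simp: q_def carrier_quotient_module)
  have aq: "a \<odot>\<^bsub>?Q\<^esub> q = \<zero>\<^bsub>?Q\<^esub>" if a: "a \<in> I" for a
  proof -
    have aR: "a \<in> carrier R" using a cring_ideal_subset[OF I] by auto
    have "a \<odot>\<^bsub>?Q\<^esub> q = I +>\<^bsub>self_module R\<^esub> (a \<odot>\<^bsub>self_module R\<^esub> \<one>\<^bsub>R\<^esub>)"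
      unfolding q_def by (rule linear_map_smult[OF quotient_map_linear[OF S] aR one, symmetric])
    also have "\<dots> = I"
      using coset_eq_zero_iff[OF S, of a] a aR by (simp add: self_module_simps)
    finally show ?thesis by (simp add: zero_quotient_module)
  qed
  define e :: "('a, 'a set) syz \<Rightarrow> 'a" where "e = basis_vec R (Gen q)"
  let ?F = "res_module R ?Q 0"
  have F: "module R ?F" by (rule res_module_module[OF R])
  interpret F: module R ?F by fact
  have e: "e \<in> carrier ?F"
    unfolding e_def res_module_def by (rule basis_vec_closed[OF R]) (use q in simp)
  note aug = augmentation_linear[OF Q]
  have aug_e: "augmentation R ?Q e = q" unfolding e_def by (rule augmentation_basis[OF Q q])
  let ?H = "res_hom R 0 ?Q X" and ?Z = "cocycle_module R 0 ?Q X"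
  let ?B = "ext_coboundaries R 0 ?Q X"
  have B: "?B = {\<zero>\<^bsub>?H\<^esub>}" by (simp add: ext_coboundaries_def)
  have Z: "module R ?Z" by (rule cocycle_module_module[OF X])
  interpret Z: module R ?Z by fact
  have BZ: "submodule ?B R ?Z" by (rule submodule_coboundaries_cocycles[OF X])
  have lin: "linear_map R ?F X g" if "g \<in> carrier ?Z" for g
    using that by (simp add: ext_cocycles_def carrier_hom_module)
  have ge: "g e \<in> ?K" if g: "g \<in> carrier ?Z" for g
  proof -
    have "a \<odot>\<^bsub>X\<^esub> g e = \<zero>\<^bsub>X\<^esub>" if a: "a \<in> I" for a
    proof -
      have aR: "a \<in> carrier R" using a cring_ideal_subset[OF I] by auto
      \<comment> \<open>Since \<open>a\<close> kills \<open>q\<close>, the element \<open>?f\<close>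
        is a cycle, and so it is the differential of the basis vector at its own code. A cocycle
        must vanish on it.\<close>
      let ?f = "a \<odot>\<^bsub>?F\<^esub> e"
      have "?f \<in> res_kernel R ?Q 0"
        using linear_map_smult[OF aug aR e] aug_e aq[OF a] aR e by (simp add: res_kernel_def)
      then have f: "syz_code R ?f \<in> res_basis R ?Q (Suc 0)" "syz_decode R (syz_code R ?f) = ?f"
        using syz_decode_code[OF res_kernel_finite] by (auto simp: res_basis_Suc)
      have "basis_vec R (syz_code R ?f) \<in> carrier (res_module R ?Q (Suc 0))"
        using basis_vec_closed[OF R f(1)] by (simp only: res_module_def[of R ?Q "Suc 0"])
      moreover have "differential R (basis_vec R (syz_code R ?f)) = ?f"
        using differential_basis[OF R f(1)] f(2) by simp
      ultimately have "g ?f = \<zero>\<^bsub>X\<^esub>" using g by (auto simp: ext_cocycles_def)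
      then show ?thesis using linear_map_smult[OF lin[OF g] aR e] by simp
    qed
    then show ?thesis using linear_map_closed[OF lin[OF g] e] by auto
  qed
  obtain T where T: "finite T" "T \<subseteq> carrier (Ext R 0 ?Q X)"
      "submodule_span R (Ext R 0 ?Q X) T = carrier (Ext R 0 ?Q X)"
    using fg by (auto simp: fin_gen_module_def)
  have "\<forall>C\<in>T. \<exists>g\<in>carrier ?Z. C = ?B +>\<^bsub>?Z\<^esub> g"
    using T(2) by (auto simp: Ext_def carrier_quotient_module)
  then obtain \<gamma> where \<gamma>: "\<And>C. C \<in> T \<Longrightarrow> \<gamma> C \<in> carrier ?Z" "\<And>C. C \<in> T \<Longrightarrow> C = ?B +>\<^bsub>?Z\<^esub> \<gamma> C" by metis
  obtain ts where ts: "set ts = T" using finite_list[OF T(1)] by blast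
  define cs where "cs = map (\<lambda>C. \<gamma> C e) ts"
  have cs: "set cs \<subseteq> ?K" using ge \<gamma>(1) ts by (auto simp: cs_def)
  then have csX: "set cs \<subseteq> carrier X" by auto
  note D = list_span_submodule[OF X csX]
  have ev: "linear_map R ?Z X (\<lambda>g. g e)"
    by (rule linear_mapI)
      (use e in \<open>auto simp: linear_map_closed[OF lin] hom_module_def\<close>)
  \<comment> \<open>The classes of \<open>G\<close> form a submodule of \<open>Ext\<close>
    containing the generators \<open>T\<close>, hence everything. In this way finite generation
    passes from classes to the values at \<open>e\<close>.\<close>
  define G where "G = {g \<in> carrier ?Z. g e \<in> list_span R X cs}"
  have G: "submodule G R ?Z" unfolding G_def by (rule submodule_vimage[OF Z X ev D])
  have "submodule ((\<lambda>g. ?B +>\<^bsub>?Z\<^esub> g) ` G) R (Ext R 0 ?Q X)"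
    unfolding Ext_def
    by (rule submodule_image[OF Z quotient_module_module[OF Z BZ] quotient_map_linear[OF Z BZ] G])
  moreover have "T \<subseteq> (\<lambda>g. ?B +>\<^bsub>?Z\<^esub> g) ` G"
  proof
    fix C assume C: "C \<in> T"
    then have "\<gamma> C \<in> G"
      using \<gamma>(1) set_subset_list_span[OF X csX] ts by (auto simp: G_def cs_def)
    then show "C \<in> (\<lambda>g. ?B +>\<^bsub>?Z\<^esub> g) ` G" using \<gamma>(2)[OF C] by blast
  qed
  ultimately have all: "carrier (Ext R 0 ?Q X) \<subseteq> (\<lambda>g. ?B +>\<^bsub>?Z\<^esub> g) ` G"
    using submodule_span_minimal T(3) by metis
  have "?K \<subseteq> list_span R X cs"
  proof
    fix x assume x: "x \<in> ?K"
    then have xX: "x \<in> carrier X" by simp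
    \<comment> \<open>As \<open>I\<close> kills \<open>x\<close>, the map taking \<open>r\<close> to
      its multiple of \<open>x\<close> factors through R/I; composed with the augmentation it
      becomes a cocycle with value \<open>x\<close> at \<open>e\<close>.\<close>
    obtain h where h: "linear_map R ?Q X h" "\<And>r. r \<in> carrier R \<Longrightarrow> h (I +>\<^bsub>self_module R\<^esub> r) = r \<odot>\<^bsub>X\<^esub> x"
      using quotient_lift[OF S X smult_map_linear[OF X xX]] x by (auto simp: self_module_simps)
    define g where "g = (\<lambda>f\<in>carrier ?F. h (augmentation R ?Q f))"
    have hl: "linear_map R ?F X (\<lambda>f. h (augmentation R ?Q f))" by (rule linear_map_comp[OF aug h(1)])
    have "linear_map R ?F X g"
      by (rule linear_mapI)
        (auto simp: g_def linear_map_closed[OF hl] linear_map_add[OF hl] linear_map_smult[OF hl])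
    moreover have "g (differential R f) = \<zero>\<^bsub>X\<^esub>" if "f \<in> carrier (res_module R ?Q (Suc 0))" for f
      using linear_map_closed[OF differential_linear[OF R] that] augmentation_differential[OF Q that]
        linear_map_zero[OF Q X h(1)] by (simp add: g_def)
    ultimately have g: "g \<in> carrier ?Z" by (simp add: ext_cocycles_def carrier_hom_module g_def)
    then have "?B +>\<^bsub>?Z\<^esub> g \<in> carrier (Ext R 0 ?Q X)" by (auto simp: Ext_def carrier_quotient_module)
    then obtain g' where g': "g' \<in> G" "?B +>\<^bsub>?Z\<^esub> g = ?B +>\<^bsub>?Z\<^esub> g'" using all by blast
    have g'Z: "g' \<in> carrier ?Z" using g'(1) by (simp add: G_def)
    \<comment> \<open>In degree 0 the only coboundary is zero, so cocycles with the same class are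
      equal.\<close>
    obtain n where "n \<in> ?B" "g = n \<oplus>\<^bsub>?Z\<^esub> g'"
      using coset_eq_iff[OF Z BZ g g'Z] g'(2) by blast
    then have "g = \<zero>\<^bsub>?Z\<^esub> \<oplus>\<^bsub>?Z\<^esub> g'" by (simp add: B)
    then have "g = g'" using Z.M.l_zero[OF g'Z] by simp
    moreover have "g e = x"
      using e aug_e h(2)[of "\<one>\<^bsub>R\<^esub>"] xX by (simp add: g_def q_def)
    ultimately show "x \<in> list_span R X cs" using g'(1) by (simp add: G_def)
  qed
  then show ?thesis using cs by blast
qed

section \<open>Torsion with respect to an ideal\<close>

lemma torsion_submodule:
  assumes X: "module R X" and I: "ideal I R"
  shows "submodule (torsion R I X) R X"
proof -
  interpret X: module R X by fact
  note R = X.R.cring_axioms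
  have sub: "ideal_power R I n \<subseteq> carrier R" for n
    by (rule cring_ideal_subset[OF ideal_power_ideal[OF R I]])
  show ?thesis
  proof (rule module_submoduleI[OF X])
    show "\<zero>\<^bsub>X\<^esub> \<in> torsion R I X" using subsetD[OF sub] by (auto simp: torsion_def intro!: exI[of _ 1])
    fix x y assume "x \<in> torsion R I X" "y \<in> torsion R I X"
    then obtain n m where x: "x \<in> carrier X" "n \<ge> 1" "\<And>a. a \<in> ideal_power R I n \<Longrightarrow> a \<odot>\<^bsub>X\<^esub> x = \<zero>\<^bsub>X\<^esub>"
      and y: "y \<in> carrier X" "m \<ge> 1" "\<And>a. a \<in> ideal_power R I m \<Longrightarrow> a \<odot>\<^bsub>X\<^esub> y = \<zero>\<^bsub>X\<^esub>"
      by (auto simp: torsion_def)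
    have "a \<odot>\<^bsub>X\<^esub> (x \<oplus>\<^bsub>X\<^esub> y) = \<zero>\<^bsub>X\<^esub>" if a: "a \<in> ideal_power R I (max n m)" for a
      using x y a ideal_power_antimono[OF R I, of n "max n m"] ideal_power_antimono[OF R I, of m "max n m"]
        sub[of "max n m"]
      by (auto simp: X.smult_r_distr subset_iff)
    then show "x \<oplus>\<^bsub>X\<^esub> y \<in> torsion R I X"
      using x y by (auto simp: torsion_def intro!: exI[of _ "max n m"])
  next
    fix a x assume a: "a \<in> carrier R" and "x \<in> torsion R I X"
    then obtain n where x: "x \<in> carrier X" "n \<ge> 1" "\<And>b. b \<in> ideal_power R I n \<Longrightarrow> b \<odot>\<^bsub>X\<^esub> x = \<zero>\<^bsub>X\<^esub>"
      by (auto simp: torsion_def)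
    have "b \<odot>\<^bsub>X\<^esub> (a \<odot>\<^bsub>X\<^esub> x) = \<zero>\<^bsub>X\<^esub>" if b: "b \<in> ideal_power R I n" for b
    proof -
      have "b \<in> carrier R" using b sub by auto
      from linear_map_smult[OF homothety_linear[OF X this] a x(1)] show ?thesis
        using x(3)[OF b] a by simp
    qed
    then show "a \<odot>\<^bsub>X\<^esub> x \<in> torsion R I X" using a x by (auto simp: torsion_def)
  qed (auto simp: torsion_def)
qed

lemma power_mem_ideal_power:
  assumes "cring R" "ideal I R" "a \<in> I"
  shows "a [^]\<^bsub>R\<^esub> n \<in> ideal_power R I n"
proof (induction n)
  case 0
  interpret cring R by fact
  show ?case by (simp add: ideal_power_def ideals_set_def nat_pow_def)
next
  case (Suc n)
  interpret cring R by fact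
  show ?case
    unfolding ideal_power_Suc using ideal_prod.prod[OF Suc assms(3)] by simp
qed

section \<open>Graded rings\<close>

context graded_ring
begin

lemma component_subset: "A n \<subseteq> carrier R"
  by (rule additive_subgroup.a_subset[OF component_subgroup])

lemma finsum_closed_induct:
  assumes "finite F" "\<And>n. n \<in> F \<Longrightarrow> f n \<in> carrier R \<and> Q (f n)" "Q \<zero>"
    and "\<And>x y. \<lbrakk>x \<in> carrier R; y \<in> carrier R; Q x; Q y\<rbrakk> \<Longrightarrow> Q (x \<oplus> y)"
  shows "Q (\<Oplus>n\<in>F. f n)"
  using assms(1,2)
proof (induction F rule: finite_induct)
  case (insert n F)
  then have "f \<in> F \<rightarrow> carrier R" by auto
  then show ?case using insert assms(4)[of "f n" "\<Oplus>n\<in>F. f n"] by simp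
qed (simp add: assms(3))

lemma homogeneous_induct [consumes 1, case_names zero add homogeneous]:
  assumes "x \<in> carrier R" and "Q \<zero>"
    and "\<And>x y. \<lbrakk>x \<in> carrier R; y \<in> carrier R; Q x; Q y\<rbrakk> \<Longrightarrow> Q (x \<oplus> y)"
    and "\<And>n a. a \<in> A n \<Longrightarrow> Q a"
  shows "Q x"
proof -
  obtain f where f: "\<And>n. f n \<in> A n" "finite {n. f n \<noteq> \<zero>}" "x = (\<Oplus>n\<in>{n. f n \<noteq> \<zero>}. f n)"
    using decomposition[OF assms(1)] by blast
  show ?thesis unfolding f(3)
    by (rule finsum_closed_induct[OF f(2)]) (use f(1) component_subset assms in blast)+
qed

lemma irrelevant_induct [consumes 1, case_names zero add homogeneous]:
  assumes "x \<in> irrelevant_ideal R A" and "Q \<zero>"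
    and "\<And>x y. \<lbrakk>x \<in> carrier R; y \<in> carrier R; Q x; Q y\<rbrakk> \<Longrightarrow> Q (x \<oplus> y)"
    and "\<And>n a. \<lbrakk>0 < n; a \<in> A n\<rbrakk> \<Longrightarrow> Q a"
  shows "Q x"
proof -
  obtain F f where f: "x = (\<Oplus>n\<in>F. f n)" "finite F" "0 \<notin> F" "\<And>n. n \<in> F \<Longrightarrow> f n \<in> A n"
    using assms(1) unfolding irrelevant_ideal_def by blast
  show ?thesis unfolding f(1)
  proof (rule finsum_closed_induct[OF f(2)])
    fix n assume n: "n \<in> F"
    then have "0 < n" using f(3) by (metis gr0I)
    then show "f n \<in> carrier R \<and> Q (f n)" using f(4)[OF n] component_subset assms(4) by blast
  qed (use assms in auto)
qed

lemma irrelevant_zero: "\<zero> \<in> irrelevant_ideal R A"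
  unfolding irrelevant_ideal_def by (auto intro!: exI[of _ "{}"])

lemma irrelevant_homogeneous: "\<lbrakk>0 < n; a \<in> A n\<rbrakk> \<Longrightarrow> a \<in> irrelevant_ideal R A"
  unfolding irrelevant_ideal_def using component_subset[of n]
  by (auto intro!: exI[of _ "{n}"] exI[of _ "\<lambda>_. a"] simp: finsum_insert)

lemma irrelevant_add:
  assumes "x \<in> irrelevant_ideal R A" "y \<in> irrelevant_ideal R A"
  shows "x \<oplus> y \<in> irrelevant_ideal R A"
proof -
  obtain F f where f: "x = (\<Oplus>n\<in>F. f n)" "finite F" "0 \<notin> F" "\<And>n. n \<in> F \<Longrightarrow> f n \<in> A n"
    using assms(1) unfolding irrelevant_ideal_def by blast
  obtain F' f' where f': "y = (\<Oplus>n\<in>F'. f' n)" "finite F'" "0 \<notin> F'" "\<And>n. n \<in> F' \<Longrightarrow> f' n \<in> A n"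
    using assms(2) unfolding irrelevant_ideal_def by blast
  \<comment> \<open>Extension by zero gives both sums the index set \<open>F \<union> F'\<close>, so
    that they can be added degree by degree.\<close>
  define g g' where "g n = (if n \<in> F then f n else \<zero>)" and "g' n = (if n \<in> F' then f' n else \<zero>)" for n
  have zA: "\<zero> \<in> A n" for n by (rule additive_subgroup.zero_closed[OF component_subgroup])
  have gA: "g n \<in> A n" "g' n \<in> A n" for n using f(4) f'(4) zA by (auto simp: g_def g'_def)
  then have gR: "g n \<in> carrier R" "g' n \<in> carrier R" for n using component_subset by blast+
  have fR: "f n \<in> carrier R" if "n \<in> F" for n using f(4)[OF that] component_subset by blast
  have fR': "f' n \<in> carrier R" if "n \<in> F'" for n using f'(4)[OF that] component_subset by blast
  have x: "x = (\<Oplus>n\<in>F \<union> F'. g n)"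
    unfolding f(1) by (rule add.finprod_mono_neutral_cong_left) (use f f' gR fR in \<open>auto simp: g_def\<close>)
  have y: "y = (\<Oplus>n\<in>F \<union> F'. g' n)"
    unfolding f'(1) by (rule add.finprod_mono_neutral_cong_left) (use f f' gR fR' in \<open>auto simp: g'_def\<close>)
  have "x \<oplus> y = (\<Oplus>n\<in>F \<union> F'. g n \<oplus> g' n)"
    unfolding x y using gR by (intro finsum_addf[symmetric]) auto
  moreover have "g n \<oplus> g' n \<in> A n" for n
    using gA by (rule additive_subgroup.a_closed[OF component_subgroup])
  moreover have "finite (F \<union> F')" "0 \<notin> F \<union> F'" using f f' by auto
  ultimately show ?thesis
    unfolding irrelevant_ideal_def by (intro CollectI exI[of _ "F \<union> F'"] exI[of _ "\<lambda>n. g n \<oplus> g' n"]) simp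
qed

lemma irrelevant_subset: "irrelevant_ideal R A \<subseteq> carrier R"
proof
  fix x assume "x \<in> irrelevant_ideal R A"
  then show "x \<in> carrier R"
    by (induction rule: irrelevant_induct) (use component_subset in auto)
qed

text \<open>Both factors are reduced to homogeneous elements; their degrees add up, and that of the
  second is positive.\<close>

lemma irrelevant_mult:
  assumes "a \<in> carrier R" "x \<in> irrelevant_ideal R A"
  shows "a \<otimes> x \<in> irrelevant_ideal R A"
proof -
  have xR: "x \<in> carrier R" using assms(2) irrelevant_subset by auto
  show ?thesis using assms(1)
  proof (induction a rule: homogeneous_induct)
    case zero
    show ?case using xR irrelevant_zero by simp
  next
    case (add a b)
    then show ?case using xR irrelevant_add by (simp add: l_distr)
  next
    case (homogeneous n a)
    then have aR: "a \<in> carrier R" using component_subset by auto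
    show ?case using assms(2)
    proof (induction x rule: irrelevant_induct)
      case zero
      show ?case using aR irrelevant_zero by simp
    next
      case (add x y)
      then show ?case using aR irrelevant_add by (simp add: r_distr)
    next
      case (homogeneous m x)
      then show ?case using component_mult[OF \<open>a \<in> A n\<close>] irrelevant_homogeneous[of "n + m"] by simp
    qed
  qed
qed

lemma irrelevant_ideal_is_ideal: "ideal (irrelevant_ideal R A) R"
  by (rule submodule_self_imp_ideal[OF cring_axioms module_submoduleI[OF self_module_module[OF cring_axioms]]])
    (use irrelevant_subset irrelevant_zero irrelevant_add irrelevant_mult in \<open>auto simp: self_module_simps\<close>)

text \<open>Because of this, a scalar acts on elements killed by R+ through its part in
  \<open>A 0\<close>.\<close>

lemma degree_zero_plus_irrelevant:
  assumes "x \<in> carrier R"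
  shows "\<exists>r\<in>A 0. \<exists>p\<in>irrelevant_ideal R A. x = r \<oplus> p"
  using assms
proof (induction rule: homogeneous_induct)
  case zero
  show ?case
    using irrelevant_zero additive_subgroup.zero_closed[OF component_subgroup, of 0] by force
next
  case (add x y)
  then obtain r s p q where *: "r \<in> A 0" "s \<in> A 0" "p \<in> irrelevant_ideal R A" "q \<in> irrelevant_ideal R A"
    "x = r \<oplus> p" "y = s \<oplus> q" by blast
  then have "x \<oplus> y = (r \<oplus> s) \<oplus> (p \<oplus> q)"
    using component_subset irrelevant_subset by (simp add: a_ac subset_iff)
  then show ?case
    using * irrelevant_add additive_subgroup.a_closed[OF component_subgroup, of r 0 s] by blast
next
  case (homogeneous n a)
  then have aR: "a \<in> carrier R" using component_subset by auto
  show ?case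
  proof (cases "n = 0")
    case True
    then show ?thesis using homogeneous aR irrelevant_zero by force
  next
    case False
    then have "a \<in> irrelevant_ideal R A" using homogeneous irrelevant_homogeneous by blast
    then show ?thesis
      using aR additive_subgroup.zero_closed[OF component_subgroup, of 0] by force
  qed
qed

text \<open>Such an \<open>x\<close> has one decomposition concentrated in degree 0 and another
  without a term in degree 0; uniqueness makes them equal.\<close>

lemma degree_zero_Int_irrelevant:
  assumes "x \<in> A 0" "x \<in> irrelevant_ideal R A"
  shows "x = \<zero>"
proof -
  have xR: "x \<in> carrier R" using assms(1) component_subset by auto
  have zA: "\<zero> \<in> A n" for n by (rule additive_subgroup.zero_closed[OF component_subgroup])
  obtain F f where f: "x = (\<Oplus>n\<in>F. f n)" "finite F" "0 \<notin> F" "\<And>n. n \<in> F \<Longrightarrow> f n \<in> A n"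
    using assms(2) unfolding irrelevant_ideal_def by blast
  define g where "g n = (if n \<in> F then f n else \<zero>)" for n
  define h where "h n = (if n = 0 then x else \<zero>)" for n :: nat
  have gsub: "{n. g n \<noteq> \<zero>} \<subseteq> F" by (auto simp: g_def)
  have fR: "f n \<in> carrier R" if "n \<in> F" for n using f(4)[OF that] component_subset by blast
  have "(\<Oplus>n\<in>F. f n) = (\<Oplus>n\<in>{n. g n \<noteq> \<zero>}. g n)"
    by (rule add.finprod_mono_neutral_cong_right) (use f fR gsub in \<open>auto simp: g_def\<close>)
  then have g: "(\<forall>n. g n \<in> A n) \<and> finite {n. g n \<noteq> \<zero>} \<and> x = (\<Oplus>n\<in>{n. g n \<noteq> \<zero>}. g n)"
    using f zA finite_subset[OF gsub] by (auto simp: g_def)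
  have hsub: "{n. h n \<noteq> \<zero>} \<subseteq> {0}" by (auto simp: h_def)
  have "(\<Oplus>n\<in>{n. h n \<noteq> \<zero>}. h n) = (\<Oplus>n\<in>{0}. h n)"
    by (rule add.finprod_mono_neutral_cong_left) (use xR hsub in \<open>auto simp: h_def\<close>)
  also have "\<dots> = x" using xR by (simp add: h_def)
  finally have h: "(\<forall>n. h n \<in> A n) \<and> finite {n. h n \<noteq> \<zero>} \<and> x = (\<Oplus>n\<in>{n. h n \<noteq> \<zero>}. h n)"
    using assms(1) zA finite_subset[OF hsub] by (auto simp: h_def)
  have "g = h" using decomposition[OF xR] g h by blast
  then have "g 0 = h 0" by simp
  then show ?thesis using f(3) by (simp add: g_def h_def)
qed

end

section \<open>Restriction of scalars to the local base ring\<close>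

context noetherian_homogeneous_ring
begin

abbreviation base_ring where "base_ring \<equiv> R\<lparr>carrier := A 0\<rparr>"

lemma base_ring_cring: "cring base_ring"
proof -
  interpret B: noetherian_ring base_ring by (rule base_noetherian)
  show ?thesis
    by (rule cring.intro[OF B.ring_axioms], unfold_locales) (use m_comm[OF subsetD[OF component_subset] subsetD[OF component_subset]] in auto)
qed

text \<open>The record \<open>base_ring\<close> keeps the unit of \<open>R\<close>, so its being a
  ring forces the unit into \<open>A 0\<close>.\<close>

lemma one_in_base: "\<one> \<in> A 0"
proof -
  interpret B: cring base_ring by (rule base_ring_cring)
  show ?thesis using B.one_closed by simp
qed

lemma restrict_scalars:
  assumes "module R X" shows "module base_ring X"
proof -
  interpret X: module R X by fact
  note A0 = subsetD[OF component_subset[of 0]]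
  show ?thesis
    by (rule moduleI[OF base_ring_cring X.abelian_group_axioms])
      (use A0 in \<open>auto simp: X.smult_l_distr X.smult_r_distr X.smult_assoc1\<close>)
qed

lemma restrict_submodule:
  assumes "module R X" "submodule H R X" shows "submodule H base_ring X"
  using assms(2) component_subset[of 0]
  by (intro module_submoduleI[OF restrict_scalars[OF assms(1)]])
    (auto intro: submodule_zero submodule_add submodule.smult_closed dest: submodule_subset)

text \<open>The induction along \<open>generate_ring\<close> writes each ring element as a part in
  \<open>A 0\<close> plus a part in R+ that kills \<open>x\<close>. For \<open>p\<close> in R+ the
  first part vanishes, since \<open>A 0\<close> and R+ meet in zero only.\<close>

lemma irrelevant_annihilates:
  assumes X: "module R X" and x: "x \<in> carrier X"
    and L: "L \<subseteq> A 1" "generate_ring R (A 0 \<union> L) = carrier R"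
    and Lx: "\<And>l. l \<in> L \<Longrightarrow> l \<odot>\<^bsub>X\<^esub> x = \<zero>\<^bsub>X\<^esub>" and p: "p \<in> irrelevant_ideal R A"
  shows "p \<odot>\<^bsub>X\<^esub> x = \<zero>\<^bsub>X\<^esub>"
proof -
  interpret X: module R X by fact
  interpret I: ideal "irrelevant_ideal R A" R by (rule irrelevant_ideal_is_ideal)
  let ?I = "irrelevant_ideal R A"
  note A0 = subsetD[OF component_subset[of 0]]
  interpret A0: additive_subgroup "A 0" R by (rule component_subgroup)
  have dec: "\<exists>r0\<in>A 0. \<exists>q\<in>?I. r = r0 \<oplus> q \<and> q \<odot>\<^bsub>X\<^esub> x = \<zero>\<^bsub>X\<^esub>"
    if "r \<in> generate_ring R (A 0 \<union> L)" for r
    using that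
  proof (induction rule: generate_ring.induct)
    case one
    show ?case using one_in_base x by (intro bexI[of _ \<one>] bexI[of _ \<zero>]) auto
  next
    case (incl h)
    then show ?case
    proof
      assume h: "h \<in> A 0"
      then show ?thesis using x A0 by (intro bexI[of _ h] bexI[of _ \<zero>]) auto
    next
      assume h: "h \<in> L"
      then have "h \<in> ?I" using L(1) irrelevant_homogeneous[of 1 h] by auto
      then show ?thesis using h Lx I.Icarr by (intro bexI[of _ \<zero>] bexI[of _ h]) auto
    qed
  next
    case (a_inv h)
    then obtain r q where *: "r \<in> A 0" "q \<in> ?I" "h = r \<oplus> q" "q \<odot>\<^bsub>X\<^esub> x = \<zero>\<^bsub>X\<^esub>" by blast
    then show ?case
      using x A0 I.Icarr by (intro bexI[of _ "\<ominus> r"] bexI[of _ "\<ominus> q"]) (auto simp: minus_add X.smult_l_minus)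
  next
    case (eng_add h k)
    then obtain r q s t where *: "r \<in> A 0" "q \<in> ?I" "h = r \<oplus> q" "q \<odot>\<^bsub>X\<^esub> x = \<zero>\<^bsub>X\<^esub>"
      "s \<in> A 0" "t \<in> ?I" "k = s \<oplus> t" "t \<odot>\<^bsub>X\<^esub> x = \<zero>\<^bsub>X\<^esub>" by blast
    then show ?case
      using x A0 I.Icarr
      by (intro bexI[of _ "r \<oplus> s"] bexI[of _ "q \<oplus> t"]) (auto simp: a_ac X.smult_l_distr)
  next
    case (eng_mult h k)
    then obtain r q s t where *: "r \<in> A 0" "q \<in> ?I" "h = r \<oplus> q" "q \<odot>\<^bsub>X\<^esub> x = \<zero>\<^bsub>X\<^esub>"
      "s \<in> A 0" "t \<in> ?I" "k = s \<oplus> t" "t \<odot>\<^bsub>X\<^esub> x = \<zero>\<^bsub>X\<^esub>" by blast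
    then have carr: "r \<in> carrier R" "q \<in> carrier R" "s \<in> carrier R" "t \<in> carrier R" using A0 I.Icarr by auto
    \<comment> \<open>Apart from \<open>r \<otimes> s\<close>, every term has a factor
      \<open>q\<close> or \<open>t\<close>, so the remainder lies in R+ and kills
      \<open>x\<close>.\<close>
    have "h \<otimes> k = r \<otimes> s \<oplus> (r \<otimes> t \<oplus> (s \<otimes> q \<oplus> t \<otimes> q))"
      using carr *(3,7) by (simp add: l_distr r_distr m_ac a_ac)
    moreover have "r \<otimes> s \<in> A 0" using component_mult[OF *(1,5)] by simp
    moreover have "r \<otimes> t \<oplus> (s \<otimes> q \<oplus> t \<otimes> q) \<in> ?I" using * carr by (simp add: I.I_l_closed)
    moreover have "(r \<otimes> t \<oplus> (s \<otimes> q \<oplus> t \<otimes> q)) \<odot>\<^bsub>X\<^esub> x = \<zero>\<^bsub>X\<^esub>"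
      using * carr x by (simp add: X.smult_l_distr X.smult_assoc1)
    ultimately show ?case by blast
  qed
  have pR: "p \<in> carrier R" using p by (rule I.Icarr)
  then obtain r q where *: "r \<in> A 0" "q \<in> ?I" "p = r \<oplus> q" "q \<odot>\<^bsub>X\<^esub> x = \<zero>\<^bsub>X\<^esub>"
    using dec[of p] L(2) by auto
  have "r = p \<ominus> q" using * A0 I.Icarr by (simp add: a_minus_def a_assoc r_neg)
  then have "r \<in> ?I" using p *(2) by (simp add: a_minus_def)
  then have "r = \<zero>" using *(1) by (rule degree_zero_Int_irrelevant[rotated])
  then show ?thesis using * I.Icarr by simp
qed

lemma cofinite_torsion_artinian:
  assumes X: "module R X" and cof: "cofinite_module R (irrelevant_ideal R A) X"
  shows "artinian_module R (torsion_module R (genideal R m0) X)"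
proof -
  interpret X: module R X by fact
  interpret B: noetherian_ring base_ring by (rule base_noetherian)
  let ?I = "irrelevant_ideal R A" and ?W = "torsion R (genideal R m0) X"
  let ?C = "{x \<in> carrier X. \<forall>a\<in>?I. a \<odot>\<^bsub>X\<^esub> x = \<zero>\<^bsub>X\<^esub>}"
  note I = irrelevant_ideal_is_ideal
  note XB = restrict_scalars[OF X]
  note A0 = subsetD[OF component_subset[of 0]]
  have m0: "maximalideal m0 base_ring" using base_local by blast
  interpret m0: maximalideal m0 base_ring by (rule m0)
  have m0A: "m0 \<subseteq> A 0" using m0.a_subset by simp
  then have m0R: "m0 \<subseteq> carrier R" using A0 by auto
  obtain L where L: "finite L" "L \<subseteq> A 1" "generate_ring R (A 0 \<union> L) = carrier R"
    using generated_in_degree_one by blast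
  have LI: "L \<subseteq> ?I" using L(2) irrelevant_homogeneous[of 1] by auto
  obtain L0 where L0: "finite L0" "L0 \<subseteq> A 0" "m0 = genideal base_ring L0"
    using B.finetely_gen[OF m0.ideal_axioms] by auto
  have L0m: "L0 \<subseteq> m0" using B.genideal_self[of L0] L0 by simp

  note W = torsion_submodule[OF X genideal_ideal[OF m0R]]
  \<comment> \<open>The finite sets \<open>L\<close> and \<open>L0\<close> suit the induction over
    single elements; that R+ and \<open>m0\<close> as a whole kill \<open>V\<close> is recovered
    below.\<close>
  define V where "V = {x \<in> ?W. \<forall>a\<in>L \<union> L0. a \<odot>\<^bsub>X\<^esub> x = \<zero>\<^bsub>X\<^esub>}"
  have LR: "L \<union> L0 \<subseteq> carrier R" using component_subset L(2) L0(2) by blast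
  have V: "submodule V R X" unfolding V_def by (rule annihilated_submodule[OF X W LR])
  have VX: "V \<subseteq> carrier X" by (rule submodule_subset[OF V])

  obtain cs where cs: "set cs \<subseteq> ?C" "?C \<subseteq> list_span R X cs"
    using fin_gen_Ext_0_imp[OF X I] cof unfolding cofinite_module_def by blast
  then have csX: "set cs \<subseteq> carrier X" by auto
  have C: "submodule ?C R X"
    by (rule annihilated_submodule[OF X X.carrier_is_submodule cring_ideal_subset[OF I]])
  note S = list_span_submodule[OF XB csX]
  have SC: "list_span base_ring X cs \<subseteq> ?C"
    by (rule list_span_minimal[OF restrict_submodule[OF X C] cs(1)])
  \<comment> \<open>On \<open>?C\<close> scalars from R+ act as zero, so a span over
    \<open>A 0\<close> inside \<open>?C\<close> is already stable under \<open>R\<close>.\<close>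
  have "submodule (list_span base_ring X cs) R X"
  proof (rule module_submoduleI[OF X])
    fix a x assume a: "a \<in> carrier R" and x: "x \<in> list_span base_ring X cs"
    obtain r p where rp: "r \<in> A 0" "p \<in> ?I" "a = r \<oplus> p"
      using degree_zero_plus_irrelevant[OF a] by blast
    have "a \<odot>\<^bsub>X\<^esub> x = r \<odot>\<^bsub>X\<^esub> x \<oplus>\<^bsub>X\<^esub> p \<odot>\<^bsub>X\<^esub> x"
      using rp A0 subsetD[OF cring_ideal_subset[OF I]] subsetD[OF SC x] by (simp add: X.smult_l_distr)
    also have "\<dots> = r \<odot>\<^bsub>X\<^esub> x" using SC x rp A0 by auto
    also have "\<dots> \<in> list_span base_ring X cs" using submodule.smult_closed[OF S _ x] rp by simp
    finally show "a \<odot>\<^bsub>X\<^esub> x \<in> list_span base_ring X cs" .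
  qed (use submodule_subset[OF S] submodule_zero[OF S] submodule_add[OF S] in auto)
  then have "list_span R X cs \<subseteq> list_span base_ring X cs"
    by (rule list_span_minimal) (rule set_subset_list_span[OF XB csX])
  moreover have "V \<subseteq> ?C"
    using irrelevant_annihilates[OF X _ L(2,3)] VX by (auto simp: V_def)
  ultimately have "V \<subseteq> list_span base_ring X cs" using cs(2) by blast
  then obtain vs where vs: "set vs \<subseteq> carrier X" "V = list_span base_ring X vs"
    using noetherian_submodule_list_span[OF base_noetherian XB csX restrict_submodule[OF X V]] by blast

  have "a \<odot>\<^bsub>X\<^esub> v = \<zero>\<^bsub>X\<^esub>" if a: "a \<in> m0" and v: "v \<in> set vs" for a v
  proof -
    have vV: "v \<in> V" using set_subset_list_span[OF XB vs(1)] vs(2) v by auto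
    \<comment> \<open>The annihilator of \<open>v\<close> in \<open>A 0\<close> is an ideal, so it
      contains \<open>m0\<close> as soon as it contains the generators \<open>L0\<close>.\<close>
    have "m0 \<subseteq> {r \<in> carrier base_ring. r \<odot>\<^bsub>X\<^esub> v = \<zero>\<^bsub>X\<^esub>}"
      unfolding L0(3)
      by (rule B.genideal_minimal[OF annihilator_ideal[OF XB]]) (use vV VX L0(2) in \<open>auto simp: V_def\<close>)
    then show ?thesis using a by auto
  qed
  then have "descending_chain_condition base_ring X V"
    unfolding vs(2) by (rule descending_chain_condition_maximal_annihilator[OF m0 XB vs(1)])
  \<comment> \<open>Chains of \<open>R\<close>-submodules are in particular chains of submodules
    over \<open>A 0\<close>.\<close>
  then have dccV: "descending_chain_condition R X V"
    using restrict_submodule[OF X] unfolding descending_chain_condition_def by blast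

  \<comment> \<open>For \<open>L\<close> the exponent comes from the support condition, for
    \<open>L0\<close> from the definition of torsion, as a power of an element of the ideal lies in
    the corresponding power of the ideal.\<close>
  have "\<exists>n::nat. (a [^] n) \<odot>\<^bsub>X\<^esub> x = \<zero>\<^bsub>X\<^esub>" if a: "a \<in> L \<union> L0" and x: "x \<in> ?W" for a x
    using a
  proof
    assume "a \<in> L"
    then show ?thesis
      using support_subset_imp_torsion[OF X cring_ideal_subset[OF I]] cof LI x
      unfolding cofinite_module_def torsion_def by blast
  next
    assume "a \<in> L0"
    then have "a \<in> genideal R m0" using L0m genideal_self[OF m0R] by blast
    then show ?thesis
      using x power_mem_ideal_power[OF cring_axioms genideal_ideal[OF m0R]] by (auto simp: torsion_def)
  qed
  then have dcc: "descending_chain_condition R X ?W"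
    using dccV L(1) L0(1) unfolding V_def
    by (intro descending_chain_condition_torsion_finite[OF X _ LR W]) auto

  \<comment> \<open>\<open>artinian_module\<close> speaks of submodules of the restricted record,
    the chain condition of submodules of \<open>X\<close>.\<close>
  have sub: "submodule H R X \<and> H \<subseteq> ?W" if H: "submodule H R (X\<lparr>carrier := ?W\<rparr>)" for H
  proof -
    have HW: "H \<subseteq> ?W" using submodule_subset[OF H] by simp
    then have "submodule H R X"
      using submodule_subset[OF W] submodule_zero[OF H] submodule_add[OF H] submodule.smult_closed[OF H]
      by (intro module_submoduleI[OF X]) auto
    then show ?thesis using HW by blast
  qed
  show ?thesis
    unfolding artinian_module_def torsion_module_def
  proof (intro conjI allI impI)
    show "module R (X\<lparr>carrier := ?W\<rparr>)" by (rule submodule.submodule_is_module[OF W X])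
    fix H :: "nat \<Rightarrow> _"
    assume H: "(\<forall>n. submodule (H n) R (X\<lparr>carrier := ?W\<rparr>)) \<and> (\<forall>n. H (Suc n) \<subseteq> H n)"
    obtain n where "\<And>k. n \<le> k \<Longrightarrow> H k = H n"
      by (rule descending_chain_conditionD[OF dcc, of H]) (use H sub in blast)+
    then show "\<exists>n. \<forall>k\<ge>n. H k = H n" by blast
  qed
qed

end

theorem lemma2p5:
  fixes R :: "('a, 'c) ring_scheme" and A :: "nat \<Rightarrow> 'a set" and m0 :: "'a set"
    and M :: "('a, 'm, 'd) module_scheme" and GM :: "int \<Rightarrow> 'm set"
    and N :: "('a, 'x, 'e) module_scheme" and GN :: "int \<Rightarrow> 'x set"
    and i :: nat
  assumes "noetherian_homogeneous_ring R A m0"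
    and "graded_module R A M GM" and "fin_gen_module R M"
    and "graded_module R A N GN" and "fin_gen_module R N"
    and "cofinite_module R (irrelevant_ideal R A)
           (local_cohomology R (irrelevant_ideal R A) i M N)"
  shows "artinian_module R
           (torsion_module R (genideal R m0)
             (local_cohomology R (irrelevant_ideal R A) i M N))"
proof -
  interpret noetherian_homogeneous_ring R A m0 by fact
  have "module R M" "module R N"
    using assms(2,4) by (simp_all add: graded_module_def)
  then have "module R (local_cohomology R (irrelevant_ideal R A) i M N)"
    by (rule local_cohomology_module[OF irrelevant_ideal_is_ideal])
  then show ?thesis using assms(6) by (rule cofinite_torsion_artinian)
qed

end
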